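(* Let $P$ be an $n$-element unit interval order, with elements labeled $1,\dots,n$ so that $\beta(1)\le\cdots\le\beta(n)$, and let $w=w(P)\in\mathfrak S_n$ be the corresponding $312$-avoiding permutation. Then $$\sum_{\lambda\vdash n}\phi_q^\lambda(\mathrm{inc}(P))=\sum_{v\le w}q^{\ell(v)}=\sum_Uq^{\mathrm{inv}(U)},$$ where the middle sum is over $v\in\mathfrak S_n$ below $w$ in the Bruhat order, $\ell(v)$ is the Coxeter length, and $U$ in the final sum varies over all $P$-excedance-free $P$-permutations.
   Context: A unit interval order is a finite poset having no induced subposet isomorphic to a disjoint sum of a 3-element chain and a 1-element chain, and none isomorphic to a disjoint sum of two 2-element chains. For $y\in P$ put $\beta(y)=\#\{x\in P: x\le_Py\}-\#\{z\in P: z\ge_Py\}$. With $P$ labeled by $[n]$ so that $\beta(1)\le\cdots\le\beta(n)$, define $w(P)=w_1\cdots w_n$ recursively by $w_j=\max(\{i: i\not>_Pj\}\setminus\{w_1,\dots,w_{j-1}\})$; this is a $312$-avoiding permutation. The incomparability graph $\mathrm{inc}(P)$ has vertex set $P=[n]$ and an edge $\{i,j\}$ for each incomparable pair. For a proper coloring $\kappa:[n]\to\{1,2,\dots\}$ of $\mathrm{inc}(P)$, let $\mathrm{inv}_{\mathrm{inc}(P)}(\kappa)$ be the number of edges $\{i,j\}$ with $i<j$ and $\kappa(i)>\kappa(j)$. The Shareshian–Wachs chromatic quasisymmetric function is $X_{\mathrm{inc}(P),q}=\sum_\kappa q^{\mathrm{inv}_{\mathrm{inc}(P)}(\kappa)}x_{\kappa(1)}\cdots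 x_{\kappa(n)}$, summed over proper colorings $\kappa$. For $P$ a unit interval order labeled by $[n]$ so that $\beta(1)\le\cdots\le\beta(n)$ it is known to be symmetric, and $\phi_q^\lambda(\mathrm{inc}(P))$ denotes the coefficients in its elementary expansion: $X_{\mathrm{inc}(P),q}=\sum_{\lambda\vdash n}\phi_q^\lambda(\mathrm{inc}(P))\,e_\lambda$. A $P$-permutation is a listing $U=v_1\cdots v_n$ of all elements of $P=[n]$. It is $P$-excedance-free if there is no $i$ with $v_i>_Pi$. $\mathrm{inv}(U)$ is the number of pairs $(i,j)$ with $j>i$ (as integers) and $j$ appearing to the left of $i$ in $U$. *)

theory Defs
  imports
    "HOL-Library.Multiset"
    "HOL-Library.FuncSet"
    "HOL-Combinatorics.Combinatorics"
    "HOL-Computational_Algebra.Polynomial"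
begin

section \<open>Unit interval orders\<close>

text \<open>
  A poset is a carrier set \<open>A\<close> together with its non-strict order relation \<open>r\<close>,
  subject to \<^const>\<open>partial_order_on\<close>.
\<close>

definition strictly_below :: "'a rel \<Rightarrow> 'a \<Rightarrow> 'a \<Rightarrow> bool" where
  "strictly_below r x y \<longleftrightarrow> (x, y) \<in> r \<and> x \<noteq> y"

definition incomparable :: "'a rel \<Rightarrow> 'a \<Rightarrow> 'a \<Rightarrow> bool" where
  "incomparable r x y \<longleftrightarrow> (x, y) \<notin> r \<and> (y, x) \<notin> r"

definition has_induced_3_plus_1 :: "'a set \<Rightarrow> 'a rel \<Rightarrow> bool" where
  "has_induced_3_plus_1 A r \<longleftrightarrow>
     (\<exists>a\<in>A. \<exists>b\<in>A. \<exists>c\<in>A. \<exists>d\<in>A.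
        strictly_below r a b \<and> strictly_below r b c \<and>
        incomparable r a d \<and> incomparable r b d \<and> incomparable r c d)"

definition has_induced_2_plus_2 :: "'a set \<Rightarrow> 'a rel \<Rightarrow> bool" where
  "has_induced_2_plus_2 A r \<longleftrightarrow>
     (\<exists>a\<in>A. \<exists>b\<in>A. \<exists>c\<in>A. \<exists>d\<in>A.
        strictly_below r a b \<and> strictly_below r c d \<and>
        incomparable r a c \<and> incomparable r a d \<and>
        incomparable r b c \<and> incomparable r b d)"

definition unit_interval_order :: "'a set \<Rightarrow> 'a rel \<Rightarrow> bool" where
  "unit_interval_order A r \<longleftrightarrow>
     finite A \<and> partial_order_on A r \<and>
     \<not> has_induced_3_plus_1 A r \<and> \<not> has_induced_2_plus_2 A r"

definition beta :: "'a set \<Rightarrow> 'a rel \<Rightarrow> 'a \<Rightarrow> int" where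
  "beta A r y = int (card {x\<in>A. (x, y) \<in> r}) - int (card {z\<in>A. (y, z) \<in> r})"

text \<open>
  The word \<open>w\<^sub>1 \<dots> w\<^sub>n\<close> as a function on \<^typ>\<open>nat\<close>, extended by the identity outside
  \<open>{1..n}\<close> in accordance with \<^const>\<open>permutes\<close>. If \<open>beta\<close> is weakly increasing on
  \<open>{1..n}\<close>, the argument of \<^const>\<open>Max\<close> is nonempty: its first part contains \<open>{1..j}\<close>.
\<close>

fun w_perm :: "nat \<Rightarrow> nat rel \<Rightarrow> nat \<Rightarrow> nat" where
  "w_perm n P j =
     (if j \<in> {1..n}
      then Max ({i\<in>{1..n}. \<not> strictly_below P j i} - w_perm n P ` {1..<j})
      else j)"

declare w_perm.simps [simp del]


section \<open>Symmetric functions and chromatic quasisymmetric functions\<close>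

text \<open>
  Formal power series in \<open>x\<^sub>1, x\<^sub>2, \<dots>\<close> over \<open>\<int>[q]\<close>: the monomial
  \<open>x\<^sub>a x\<^sub>b \<dots> x\<^sub>c\<close> is the multiset \<open>{#a, b, \<dots>, c#}\<close> of its variable indices, and a series
  assigns to each monomial its coefficient. There is no variable \<open>x\<^sub>0\<close>, so the series
  below vanish at multisets containing \<open>0\<close>. An \<^typ>\<open>int poly\<close> is a polynomial in \<open>q\<close>,
  and \<open>monom 1 k\<close> is \<open>q^k\<close>.
\<close>

type_synonym qseries = "nat multiset \<Rightarrow> int poly"

definition series_one :: qseries where
  "series_one M = (if M = {#} then 1 else 0)"

definition series_mult :: "qseries \<Rightarrow> qseries \<Rightarrow> qseries" where
  "series_mult f g M = (\<Sum>A | A \<subseteq># M. f A * g (M - A))"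

definition elementary :: "nat \<Rightarrow> qseries" where
  "elementary k M = (if \<exists>S. finite S \<and> card S = k \<and> S \<subseteq> {1..} \<and> M = mset_set S then 1 else 0)"

definition elementary_product :: "nat list \<Rightarrow> qseries" where
  "elementary_product lam = foldr series_mult (map elementary lam) series_one"

definition partitions :: "nat \<Rightarrow> nat list set" where
  "partitions n = {lam. sorted_wrt (\<ge>) lam \<and> (\<forall>k\<in>set lam. k \<ge> 1) \<and> sum_list lam = n}"

text \<open>
  The coefficients of a symmetric function, homogeneous of degree \<open>n\<close>, in the basis of
  elementary symmetric functions. The first conjunct only makes the coefficient function
  unique as a function on all lists.
\<close>

definition elementary_coeffs :: "nat \<Rightarrow> qseries \<Rightarrow> nat list \<Rightarrow> int poly" where
  "elementary_coeffs n X =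
     (THE c. (\<forall>lam. lam \<notin> partitions n \<longrightarrow> c lam = 0) \<and>
             (\<forall>M. X M = (\<Sum>lam\<in>partitions n. c lam * elementary_product lam M)))"

text \<open>The edge set of the incomparability graph; its vertex set is \<open>A\<close>.\<close>

definition inc :: "'a set \<Rightarrow> 'a rel \<Rightarrow> 'a set set" where
  "inc A r = {{x, y} | x y. x \<in> A \<and> y \<in> A \<and> incomparable r x y}"

definition proper_colorings :: "'a set \<Rightarrow> 'a set set \<Rightarrow> ('a \<Rightarrow> nat) set" where
  "proper_colorings V E =
     {\<kappa> \<in> V \<rightarrow>\<^sub>E {1..}. \<forall>x\<in>V. \<forall>y\<in>V. {x, y} \<in> E \<longrightarrow> \<kappa> x \<noteq> \<kappa> y}"

definition coloring_inv :: "nat set set \<Rightarrow> (nat \<Rightarrow> nat) \<Rightarrow> nat" where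
  "coloring_inv E \<kappa> = card {(i, j). {i, j} \<in> E \<and> i < j \<and> \<kappa> i > \<kappa> j}"

definition chromatic_qsym :: "nat set \<Rightarrow> nat set set \<Rightarrow> qseries" where
  "chromatic_qsym V E M =
     (\<Sum>\<kappa> | \<kappa> \<in> proper_colorings V E \<and> image_mset \<kappa> (mset_set V) = M.
        monom 1 (coloring_inv E \<kappa>))"

definition phi :: "nat \<Rightarrow> nat rel \<Rightarrow> nat list \<Rightarrow> int poly" where
  "phi n P = elementary_coeffs n (chromatic_qsym {1..n} (inc {1..n} P))"


section \<open>Coxeter length and Bruhat order on the symmetric group\<close>

definition coxeter_length :: "nat \<Rightarrow> (nat \<Rightarrow> nat) \<Rightarrow> nat" where
  "coxeter_length n v =
     (LEAST k. \<exists>is. length is = k \<and> set is \<subseteq> {1..<n} \<and>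
                    v = foldr (\<circ>) (map (\<lambda>i. transpose i (Suc i)) is) id)"

definition bruhat_step :: "nat \<Rightarrow> (nat \<Rightarrow> nat) \<Rightarrow> (nat \<Rightarrow> nat) \<Rightarrow> bool" where
  "bruhat_step n u v \<longleftrightarrow>
     u permutes {1..n} \<and>
     (\<exists>a\<in>{1..n}. \<exists>b\<in>{1..n}. a \<noteq> b \<and> v = u \<circ> transpose a b) \<and>
     coxeter_length n u < coxeter_length n v"

definition bruhat_le :: "nat \<Rightarrow> (nat \<Rightarrow> nat) \<Rightarrow> (nat \<Rightarrow> nat) \<Rightarrow> bool" where
  "bruhat_le n = (bruhat_step n)\<^sup>*\<^sup>*"


section \<open>P-permutations\<close>

text \<open>
  A \<open>P\<close>-permutation is an element of \<open>permutations_of_set {1..n}\<close>. List positions are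
  counted from 0, so the entry \<open>v\<^sub>i\<close> of \<open>U = v\<^sub>1 \<dots> v\<^sub>n\<close> is \<open>U ! (i - 1)\<close>.
\<close>

definition excedance_free :: "nat rel \<Rightarrow> nat list \<Rightarrow> bool" where
  "excedance_free P U \<longleftrightarrow> \<not> (\<exists>i\<in>{1..length U}. strictly_below P i (U ! (i - 1)))"

definition word_inv :: "nat list \<Rightarrow> nat" where
  "word_inv U =
     card {(i, j). i < j \<and> (\<exists>k l. k < l \<and> l < length U \<and> U ! k = j \<and> U ! l = i)}"

end

theory Submission
  imports Defs
begin

text \<open>
  All three sums equal the product over \<open>j = 1, \<dots>, n\<close> of the \<open>q\<close>-integers of
  \<open>1 + #{i > j : i incomparable to j}\<close>.

  For the excedance-free words this follows by choosing the letters from left to right. Such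
  words are closed under going down in the Bruhat order, and a word different from \<open>w\<close> can be
  moved up by placing the letter of \<open>w\<close> at the first position of disagreement; so they are
  exactly the interval below \<open>w\<close>.

  For the chromatic quasisymmetric function \<open>X\<close>, specialising \<open>k\<close> variables to \<open>1\<close> turns
  \<open>e_\<lambda>\<close> into a product of binomial coefficients \<open>(k choose \<lambda>_i)\<close>, a polynomial in \<open>k\<close> whose
  value at \<open>k = -1\<close> is \<open>(-1)^n\<close>. So, up to this sign, the sum of the coefficients of \<open>X\<close> is
  the value at \<open>-1\<close> of its \<open>q\<close>-chromatic polynomial, which is a signed sum over the colorings
  whose set of colors is an initial segment \<open>{1..k}\<close>. Inserting a new smallest vertex, whose
  neighbors form a clique, multiplies this signed sum by a \<open>q\<close>-integer, since all but one of the
  gaps between consecutive neighboring colors cancel against the colors inside them.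
\<close>

section \<open>Natural labellings of unit interval orders\<close>

text \<open>The coefficients \<open>phi\<close> come from a definite description, so nothing can be
  said about their sum until the elementary expansion is known to exist and to be unique. Existence
  requires the symmetry of the chromatic quasisymmetric function, which is proved here from the
  graph: exchanging the exponents of two adjacent colors amounts to exchanging the sizes of two
  classes, and the polynomial recording the class size and the inversions is palindromic. The value
  at -1 is not obtained from an explicit polynomial in k. A vanishing difference of order n + 1
  expresses it as an integer combination of the values at k = 0, ..., n. This combination applies
  equally to products of binomial coefficients and to numbers of colorings, and in both cases it
  leaves only a sign. The poset enters through one monotonicity property: i <_P j persists when i
  decreases or j increases. For words it makes the sets of admissible letters nested and downward
  closed; for colorings it makes the larger neighbors of a vertex a clique. This is why the two
  counts have the same factors.\<close>

lemma beta_le_imp_subsets: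
  assumes P: "unit_interval_order A r" and x: "x \<in> A" and y: "y \<in> A"
    and beta: "beta A r x \<le> beta A r y"
  shows "{a\<in>A. strictly_below r a x} \<subseteq> {a\<in>A. strictly_below r a y}"
    and "{a\<in>A. strictly_below r y a} \<subseteq> {a\<in>A. strictly_below r x a}"
proof -
  have po: "partial_order_on A r" and fin: "finite A" 
    and n31: "\<not> has_induced_3_plus_1 A r" and n22: "\<not> has_induced_2_plus_2 A r"
    using P by (auto simp: unit_interval_order_def)
  have tr: "\<And>a b c. (a, b) \<in> r \<Longrightarrow> (b, c) \<in> r \<Longrightarrow> (a, c) \<in> r"
    and as: "\<And>a b. (a, b) \<in> r \<Longrightarrow> (b, a) \<in> r \<Longrightarrow> a = b"
    and rf: "\<And>a. a \<in> A \<Longrightarrow> (a, a) \<in> r"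
    using partial_order_onD[OF po] by (auto dest: transD antisymD refl_onD)
  define D where "D z = {a\<in>A. strictly_below r a z}" for z
  define U where "U z = {a\<in>A. strictly_below r z a}" for z
  \<comment> \<open>Two incomparable down-sets would give an induced 2+2, formed by u, v and a
    witness below each of them. \<open>U_chain\<close> is the dual.\<close>
  have D_chain: "D u \<subseteq> D v \<or> D v \<subseteq> D u" if "u \<in> A" "v \<in> A" for u v
  proof (rule ccontr)
    assume "\<not> ?thesis"
    then obtain a b where ab: "a \<in> D u" "a \<notin> D v" "b \<in> D v" "b \<notin> D u" by blast
    then have "has_induced_2_plus_2 A r"
      unfolding has_induced_2_plus_2_def using that
      by (intro bexI[of _ a] bexI[of _ u] bexI[of _ b] bexI[of _ v])
         (auto simp: D_def strictly_below_def incomparable_def dest: tr as)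
    with n22 show False by simp
  qed
  have U_chain: "U u \<subseteq> U v \<or> U v \<subseteq> U u" if "u \<in> A" "v \<in> A" for u v
  proof (rule ccontr)
    assume "\<not> ?thesis"
    then obtain a b where ab: "a \<in> U u" "a \<notin> U v" "b \<in> U v" "b \<notin> U u" by blast
    then have "has_induced_2_plus_2 A r"
      unfolding has_induced_2_plus_2_def using that
      by (intro bexI[of _ u] bexI[of _ a] bexI[of _ v] bexI[of _ b])
         (auto simp: U_def strictly_below_def incomparable_def dest: tr as)
    with n22 show False by simp
  qed
  \<comment> \<open>Here a < v < c is a chain and u is incomparable to all three, an induced 3+1. So
    if the down-set of v is not contained in that of u, then the up-set of v is contained in that of
    u, and both facts make \<open>beta\<close> larger at v.\<close>
  have DU: False if uv: "u \<in> A" "v \<in> A" and a: "a \<in> D v" "a \<notin> D u" and c: "c \<in> U v" "c \<notin> U u" for u v a c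
  proof -
    have "has_induced_3_plus_1 A r"
      unfolding has_induced_3_plus_1_def using uv a c
      by (intro bexI[of _ a] bexI[of _ v] bexI[of _ c] bexI[of _ u])
         (auto simp: D_def U_def strictly_below_def incomparable_def dest: tr as)
    with n31 show False by simp
  qed
  \<comment> \<open>\<open>beta\<close> counts z itself in both of its sets, and the two
    contributions cancel.\<close>
  have card: "beta A r z = int (card (D z)) - int (card (U z))" if "z \<in> A" for z
  proof -
    have "{a\<in>A. (a, z) \<in> r} = insert z (D z)" "{a\<in>A. (z, a) \<in> r} = insert z (U z)"
      using that rf by (auto simp: D_def U_def strictly_below_def)
    moreover have "z \<notin> D z" "z \<notin> U z" "finite (D z)" "finite (U z)"
      using fin by (auto simp: D_def U_def strictly_below_def)
    ultimately show ?thesis by (simp add: beta_def)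
  qed
  have finDU: "finite (D z)" "finite (U z)" for z using fin by (auto simp: D_def U_def)
  have le: "int (card (D x)) - int (card (U x)) \<le> int (card (D y)) - int (card (U y))"
    using beta card x y by simp
  have "D x \<subseteq> D y"
  proof (rule ccontr)
    assume *: "\<not> D x \<subseteq> D y"
    then have "D y \<subset> D x" using D_chain[OF x y] by blast
    then have "card (D y) < card (D x)" using finDU psubset_card_mono by blast
    moreover have "U x \<subseteq> U y" using DU[of y x] * x y by blast
    then have "card (U x) \<le> card (U y)" using finDU card_mono by blast
    ultimately show False using le by linarith
  qed
  moreover have "U y \<subseteq> U x"
  proof (rule ccontr)
    assume *: "\<not> U y \<subseteq> U x"
    then have "U x \<subset> U y" using U_chain[OF x y] by blast
    then have "card (U x) < card (U y)" using finDU psubset_card_mono by blast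
    moreover have "D y \<subseteq> D x" using DU[of x y] * x y by blast
    then have "card (D y) \<le> card (D x)" using finDU card_mono by blast
    ultimately show False using le by linarith
  qed
  ultimately show "{a\<in>A. strictly_below r a x} \<subseteq> {a\<in>A. strictly_below r a y}"
    and "{a\<in>A. strictly_below r y a} \<subseteq> {a\<in>A. strictly_below r x a}"
    by (auto simp: D_def U_def)
qed

text \<open>The poset as a staircase: the pairs \<open>(i, j)\<close> with
  \<open>strictly_below P i j\<close> lie above the diagonal and are closed under lowering i and
  raising j. Reflexivity keeps loops out of \<open>inc\<close>.\<close>

locale natural_unit_interval =
  fixes n :: nat and P :: "nat rel"
  assumes refl: "i \<in> {1..n} \<Longrightarrow> (i, i) \<in> P"
    and below_less: "i \<in> {1..n} \<Longrightarrow> j \<in> {1..n} \<Longrightarrow> strictly_below P i j \<Longrightarrow> i < j"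
    and below_mono: "i' \<in> {1..n} \<Longrightarrow> i \<in> {1..n} \<Longrightarrow> j \<in> {1..n} \<Longrightarrow> j' \<in> {1..n} \<Longrightarrow>
      i' \<le> i \<Longrightarrow> strictly_below P i j \<Longrightarrow> j \<le> j' \<Longrightarrow> strictly_below P i' j'"

lemma natural_unit_intervalI:
  assumes P: "unit_interval_order {1..n} P"
    and beta: "\<forall>i\<in>{1..n}. \<forall>j\<in>{1..n}. i \<le> j \<longrightarrow> beta {1..n} P i \<le> beta {1..n} P j"
  shows "natural_unit_interval n P"
proof
  have D: "strictly_below P a j" if "a \<in> {1..n}" "i \<in> {1..n}" "j \<in> {1..n}" "i \<le> j" "strictly_below P a i" for a i j
    using beta_le_imp_subsets(1)[OF P that(2,3)] beta that by blast
  have U: "strictly_below P i a" if "a \<in> {1..n}" "i \<in> {1..n}" "j \<in> {1..n}" "i \<le> j" "strictly_below P j a" for a i j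
    using beta_le_imp_subsets(2)[OF P that(2,3)] beta that by blast
  show "(i, i) \<in> P" if "i \<in> {1..n}" for i
    using P that by (auto simp: unit_interval_order_def dest!: partial_order_onD(1) refl_onD)
  \<comment> \<open>If j \<le> i, the down-set of j lies in that of i, so i would be strictly below
    itself.\<close>
  show "i < j" if "i \<in> {1..n}" "j \<in> {1..n}" "strictly_below P i j" for i j
    using D[of i j i] that by (force simp: strictly_below_def)
  show "strictly_below P i' j'" if "i' \<in> {1..n}" "i \<in> {1..n}" "j \<in> {1..n}" "j' \<in> {1..n}"
    "i' \<le> i" "strictly_below P i j" "j \<le> j'" for i i' j j'
    using U[of j i' i] D[of i' j j'] that by blast
qed

context natural_unit_interval
begin

lemma inc_edge_iff:
  assumes "i \<in> {1..n}" "j \<in> {1..n}" "i < j"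
  shows "{i, j} \<in> inc {1..n} P \<longleftrightarrow> \<not> strictly_below P i j"
proof -
  have "\<not> strictly_below P j i" using below_less[of j i] assms by auto
  then have "incomparable P i j \<longleftrightarrow> \<not> strictly_below P i j" "incomparable P j i \<longleftrightarrow> \<not> strictly_below P i j"
    using assms by (auto simp: incomparable_def strictly_below_def)
  moreover have "{i, j} \<in> inc {1..n} P" if "incomparable P i j"
    using that assms unfolding inc_def by blast
  moreover have "incomparable P i j \<or> incomparable P j i" if "{i, j} \<in> inc {1..n} P"
    using that by (auto simp: inc_def doubleton_eq_iff)
  ultimately show ?thesis by blast
qed

lemma inc_edgeD:
  assumes "{i, j} \<in> inc {1..n} P"
  shows "i \<in> {1..n}" "j \<in> {1..n}" "i \<noteq> j"
  using assms refl by (auto simp: inc_def incomparable_def doubleton_eq_iff)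

text \<open>If i' were strictly below j', then \<open>below_mono\<close> would put i strictly below
  j. Hence everything between two adjacent vertices is a clique.\<close>

lemma inc_edge_interval:
  assumes "{i, j} \<in> inc {1..n} P" "i \<le> i'" "i' < j'" "j' \<le> j"
  shows "{i', j'} \<in> inc {1..n} P"
proof -
  have ij: "i \<in> {1..n}" "j \<in> {1..n}" "i < j" using inc_edgeD[OF assms(1)] assms by auto
  then have "\<not> strictly_below P i j" using assms inc_edge_iff by blast
  moreover have "i' \<in> {1..n}" "j' \<in> {1..n}" using ij assms by auto
  ultimately show ?thesis using below_mono[of i i' j' j] inc_edge_iff[of i' j'] ij assms by blast
qed

end

section \<open>Coxeter length and inversions\<close>

definition inversions :: "nat \<Rightarrow> (nat \<Rightarrow> nat) \<Rightarrow> (nat \<times> nat) set" where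
  "inversions n v = {(i, j). i \<in> {1..n} \<and> j \<in> {1..n} \<and> i < j \<and> v i > v j}"

lemma finite_inversions [simp]: "finite (inversions n v)"
  by (rule finite_subset[of _ "{1..n} \<times> {1..n}"]) (auto simp: inversions_def)

lemma inversions_id: "inversions n id = {}"
  by (auto simp: inversions_def)

lemma card_inversions_transpose_less:
  assumes v: "inj v" and ab: "a \<in> {1..n}" "b \<in> {1..n}" "a < b" "v a < v b"
  shows "card (inversions n v) < card (inversions n (v \<circ> transpose a b))"
proof -
  let ?t = "transpose a b" and ?w = "v \<circ> transpose a b"
  define f where "f = (\<lambda>(i, j). if i < a \<or> b < j then (?t i, ?t j) else (i, j))"
  have ff: "f (f p) = p" for p
  proof -
    have "?t i = i" if "i < a \<or> b < i" for i using that ab by (auto intro!: transpose_apply_other)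
    then show ?thesis by (cases p) (simp add: f_def)
  qed
  have "inj_on f (inversions n v)"
    by (rule inj_on_inverseI[of _ f]) (rule ff)
  moreover have "f ` inversions n v \<subseteq> inversions n ?w - {(a, b)}"
  proof
    fix q assume "q \<in> f ` inversions n v"
    then obtain k l where kl: "k \<in> {1..n}" "l \<in> {1..n}" "k < l" "v l < v k" "q = f (k, l)"
      by (auto simp: inversions_def)
    consider "k < a" | "b < l" | "a \<le> k" "l \<le> b" by linarith
    then show "q \<in> inversions n ?w - {(a, b)}"
    proof cases
      case 1
      then have "?t k = k" using ab by (auto intro!: transpose_apply_other)
      moreover have "k < ?t l" "?t l \<in> {1..n}" using kl(1-3) ab 1 by (auto simp: transpose_def)
      ultimately show ?thesis using 1 kl by (simp add: f_def inversions_def)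
    next
      case 2
      then have "?t l = l" using ab by (auto intro!: transpose_apply_other)
      moreover have "?t k < l" "?t k \<in> {1..n}" using kl(1-3) ab 2 by (auto simp: transpose_def)
      ultimately show ?thesis using 2 kl ab by (simp add: f_def inversions_def)
    next
      case 3
      then have q: "q = (k, l)" using kl by (simp add: f_def)
      have "v (?t l) < v (?t k)"
        using 3 kl(3,4) ab(4) by (cases "k = a"; cases "l = b") (simp_all add: transpose_apply_other)
      moreover have "(k, l) \<noteq> (a, b)" using kl(4) ab by auto
      ultimately show ?thesis using kl(1-3) q by (simp add: inversions_def)
    qed
  qed
  moreover have "(a, b) \<in> inversions n ?w" using ab by (auto simp: inversions_def)
  ultimately have "card (inversions n v) \<le> card (inversions n ?w - {(a, b)})"
    by (intro card_inj_on_le) auto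
  also have "\<dots> < card (inversions n ?w)" 
    using \<open>(a, b) \<in> inversions n ?w\<close> by (intro psubset_card_mono) auto
  finally show ?thesis .
qed

text \<open>An adjacent transposition preserves the order of every pair of positions except
  \<open>(i, Suc i)\<close>, so it carries old inversions to new ones and adds this one
  pair.\<close>

lemma card_inversions_adjacent:
  assumes v: "inj v" and i: "i \<in> {1..<n}" "v i < v (Suc i)"
  shows "card (inversions n (v \<circ> transpose i (Suc i))) = Suc (card (inversions n v))"
proof -
  let ?t = "transpose i (Suc i)" and ?w = "v \<circ> transpose i (Suc i)"
  have mono: "?t k < ?t l" if "k < l" "(k, l) \<noteq> (i, Suc i)" for k l
    using that unfolding transpose_def by simp linarith
  have range: "?t k \<in> {1..n}" if "k \<in> {1..n}" for k
    using that i by (simp add: transpose_def)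
  have *: "inversions n ?w = insert (i, Suc i) (map_prod ?t ?t ` inversions n v)"
  proof (intro equalityI subsetI)
    fix p assume "p \<in> inversions n ?w"
    then obtain k l where p: "p = (k, l)" "k \<in> {1..n}" "l \<in> {1..n}" "k < l" "v (?t k) > v (?t l)"
      by (auto simp: inversions_def)
    show "p \<in> insert (i, Suc i) (map_prod ?t ?t ` inversions n v)"
    proof (cases "p = (i, Suc i)")
      case False
      then have "(?t k, ?t l) \<in> inversions n v"
        using p mono range by (simp add: inversions_def)
      then have "map_prod ?t ?t (?t k, ?t l) \<in> map_prod ?t ?t ` inversions n v" by (rule imageI)
      then show ?thesis using p by simp
    qed simp
  next
    fix p assume "p \<in> insert (i, Suc i) (map_prod ?t ?t ` inversions n v)"
    then consider "p = (i, Suc i)"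
      | k l where "k \<in> {1..n}" "l \<in> {1..n}" "k < l" "v l < v k" "p = (?t k, ?t l)"
      by (auto simp: inversions_def)
    then show "p \<in> inversions n ?w"
    proof cases
      case 1
      then show ?thesis using i by (simp add: inversions_def)
    next
      case 2
      moreover have "(k, l) \<noteq> (i, Suc i)" using 2 i by auto
      ultimately show ?thesis using mono range by (simp add: inversions_def)
    qed
  qed
  have "(i, Suc i) \<notin> map_prod ?t ?t ` inversions n v"
  proof
    assume "(i, Suc i) \<in> map_prod ?t ?t ` inversions n v"
    then obtain k l where kl: "k < l" "i = ?t k" "Suc i = ?t l" by (auto simp: inversions_def)
    then have "k = Suc i" "l = i" by (metis transpose_involutory transpose_apply_first transpose_apply_second)+
    with kl show False by simp
  qed
  moreover have "inj_on (map_prod ?t ?t) (inversions n v)"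
    by (intro inj_on_subset[OF prod.inj_map]) (auto intro: inj_transpose)
  ultimately show ?thesis unfolding * by (simp add: card_image)
qed

definition word_perm :: "nat list \<Rightarrow> nat \<Rightarrow> nat" where
  "word_perm is = foldr (\<circ>) (map (\<lambda>i. transpose i (Suc i)) is) id"

lemma word_perm_Nil: "word_perm [] = id"
  by (simp add: word_perm_def)

lemma word_perm_Cons: "word_perm (i # is) = transpose i (Suc i) \<circ> word_perm is"
  by (simp only: word_perm_def list.map foldr_Cons comp_apply)

lemma word_perm_snoc: "word_perm (is @ [i]) = word_perm is \<circ> transpose i (Suc i)"
  by (induction "is") (simp_all only: append.simps word_perm_Nil word_perm_Cons comp_assoc comp_id id_comp)

lemma word_perm_permutes:
  "set is \<subseteq> {1..<n} \<Longrightarrow> word_perm is permutes {1..n}"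
proof (induction "is")
  case (Cons i js)
  have "transpose i (Suc i) permutes {1..n}" using Cons.prems by (intro permutes_swap_id) auto
  moreover have "word_perm js permutes {1..n}"
    using Cons.prems by (intro Cons.IH) auto
  ultimately show ?case unfolding word_perm_Cons
    by (rule permutes_compose[rotated])
qed (simp add: word_perm_Nil permutes_id)

lemma card_inversions_word_le:
  "set is \<subseteq> {1..<n} \<Longrightarrow>
    card (inversions n (word_perm is)) \<le> length is"
proof (induction "is" rule: rev_induct)
  case Nil
  show ?case unfolding word_perm_Nil inversions_id by simp
next
  case (snoc i js)
  define v where "v = word_perm js"
  have v: "v permutes {1..n}" unfolding v_def using snoc.prems by (intro word_perm_permutes) auto
  then have "inj v" by (rule permutes_inj)
  have i: "i \<in> {1..<n}" using snoc.prems by auto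
  have IH: "card (inversions n v) \<le> length js" using snoc by (auto simp: v_def)
  have "card (inversions n (v \<circ> transpose i (Suc i))) \<le> Suc (card (inversions n v))"
  proof (cases "v i < v (Suc i)")
    case True
    show ?thesis using card_inversions_adjacent[OF \<open>inj v\<close> i True] by simp
  next
    case False
    \<comment> \<open>At a descent the roles are exchanged: \<open>v\<close> arises from
      \<open>?u\<close> by the same transposition, at an ascent of \<open>?u\<close>.\<close>
    let ?u = "v \<circ> transpose i (Suc i)"
    have "v i \<noteq> v (Suc i)" using \<open>inj v\<close> by (simp add: inj_eq)
    then have "?u i < ?u (Suc i)" using False by auto
    moreover have "inj ?u" using \<open>inj v\<close> by (intro inj_compose) auto
    ultimately have "card (inversions n (?u \<circ> transpose i (Suc i))) = Suc (card (inversions n ?u))"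
      using i card_inversions_adjacent by blast
    then show ?thesis by (simp add: comp_assoc)
  qed
  then have "card (inversions n (v \<circ> transpose i (Suc i))) \<le> length (js @ [i])"
    using IH by simp
  then show ?case by (simp only: word_perm_snoc v_def)
qed

text \<open>Ascents force \<open>j \<le> v j\<close> throughout, and one strict inequality would
  make the values sum to more than the positions.\<close>

lemma permutes_eq_id_if_ascending:
  assumes v: "v permutes {1..n}" and asc: "\<And>i. i \<in> {1..<n} \<Longrightarrow> v i < v (Suc i)"
  shows "v = id"
proof -
  have le: "j \<le> v j" if "j \<in> {1..n}" for j
    using that
  proof (induction j)
    case (Suc j)
    show ?case
    proof (cases "j = 0")
      case True
      then show ?thesis using permutes_in_image[OF v, of "Suc j"] Suc.prems by simp
    next
      case False
      then have "j \<le> v j" "v j < v (Suc j)" using Suc.IH Suc.prems asc[of j] by auto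
      then show ?thesis by simp
    qed
  qed simp
  have "v j = j" if j: "j \<in> {1..n}" for j
  proof (rule ccontr)
    assume "v j \<noteq> j"
    then have "id j < v j" using le[OF j] by simp
    then have "sum id {1..n} < sum v {1..n}"
      using j le by (intro sum_strict_mono_ex1) auto
    moreover have "sum v {1..n} = sum id {1..n}"
      using sum.permute[OF v, of id] by simp
    ultimately show False by simp
  qed
  moreover have "v j = j" if "j \<notin> {1..n}" for j
    using v that by (rule permutes_not_in)
  ultimately show ?thesis by (intro ext) (metis id_apply)
qed

text \<open>Bubble sort: a permutation other than the identity has a descent, and undoing it removes
  exactly one inversion.\<close>

lemma exists_word_of_inversions:
  "v permutes {1..n} \<Longrightarrow>
    \<exists>is. length is = card (inversions n v) \<and> set is \<subseteq> {1..<n} \<and>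
         v = word_perm is"
proof (induction "card (inversions n v)" arbitrary: v rule: less_induct)
  case less
  show ?case
  proof (cases "v = id")
    case True
    then have "length [] = card (inversions n v)" "v = word_perm []"
      unfolding True inversions_id word_perm_Nil by simp_all
    then show ?thesis by (intro exI[of _ "[]"]) auto
  next
    case False
    then obtain i where i: "i \<in> {1..<n}" "\<not> v i < v (Suc i)"
      using permutes_eq_id_if_ascending[OF less.prems] by blast
    let ?u = "v \<circ> transpose i (Suc i)"
    have inj: "inj v" using less.prems by (rule permutes_inj)
    then have "v i \<noteq> v (Suc i)" by (simp add: inj_eq)
    then have "?u i < ?u (Suc i)" using i by auto
    moreover have "inj ?u" using inj by (intro inj_compose) auto
    ultimately have "card (inversions n (?u \<circ> transpose i (Suc i))) = Suc (card (inversions n ?u))"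
      using i card_inversions_adjacent by blast
    then have card: "card (inversions n v) = Suc (card (inversions n ?u))" by (simp add: comp_assoc)
    have "transpose i (Suc i) permutes {1..n}" using i by (intro permutes_swap_id) auto
    then have "?u permutes {1..n}" using less.prems by (rule permutes_compose)
    then obtain js where js: "length js = card (inversions n ?u)" "set js \<subseteq> {1..<n}"
      "?u = word_perm js"
      using less.hyps[of ?u] card by auto
    have "v = ?u \<circ> transpose i (Suc i)" by (simp add: comp_assoc)
    also have "\<dots> = word_perm (js @ [i])"
      unfolding word_perm_snoc js(3)[symmetric] ..
    finally show ?thesis using js(1,2) i card by (intro exI[of _ "js @ [i]"]) auto
  qed
qed

lemma coxeter_length_eq_card_inversions:
  assumes "v permutes {1..n}"
  shows "coxeter_length n v = card (inversions n v)"
  unfolding coxeter_length_def word_perm_def[symmetric]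
  using exists_word_of_inversions[OF assms] card_inversions_word_le
  by (intro Least_equality) auto

text \<open>Turns the length condition of \<open>bruhat_step\<close> into a comparison of two
  letters. When \<open>v b < v a\<close>, the strict increase is applied to the transposed
  permutation instead.\<close>

lemma coxeter_length_transpose_less_iff:
  assumes v: "v permutes {1..n}" and ab: "a \<in> {1..n}" "b \<in> {1..n}" "a < b"
  shows "coxeter_length n v < coxeter_length n (v \<circ> transpose a b) \<longleftrightarrow> v a < v b"
proof -
  let ?u = "v \<circ> transpose a b"
  have "transpose a b permutes {1..n}" using ab by (intro permutes_swap_id) auto
  then have u: "?u permutes {1..n}" using v by (rule permutes_compose)
  have inj: "inj v" "inj ?u" using v u permutes_inj by auto
  have "v a \<noteq> v b" using inj ab by (simp add: inj_eq)
  moreover have "card (inversions n ?u) < card (inversions n (?u \<circ> transpose a b))" if "v b < v a"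
    using that ab inj by (intro card_inversions_transpose_less) auto
  then have "card (inversions n ?u) < card (inversions n v)" if "v b < v a"
    using that by (simp add: comp_assoc)
  moreover have "card (inversions n v) < card (inversions n ?u)" if "v a < v b"
    using card_inversions_transpose_less[OF inj(1) ab that] .
  ultimately have "card (inversions n v) < card (inversions n ?u) \<longleftrightarrow> v a < v b"
    by (metis less_asym nat_neq_iff)
  then show ?thesis using v u by (simp only: coxeter_length_eq_card_inversions)
qed

section \<open>Excedance-free words\<close>

definition q_int :: "nat \<Rightarrow> int poly" where
  "q_int m = (\<Sum>k<m. monom 1 k)"

text \<open>The number of smaller elements takes each of the values 0, ...,
  \<open>card B - 1\<close> once. This produces the q-integers both for letters and for
  colors.\<close>

lemma sum_card_less:
  fixes B :: "'a::linorder set" and f :: "nat \<Rightarrow> 'b::comm_monoid_add"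
  assumes "finite B"
  shows "(\<Sum>x\<in>B. f (card {a\<in>B. a < x})) = (\<Sum>k<card B. f k)"
  using assms
proof (induction B rule: finite_linorder_max_induct)
  case (insert b B)
  have b: "b \<notin> B" using insert by auto
  have "{a \<in> insert b B. a < x} = {a \<in> B. a < x}" if "x \<in> B" for x
    using insert that by auto
  moreover have "{a \<in> insert b B. a < b} = B" using insert by auto
  ultimately show ?case using insert b by (simp add: add.commute)
qed simp

text \<open>The sets constrain the letters position by position. Fixing the leftmost letter first
  makes its inversions with the rest depend only on that letter and on \<open>A\<close>.\<close>

fun words :: "'a set \<Rightarrow> 'a set list \<Rightarrow> 'a list set" where
  "words A [] = (if A = {} then {[]} else {})"
| "words A (H # Hs) = (\<Union>x\<in>A \<inter> H. (#) x ` words (A - {x}) Hs)"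

lemma in_words_iff:
  "U \<in> words A Hs \<longleftrightarrow> distinct U \<and> set U = A \<and> list_all2 (\<in>) U Hs"
proof (induction Hs arbitrary: A U)
  case Nil
  then show ?case by auto
next
  case (Cons H Hs)
  show ?case by (cases U) (auto simp: Cons.IH)
qed

lemma finite_words: "finite A \<Longrightarrow> finite (words A Hs)"
  by (induction Hs arbitrary: A) auto

lemma word_inv_Cons:
  assumes "distinct (x # xs)"
  shows "word_inv (x # xs) = card {a\<in>set xs. a < x} + word_inv xs"
proof -
  let ?I = "\<lambda>U::nat list. {(i, j). i < j \<and> (\<exists>k l. k < l \<and> l < length U \<and> U ! k = j \<and> U ! l = i)}"
  have fin: "finite (?I xs)"
    by (rule finite_subset[of _ "set xs \<times> set xs"]) auto
  have "?I (x # xs) = (\<lambda>a. (a, x)) ` {a\<in>set xs. a < x} \<union> ?I xs"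
  proof (intro equalityI subsetI)
    fix p assume "p \<in> ?I (x # xs)"
    then obtain i j k l where p: "p = (i, j)" "i < j" "k < l" "l < length (x # xs)"
      "(x # xs) ! k = j" "(x # xs) ! l = i" by auto
    then obtain l' where l': "l = Suc l'" by (cases l) auto
    show "p \<in> (\<lambda>a. (a, x)) ` {a\<in>set xs. a < x} \<union> ?I xs"
      using p l' by (cases k) auto
  next
    fix p assume "p \<in> (\<lambda>a. (a, x)) ` {a\<in>set xs. a < x} \<union> ?I xs"
    then consider a where "p = (a, x)" "a \<in> set xs" "a < x"
      | i j k l where "p = (i, j)" "i < j" "k < l" "l < length xs" "xs ! k = j" "xs ! l = i" by auto
    then show "p \<in> ?I (x # xs)"
    proof cases
      case 1
      then obtain l where "l < length xs" "xs ! l = a" by (auto simp: in_set_conv_nth)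
      then have "\<exists>k l. k < l \<and> l < length (x # xs) \<and> (x # xs) ! k = x \<and> (x # xs) ! l = a"
        by (intro exI[of _ 0] exI[of _ "Suc l"]) simp
      then show ?thesis using 1 by blast
    next
      case 2
      then have "\<exists>k l. k < l \<and> l < length (x # xs) \<and> (x # xs) ! k = j \<and> (x # xs) ! l = i"
        by (intro exI[of _ "Suc k"] exI[of _ "Suc l"]) simp
      then show ?thesis using 2 by blast
    qed
  qed
  moreover have "(\<lambda>a. (a, x)) ` {a\<in>set xs. a < x} \<inter> ?I xs = {}"
  proof -
    have "x \<noteq> xs ! k" if "k < l" "l < length xs" for k l
      using assms that nth_mem[of k xs] by auto
    then show ?thesis by blast
  qed
  moreover have "card ((\<lambda>a. (a, x)) ` {a\<in>set xs. a < x}) = card {a\<in>set xs. a < x}"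
    by (intro card_image inj_onI) auto
  ultimately show ?thesis unfolding word_inv_def using fin
    by (simp add: card_Un_disjoint)
qed

text \<open>The inversions caused by the leftmost letter x are the smaller letters of
  \<open>A\<close>, all of which lie in the first set because it is downward closed in
  \<open>A\<close>; so the choices of x add up to a q-integer. As the first set lies in all later
  ones, removing x lowers every later count by exactly one, whatever x is. This is the origin of
  \<open>- i\<close>.\<close>

lemma sum_word_inv_words:
  assumes "finite A" "sorted_wrt (\<subseteq>) Hs"
    and "\<And>H x y. H \<in> set Hs \<Longrightarrow> x \<in> H \<Longrightarrow> y \<in> A \<Longrightarrow> y \<le> x \<Longrightarrow> y \<in> H"
    and "card A = length Hs"
  shows "(\<Sum>U\<in>words A Hs. monom 1 (word_inv U)) = (\<Prod>i<length Hs. q_int (card (A \<inter> Hs ! i) - i))"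
  using assms
proof (induction Hs arbitrary: A)
  case Nil
  have "word_inv [] = 0" by (simp add: word_inv_def)
  then show ?case using Nil by simp
next
  case (Cons H Hs)
  define R where "R = (\<Prod>i<length Hs. q_int (card (A \<inter> Hs ! i) - Suc i))"
  have inner: "(\<Sum>U\<in>(#) x ` words (A - {x}) Hs. monom 1 (word_inv U)) = monom 1 (card {a\<in>A. a < x}) * R"
    if x: "x \<in> A \<inter> H" for x
  proof -
    have "word_inv (x # U) = card {a\<in>A. a < x} + word_inv U" if "U \<in> words (A - {x}) Hs" for U
    proof -
      have U: "distinct U" "set U = A - {x}" using that by (auto simp: in_words_iff)
      then have "{a \<in> set U. a < x} = {a\<in>A. a < x}" by auto
      with U show ?thesis using word_inv_Cons[of x U] by simp
    qed
    then have "(\<Sum>U\<in>(#) x ` words (A - {x}) Hs. monom 1 (word_inv U)) =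
        (\<Sum>U\<in>words (A - {x}) Hs. monom (1::int) (card {a\<in>A. a < x}) * monom 1 (word_inv U))"
      by (simp add: sum.reindex mult_monom)
    also have "\<dots> = monom 1 (card {a\<in>A. a < x}) * (\<Sum>U\<in>words (A - {x}) Hs. monom 1 (word_inv U))"
      by (simp add: sum_distrib_left)
    also have "(\<Sum>U\<in>words (A - {x}) Hs. monom 1 (word_inv U)) =
        (\<Prod>i<length Hs. q_int (card ((A - {x}) \<inter> Hs ! i) - i))"
    proof (rule Cons.IH)
      show "card (A - {x}) = length Hs" using Cons.prems x by simp
      show "y \<in> H'" if "H' \<in> set Hs" "z \<in> H'" "y \<in> A - {x}" "y \<le> z" for H' z y
        using Cons.prems(3)[of H' z y] that by auto
    qed (use Cons.prems in auto)
    also have "\<dots> = R"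
      unfolding R_def
    proof (intro prod.cong refl)
      fix i assume "i \<in> {..<length Hs}"
      then have "H \<subseteq> Hs ! i" using Cons.prems by auto
      then have "(A - {x}) \<inter> Hs ! i = A \<inter> Hs ! i - {x}" "x \<in> A \<inter> Hs ! i" using x by auto
      then show "q_int (card ((A - {x}) \<inter> Hs ! i) - i) = q_int (card (A \<inter> Hs ! i) - Suc i)"
        using Cons.prems(1) by simp
    qed
    finally show ?thesis .
  qed
  have "(\<Sum>U\<in>words A (H # Hs). monom 1 (word_inv U)) =
      (\<Sum>x\<in>A \<inter> H. \<Sum>U\<in>(#) x ` words (A - {x}) Hs. monom 1 (word_inv U))"
    unfolding words.simps using Cons.prems(1)
    by (intro sum.UNION_disjoint) (auto simp: finite_words)
  also have "\<dots> = (\<Sum>x\<in>A \<inter> H. monom 1 (card {a\<in>A \<inter> H. a < x}) * R)"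
  proof (intro sum.cong refl)
    fix x assume x: "x \<in> A \<inter> H"
    then have "{a\<in>A. a < x} = {a\<in>A \<inter> H. a < x}" using Cons.prems(3)[of H x] by auto
    then show "(\<Sum>U\<in>(#) x ` words (A - {x}) Hs. monom 1 (word_inv U)) =
        monom 1 (card {a\<in>A \<inter> H. a < x}) * R"
      using inner[OF x] by simp
  qed
  also have "\<dots> = q_int (card (A \<inter> H)) * R"
    using sum_card_less[of "A \<inter> H" "monom (1::int)"] Cons.prems(1)
    by (simp add: sum_distrib_right[symmetric] q_int_def)
  also have "\<dots> = (\<Prod>i<length (H # Hs). q_int (card (A \<inter> (H # Hs) ! i) - i))"
    unfolding length_Cons prod.lessThan_Suc_shift R_def by simp
  finally show ?case .
qed

context natural_unit_interval
begin

lemma sum_excedance_free: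
  "(\<Sum>U | U \<in> permutations_of_set {1..n} \<and> excedance_free P U. monom (1::int) (word_inv U)) =
    (\<Prod>j=1..n. q_int (Suc (card {i\<in>{1..n}. j < i \<and> \<not> strictly_below P j i})))"
proof -
  define H where "H j = {i\<in>{1..n}. \<not> strictly_below P j i}" for j
  define Hs where "Hs = map H [1..<Suc n]"
  have Hs_nth: "Hs ! i = H (Suc i)" if "i < n" for i using that by (simp add: Hs_def nth_append del: upt_Suc)
  have len: "length Hs = n" by (simp add: Hs_def)
  have "{U. U \<in> permutations_of_set {1..n} \<and> excedance_free P U} = words {1..n} Hs"
  proof (intro set_eqI)
    fix U
    have "list_all2 (\<in>) U Hs \<longleftrightarrow> excedance_free P U" if U: "distinct U" "set U = {1..n}"
    proof -
      have "length U = n" using distinct_card[OF U(1)] U(2) by simp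
      moreover have "U ! k \<in> H (Suc k) \<longleftrightarrow> \<not> strictly_below P (Suc k) (U ! k)" if "k < n" for k
        using U(2) that calculation nth_mem[of k U] by (auto simp: H_def)
      moreover have "(\<forall>k<n. Q (Suc k)) \<longleftrightarrow> (\<forall>i\<in>{1..n}. Q i)" for Q
        using image_Suc_lessThan[of n] by (metis (no_types, lifting) ball_simps(9) lessThan_iff)
      from this[of "\<lambda>i. \<not> strictly_below P i (U ! (i - 1))"]
      have "(\<forall>k<n. \<not> strictly_below P (Suc k) (U ! k)) \<longleftrightarrow>
          (\<forall>i\<in>{1..n}. \<not> strictly_below P i (U ! (i - 1)))" by simp
      ultimately show ?thesis by (auto simp: list_all2_conv_all_nth excedance_free_def len Hs_nth)
    qed
    then show "U \<in> {U. U \<in> permutations_of_set {1..n} \<and> excedance_free P U} \<longleftrightarrow> U \<in> words {1..n} Hs"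
      by (auto simp: in_words_iff permutations_of_set_def)
  qed
  moreover have "(\<Sum>U\<in>words {1..n} Hs. monom 1 (word_inv U)) =
      (\<Prod>i<length Hs. q_int (card ({1..n} \<inter> Hs ! i) - i))"
  proof (rule sum_word_inv_words)
    show "sorted_wrt (\<subseteq>) Hs"
      unfolding sorted_wrt_iff_nth_less len
    proof (intro allI impI)
      fix i j assume ij: "i < j" "j < n"
      then have "H (Suc i) \<subseteq> H (Suc j)" using below_mono[of "Suc i" "Suc j"] by (auto simp: H_def)
      then show "Hs ! i \<subseteq> Hs ! j" using ij by (simp add: Hs_nth)
    qed
    show "y \<in> K" if K: "K \<in> set Hs" and "x \<in> K" "y \<in> {1..n}" "y \<le> x" for K x y
    proof -
      obtain j where "j \<in> set [1..<Suc n]" "K = H j" using K unfolding Hs_def set_map by blast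
      then have j: "j \<in> {1..n}" "K = H j" by auto
      then show ?thesis using that below_mono[of j j y x] by (auto simp: H_def)
    qed
  qed (auto simp: len)
  moreover have "(\<Prod>i<length Hs. q_int (card ({1..n} \<inter> Hs ! i) - i)) =
      (\<Prod>j=1..n. q_int (Suc (card {i\<in>{1..n}. j < i \<and> \<not> strictly_below P j i})))"
  proof -
    \<comment> \<open>The \<open>Suc i\<close> letters up to \<open>Suc i\<close> are all admissible
      at this position; subtracting \<open>i\<close> leaves one of them, which is the
      \<open>Suc\<close> on the right.\<close>
    have "card ({1..n} \<inter> Hs ! i) - i = Suc (card {k\<in>{1..n}. Suc i < k \<and> \<not> strictly_below P (Suc i) k})"
      if i: "i < n" for i
    proof -
      have "{1..n} \<inter> Hs ! i = {1..Suc i} \<union> {k\<in>{1..n}. Suc i < k \<and> \<not> strictly_below P (Suc i) k}"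
      proof (rule set_eqI)
        fix k
        have "\<not> strictly_below P (Suc i) k" if "k \<in> {1..n}" "k \<le> Suc i"
          using below_less[of "Suc i" k] that i by auto
        then show "k \<in> {1..n} \<inter> Hs ! i \<longleftrightarrow>
            k \<in> {1..Suc i} \<union> {k\<in>{1..n}. Suc i < k \<and> \<not> strictly_below P (Suc i) k}"
          using i by (cases "k \<le> Suc i") (auto simp: Hs_nth H_def)
      qed
      moreover have "{1..Suc i} \<inter> {k\<in>{1..n}. Suc i < k \<and> \<not> strictly_below P (Suc i) k} = {}" by auto
      ultimately show ?thesis by (simp add: card_Un_disjoint)
    qed
    then have "(\<Prod>i<length Hs. q_int (card ({1..n} \<inter> Hs ! i) - i)) =
      (\<Prod>i<n. q_int (Suc (card {k\<in>{1..n}. Suc i < k \<and> \<not> strictly_below P (Suc i) k})))"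
      by (simp add: len)
    also have "\<dots> = (\<Prod>j=1..n. q_int (Suc (card {i\<in>{1..n}. j < i \<and> \<not> strictly_below P j i})))"
      by (rule prod.reindex_bij_witness[of _ "\<lambda>j. j - 1" Suc]) auto
    finally show ?thesis .
  qed
  ultimately show ?thesis by simp
qed

end

section \<open>The Bruhat interval\<close>

context natural_unit_interval
begin

text \<open>The functional form of an excedance-free word, on which Bruhat steps can act.\<close>

definition bounded_perm :: "(nat \<Rightarrow> nat) \<Rightarrow> bool" where
  "bounded_perm v \<longleftrightarrow> v permutes {1..n} \<and> (\<forall>i\<in>{1..n}. \<not> strictly_below P i (v i))"

lemma w_perm_greedy:
  assumes j: "j \<in> {1..n}"
  defines "C \<equiv> {i\<in>{1..n}. \<not> strictly_below P j i} - w_perm n P ` {1..<j}"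
  shows "w_perm n P j \<in> C" and "\<And>i. i \<in> C \<Longrightarrow> i \<le> w_perm n P j"
proof -
  have w: "w_perm n P j = Max C" using j by (subst w_perm.simps) (simp add: C_def)
  have "finite C" by (simp add: C_def)
  moreover have "C \<noteq> {}"
  proof
    assume "C = {}"
    \<comment> \<open>Pigeonhole: the j letters up to j are admissible at position j, and at most j
      - 1 letters have been used before.\<close>
    moreover have "{1..j} \<subseteq> {i\<in>{1..n}. \<not> strictly_below P j i}"
      using j below_less[of j] by fastforce
    ultimately have "{1..j} \<subseteq> w_perm n P ` {1..<j}" by (auto simp: C_def)
    then have "card {1..j} \<le> card {1..<j}"
      by (meson card_image_le card_mono finite_atLeastLessThan finite_imageI order_trans)
    with j show False by auto
  qed
  ultimately show "w_perm n P j \<in> C" unfolding w by (rule Max_in)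
  show "i \<le> w_perm n P j" if "i \<in> C" for i unfolding w using \<open>finite C\<close> that by (rule Max_ge)
qed

lemma bounded_perm_w_perm: "bounded_perm (w_perm n P)"
proof -
  have neq: "w_perm n P i \<noteq> w_perm n P j" if "i \<in> {1..n}" "j \<in> {1..n}" "i < j" for i j
  proof -
    have "w_perm n P i \<in> w_perm n P ` {1..<j}" using that by (intro imageI) auto
    then show ?thesis using w_perm_greedy(1)[of j] that(2) by auto
  qed
  have "inj_on (w_perm n P) {1..n}"
    by (rule inj_onI) (metis neq nat_neq_iff)
  moreover have "w_perm n P ` {1..n} \<subseteq> {1..n}" using w_perm_greedy(1) by blast
  ultimately have "bij_betw (w_perm n P) {1..n} {1..n}"
    by (simp add: bij_betw_def endo_inj_surj)
  moreover have "w_perm n P j = j" if "j \<notin> {1..n}" for j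
    using that by (subst w_perm.simps) (simp only: if_False)
  ultimately have "w_perm n P permutes {1..n}" by (rule bij_imp_permutes)
  then show ?thesis using w_perm_greedy(1) by (auto simp: bounded_perm_def)
qed

text \<open>The constraints on u at a and at b both follow from the single constraint on v at a: the
  letter there is \<open>u b\<close>, the larger of the two, and a is the smaller position, so
  \<open>below_mono\<close> covers both.\<close>

lemma bounded_perm_bruhat_step:
  assumes v: "bounded_perm v" and step: "bruhat_step n u v"
  shows "bounded_perm u"
proof -
  have u: "u permutes {1..n}" and len: "coxeter_length n u < coxeter_length n v"
    using step by (auto simp: bruhat_step_def)
  obtain a b where ab: "a \<in> {1..n}" "b \<in> {1..n}" "a < b" "v = u \<circ> transpose a b"
  proof -
    obtain a b where "a \<in> {1..n}" "b \<in> {1..n}" "a \<noteq> b" "v = u \<circ> transpose a b"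
      using step by (auto simp: bruhat_step_def)
    then show thesis using that[of a b] that[of b a] by (metis nat_neq_iff transpose_commute)
  qed
  then have lt: "u a < u b" using len u coxeter_length_transpose_less_iff by blast
  have range: "u i \<in> {1..n}" if "i \<in> {1..n}" for i using permutes_in_image[OF u] that by blast
  have nb: "\<not> strictly_below P i (v i)" if "i \<in> {1..n}" for i
    using v that by (auto simp: bounded_perm_def)
  have va: "\<not> strictly_below P a (u b)" using nb[OF ab(1)] ab by simp
  have "\<not> strictly_below P i (u i)" if i: "i \<in> {1..n}" for i
  proof -
    consider "i = a" | "i = b" | "i \<noteq> a" "i \<noteq> b" by blast
    then show ?thesis
    proof cases
      case 1
      then show ?thesis using va below_mono[of a a "u a" "u b"] ab lt range by auto
    next
      case 2
      then show ?thesis using va below_mono[of a b "u b" "u b"] ab lt range by auto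
    next
      case 3
      then show ?thesis using nb[OF i] ab by simp
    qed
  qed
  with u show ?thesis by (auto simp: bounded_perm_def)
qed

lemma bruhat_le_w_permI:
  "bounded_perm v \<Longrightarrow> bruhat_le n v (w_perm n P)"
\<comment> \<open>There are at most \<open>n * n\<close> inversions, so this measure drops whenever
  the length grows.\<close>
proof (induction "n * n - coxeter_length n v" arbitrary: v rule: less_induct)
  case less
  let ?w = "w_perm n P"
  have v: "v permutes {1..n}" and nb: "\<And>i. i \<in> {1..n} \<Longrightarrow> \<not> strictly_below P i (v i)"
    using less.prems by (auto simp: bounded_perm_def)
  have w: "?w permutes {1..n}" using bounded_perm_w_perm by (simp add: bounded_perm_def)
  show ?case
  proof (cases "v = ?w")
    case True
    then show ?thesis by (simp add: bruhat_le_def)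
  next
    case False
    define j where "j = (LEAST j. v j \<noteq> ?w j)"
    obtain i where "v i \<noteq> ?w i" using False ext[of v ?w] by metis
    then have j: "v j \<noteq> ?w j" unfolding j_def by (rule LeastI)
    have before: "v i = ?w i" if "i < j" for i
  proof (rule ccontr)
    assume "v i \<noteq> ?w i"
    then have "j \<le> i" unfolding j_def by (rule Least_le)
    with that show False by simp
  qed
    have jn: "j \<in> {1..n}" using j permutes_not_in[OF v, of j] permutes_not_in[OF w, of j] by argo
    \<comment> \<open>The two permutations agree before j, so the letter \<open>v j\<close> is still
      available when \<open>?w\<close> makes its greedy choice at j; hence it is at most
      \<open>?w j\<close>.\<close>
    have "v j \<notin> ?w ` {1..<j}"
    proof
      assume "v j \<in> ?w ` {1..<j}"
      then obtain i where "i < j" "v j = v i" using before by auto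
      then show False using permutes_inj[OF v] by (simp add: inj_eq)
    qed
    moreover have "v j \<in> {1..n}" using permutes_in_image[OF v] jn by blast
    ultimately have "v j \<in> {i\<in>{1..n}. \<not> strictly_below P j i} - ?w ` {1..<j}"
      using nb[OF jn] by blast
    then have "v j \<le> ?w j" by (rule w_perm_greedy(2)[OF jn])
    with j have lt: "v j < ?w j" by simp
    obtain b where b: "v b = ?w j" using permutes_surj[OF v] by (metis surjD)
    have "?w j \<in> {1..n}" using permutes_in_image[OF w] jn by blast
    then have bn: "b \<in> {1..n}" using permutes_in_image[OF v] b by metis
    have "b \<noteq> j" using b j by auto
    moreover have "\<not> b < j" using before[of b] b permutes_inj[OF w] by (auto simp: inj_eq)
    ultimately have "j < b" by simp
    define u where "u = v \<circ> transpose j b"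
    have len: "coxeter_length n v < coxeter_length n u"
      unfolding u_def using coxeter_length_transpose_less_iff[OF v jn bn \<open>j < b\<close>] lt b by simp
    then have step: "bruhat_step n v u"
      unfolding bruhat_step_def using v jn bn \<open>j < b\<close>
      by (intro conjI bexI[of _ j] bexI[of _ b]) (auto simp: u_def)
    have "transpose j b permutes {1..n}" using jn bn by (intro permutes_swap_id)
    then have u: "u permutes {1..n}" unfolding u_def using v by (rule permutes_compose)
    have "\<not> strictly_below P i (u i)" if i: "i \<in> {1..n}" for i
    proof -
      consider "i = j" | "i = b" | "i \<noteq> j" "i \<noteq> b" by blast
      then show ?thesis
      proof cases
        case 1
        then show ?thesis using w_perm_greedy(1)[OF jn] b by (auto simp: u_def)
      next
        case 2
        moreover have "v j \<in> {1..n}" using permutes_in_image[OF v] jn by blast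
        ultimately show ?thesis
          using nb[OF bn] below_mono[of b b "v j" "v b"] bn lt b \<open>?w j \<in> {1..n}\<close> by (auto simp: u_def)
      next
        case 3
        then show ?thesis using nb i by (simp add: u_def)
      qed
    qed
    with u have bu: "bounded_perm u" by (simp add: bounded_perm_def)
    have "coxeter_length n u \<le> n * n"
    proof -
      have "card (inversions n u) \<le> card ({1..n} \<times> {1..n})"
        by (intro card_mono) (auto simp: inversions_def)
      then show ?thesis using u by (simp add: coxeter_length_eq_card_inversions)
    qed
    then have "bruhat_le n u ?w" using less.hyps[of u] bu len by linarith
    then show ?thesis using step unfolding bruhat_le_def by (meson converse_rtranclp_into_rtranclp)
  qed
qed

lemma bruhat_le_w_perm_iff:
  "v permutes {1..n} \<and> bruhat_le n v (w_perm n P) \<longleftrightarrow> bounded_perm v"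
proof
  assume *: "v permutes {1..n} \<and> bruhat_le n v (w_perm n P)"
  then have "(bruhat_step n)\<^sup>*\<^sup>* v (w_perm n P)" by (simp add: bruhat_le_def)
  then show "bounded_perm v"
    by (induction rule: converse_rtranclp_induct) (auto intro: bounded_perm_w_perm bounded_perm_bruhat_step)
next
  assume "bounded_perm v"
  then show "v permutes {1..n} \<and> bruhat_le n v (w_perm n P)"
    using bruhat_le_w_permI by (simp add: bounded_perm_def)
qed

end

definition word_of :: "nat \<Rightarrow> (nat \<Rightarrow> nat) \<Rightarrow> nat list" where
  "word_of n v = map v [1..<Suc n]"

lemma length_word_of [simp]: "length (word_of n v) = n"
  by (simp add: word_of_def)

lemma nth_word_of [simp]: "k < n \<Longrightarrow> word_of n v ! k = v (Suc k)"
  by (simp add: word_of_def nth_append del: upt_Suc)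

text \<open>\<open>word_inv\<close> counts pairs of letters, \<open>inversions\<close> collects
  pairs of positions; v translates the latter into the former.\<close>

lemma word_inv_word_of:
  assumes v: "v permutes {1..n}"
  shows "word_inv (word_of n v) = card (inversions n v)"
proof -
  have "{(i, j). i < j \<and> (\<exists>k l. k < l \<and> l < n \<and> v (Suc k) = j \<and> v (Suc l) = i)} =
      (\<lambda>(k, l). (v l, v k)) ` inversions n v"
  proof (intro equalityI subsetI)
    fix p assume "p \<in> {(i, j). i < j \<and> (\<exists>k l. k < l \<and> l < n \<and> v (Suc k) = j \<and> v (Suc l) = i)}"
    then obtain k l where "p = (v (Suc l), v (Suc k))" "v (Suc l) < v (Suc k)" "k < l" "l < n" by auto
    then show "p \<in> (\<lambda>(k, l). (v l, v k)) ` inversions n v"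
      by (intro image_eqI[of _ _ "(Suc k, Suc l)"]) (auto simp: inversions_def)
  next
    fix p assume "p \<in> (\<lambda>(k, l). (v l, v k)) ` inversions n v"
    then obtain k l where kl: "p = (v l, v k)" "v l < v k" "k < l" "1 \<le> k" "l \<le> n" by (auto simp: inversions_def)
    then obtain k' l' where "k = Suc k'" "l = Suc l'" by (cases k; cases l) auto
    with kl have "p = (v (Suc l'), v (Suc k'))" "v (Suc l') < v (Suc k')" "k' < l'" "l' < n" by auto
    then show "p \<in> {(i, j). i < j \<and> (\<exists>k l. k < l \<and> l < n \<and> v (Suc k) = j \<and> v (Suc l) = i)}"
      by blast
  qed
  moreover have "inj_on (\<lambda>(k, l). (v l, v k)) (inversions n v)"
    by (rule inj_onI, clarify) (simp add: inj_eq[OF permutes_inj[OF v]])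
  moreover have eq: "k < l \<and> l < n \<and> word_of n v ! k = j \<and> word_of n v ! l = i \<longleftrightarrow>
      k < l \<and> l < n \<and> v (Suc k) = j \<and> v (Suc l) = i" for i j k l
    using nth_word_of[of k n v] nth_word_of[of l n v] by auto
  have "word_inv (word_of n v) =
      card {(i, j). i < j \<and> (\<exists>k l. k < l \<and> l < n \<and> v (Suc k) = j \<and> v (Suc l) = i)}"
    unfolding word_inv_def length_word_of eq ..
  ultimately show ?thesis by (simp add: card_image)
qed

context natural_unit_interval
begin

lemma sum_bruhat_eq_sum_excedance_free:
  "(\<Sum>v | v permutes {1..n} \<and> bruhat_le n v (w_perm n P). monom 1 (coxeter_length n v)) =
    (\<Sum>U | U \<in> permutations_of_set {1..n} \<and> excedance_free P U. monom (1::int) (word_inv U))"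
  unfolding bruhat_le_w_perm_iff
proof (rule sum.reindex_bij_witness[of _ "\<lambda>U j. if j \<in> {1..n} then U ! (j - 1) else j" "word_of n"])
  fix v assume "v \<in> {v. bounded_perm v}"
  then have v: "v permutes {1..n}" and nb: "\<And>i. i \<in> {1..n} \<Longrightarrow> \<not> strictly_below P i (v i)"
    by (auto simp: bounded_perm_def)
  show "(\<lambda>j. if j \<in> {1..n} then word_of n v ! (j - 1) else j) = v"
  proof
    show "(if j \<in> {1..n} then word_of n v ! (j - 1) else j) = v j" for j
      by (cases "j \<in> {1..n}") (auto simp: permutes_not_in[OF v, of j])
  qed
  have set: "set [1..<Suc n] = {1..n}" by auto
  have "set (word_of n v) = {1..n}" "distinct (word_of n v)"
    unfolding word_of_def set_map distinct_map set
    using permutes_image[OF v] permutes_inj_on[OF v] by auto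
  then show "word_of n v \<in> {U \<in> permutations_of_set {1..n}. excedance_free P U}"
    using nb by (auto simp: permutations_of_set_def excedance_free_def)
  show "monom 1 (word_inv (word_of n v)) = monom 1 (coxeter_length n v)"
    using word_inv_word_of[OF v] coxeter_length_eq_card_inversions[OF v] by simp
next
  fix U assume "U \<in> {U \<in> permutations_of_set {1..n}. excedance_free P U}"
  then have U: "distinct U" "set U = {1..n}" "excedance_free P U" by (auto simp: permutations_of_set_def)
  have len: "length U = n" using distinct_card[OF U(1)] U(2) by simp
  let ?v = "\<lambda>j. if j \<in> {1..n} then U ! (j - 1) else j"
  have "inj_on ?v {1..n}"
    using U(1) len by (auto simp: inj_on_def nth_eq_iff_index_eq)
  moreover have "?v ` {1..n} \<subseteq> {1..n}"
    using U(2) len nth_mem by fastforce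
  ultimately have "bij_betw ?v {1..n} {1..n}"
    by (intro bij_betw_imageI endo_inj_surj finite_atLeastAtMost)
  then have "?v permutes {1..n}" by (rule bij_imp_permutes) auto
  moreover have "\<not> strictly_below P i (?v i)" if "i \<in> {1..n}" for i
    using U(3) that len by (auto simp: excedance_free_def)
  ultimately show "?v \<in> {v. bounded_perm v}" by (simp add: bounded_perm_def)
  show "word_of n ?v = U"
    by (intro nth_equalityI) (auto simp: len)
qed

end

section \<open>The elementary basis\<close>

text \<open>Over an infinite index set the sum in \<open>series_mult\<close> would be 0 by
  convention.\<close>

lemma finite_submultisets: "finite {A. A \<subseteq># M}"
proof (induction M)
  case (add x M)
  have "{A. A \<subseteq># add_mset x M} \<subseteq> {A. A \<subseteq># M} \<union> add_mset x ` {A. A \<subseteq># M}"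
  proof
    fix A assume "A \<in> {A. A \<subseteq># add_mset x M}"
    then have A: "A \<subseteq># add_mset x M" by simp
    show "A \<in> {A. A \<subseteq># M} \<union> add_mset x ` {A. A \<subseteq># M}"
    proof (cases "x \<in># A")
      case True
      then have "A = add_mset x (A - {#x#})" by simp
      moreover have "A - {#x#} \<subseteq># M" using A by (simp add: subset_eq_diff_conv)
      ultimately show ?thesis by blast
    next
      case False
      have "A \<subseteq># M"
      proof (rule mset_subset_eqI)
        show "count A y \<le> count M y" for y
          using mset_subset_eq_count[OF A, of y] False by (cases "y = x") (auto simp: not_in_iff)
      qed
      then show ?thesis by simp
    qed
  qed
  then show ?case using add finite_subset by blast
qed simp

lemma finite_partitions: "finite (partitions n)"
proof -
  have "partitions n \<subseteq> {xs. set xs \<subseteq> {..n} \<and> length xs \<le> n}"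
  proof
    fix lam assume lam: "lam \<in> partitions n"
    then have "length lam \<le> sum_list lam"
      using sum_list_mono[of lam "\<lambda>_. 1" "\<lambda>k. k"] by (simp add: partitions_def sum_list_triv)
    moreover have "k \<le> n" if "k \<in> set lam" for k
      using lam member_le_sum_list[OF that] by (simp add: partitions_def)
    ultimately show "lam \<in> {xs. set xs \<subseteq> {..n} \<and> length xs \<le> n}"
      using lam by (auto simp: partitions_def)
  qed
  then show ?thesis using finite_subset finite_lists_length_le[of "{..n}" n] by blast
qed

lemma elementaryE:
  assumes "elementary k M \<noteq> 0"
  obtains S where "finite S" "card S = k" "S \<subseteq> {1..}" "M = mset_set S" "elementary k M = 1"
  using assms by (auto simp: elementary_def split: if_splits)

lemma elementary_mset_set:
  "finite S \<Longrightarrow> S \<subseteq> {1..} \<Longrightarrow> card S = k \<Longrightarrow> elementary k (mset_set S) = 1"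
  by (auto simp: elementary_def)

lemma elementary_product_Nil [simp]: "elementary_product [] = series_one"
  by (simp add: elementary_product_def)

lemma elementary_product_Cons [simp]:
  "elementary_product (k # ks) = series_mult (elementary k) (elementary_product ks)"
  by (simp add: elementary_product_def)

lemma series_mult_nonzeroE:
  assumes "series_mult f g M \<noteq> 0"
  obtains A where "A \<subseteq># M" "f A \<noteq> 0" "g (M - A) \<noteq> 0"
proof -
  obtain A where "A \<in> {A. A \<subseteq># M}" "f A * g (M - A) \<noteq> 0"
    using assms unfolding series_mult_def by (rule sum.not_neutral_contains_not_neutral)
  then show thesis using that by auto
qed

lemma elementary_product_homogeneous:
  "elementary_product lam M \<noteq> 0 \<Longrightarrow> size M = sum_list lam \<and> 0 \<notin># M"
proof (induction lam arbitrary: M)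
  case Nil
  then show ?case by (auto simp: series_one_def split: if_splits)
next
  case (Cons k lam)
  then obtain A where A: "A \<subseteq># M" "elementary k A \<noteq> 0" "elementary_product lam (M - A) \<noteq> 0"
    by (auto elim: series_mult_nonzeroE)
  have M: "M = A + (M - A)" using A(1) by simp
  have "size A = k" "0 \<notin># A" using A(2) by (auto elim!: elementaryE)
  then have "size (A + (M - A)) = k + sum_list lam" "0 \<notin># A + (M - A)"
    using Cons.IH[OF A(3)] by (simp_all del: subset_mset.add_diff_inverse)
  then show ?case unfolding M[symmetric] by simp
qed

text \<open>Adjacent transpositions suffice, since they can sort the exponents of any monomial. The
  index 0 is left out because there is no such variable.\<close>

definition sym_series :: "qseries \<Rightarrow> bool" where
  "sym_series f \<longleftrightarrow> (\<forall>M a. 1 \<le> a \<longrightarrow> f (image_mset (transpose a (Suc a)) M) = f M)"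

lemma sym_series_mult:
  assumes "sym_series f" "sym_series g"
  shows "sym_series (series_mult f g)"
  unfolding sym_series_def
proof (intro allI impI)
  fix M and a :: nat assume a: "1 \<le> a"
  let ?t = "transpose a (Suc a)"
  have tt: "image_mset ?t (image_mset ?t A) = A" for A
    by (simp add: multiset.map_comp)
  have inv: "f (image_mset ?t A) = f A" "g (image_mset ?t A) = g A" for A
    using assms a by (auto simp: sym_series_def)
  have sub: "image_mset ?t A \<subseteq># image_mset ?t B" if "A \<subseteq># B" for A B
    using that by (rule image_mset_subseteq_mono)
  show "series_mult f g (image_mset ?t M) = series_mult f g M"
    unfolding series_mult_def
  proof (rule sum.reindex_bij_witness[of _ "image_mset ?t" "image_mset ?t"])
    fix A assume "A \<in> {A. A \<subseteq># image_mset ?t M}"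
    then have A: "A \<subseteq># image_mset ?t M" by simp
    show "image_mset ?t A \<in> {A. A \<subseteq># M}" using sub[OF A] by (simp add: tt)
    then have "M - image_mset ?t A = image_mset ?t (image_mset ?t M - A)"
      using A by (simp add: image_mset_Diff tt)
    then show "f (image_mset ?t A) * g (M - image_mset ?t A) = f A * g (image_mset ?t M - A)"
      by (simp add: inv)
  qed (auto simp: tt sub)
qed

lemma sym_series_elementary: "sym_series (elementary k)"
  unfolding sym_series_def
proof (intro allI impI)
  fix M and a :: nat assume a: "1 \<le> a"
  let ?t = "transpose a (Suc a)"
  have *: "\<exists>S. finite S \<and> card S = k \<and> S \<subseteq> {1..} \<and> image_mset ?t M = mset_set S"
    if "finite S" "card S = k" "S \<subseteq> {1..}" "M = mset_set S" for M S
  proof (intro exI conjI)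
    show "finite (?t ` S)" "card (?t ` S) = k" using that by (auto simp: card_image)
    show "?t ` S \<subseteq> {1..}" using that a by (auto simp: transpose_def)
    show "image_mset ?t M = mset_set (?t ` S)"
      using that by (simp add: image_mset_mset_set)
  qed
  have tt: "image_mset ?t (image_mset ?t A) = A" for A
    by (simp add: multiset.map_comp)
  have "(\<exists>S. finite S \<and> card S = k \<and> S \<subseteq> {1..} \<and> image_mset ?t M = mset_set S) \<longleftrightarrow>
      (\<exists>S. finite S \<and> card S = k \<and> S \<subseteq> {1..} \<and> M = mset_set S)"
    using *[of _ M] *[of _ "image_mset ?t M"] unfolding tt by blast
  then show "elementary k (image_mset ?t M) = elementary k M" by (simp add: elementary_def)
qed

lemma sym_series_elementary_product: "sym_series (elementary_product lam)"
proof (induction lam)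
  case Nil
  show ?case by (simp add: sym_series_def series_one_def)
next
  case (Cons k lam)
  then show ?case by (simp add: sym_series_mult sym_series_elementary)
qed

text \<open>The largest element is at least the cardinality, which allows it to be split off and
  compared with the last term of the initial segment.\<close>

lemma sum_atLeast1_card_le:
  assumes "finite S" "S \<subseteq> {1..}"
  shows "\<Sum>{1..card S} \<le> \<Sum>S \<and> (\<Sum>S = \<Sum>{1..card S} \<longrightarrow> S = {1..card S})"
  using assms
proof (induction S rule: finite_linorder_max_induct)
  case (insert b S)
  have b: "b \<notin> S" using insert by auto
  have "insert b S \<subseteq> {1..b}" using insert by (auto simp: less_imp_le)
  then have "card (insert b S) \<le> card {1..b}" by (intro card_mono) auto
  then have cb: "Suc (card S) \<le> b" using insert b by simp
  have IH: "\<Sum>{1..card S} \<le> \<Sum>S" "\<Sum>S = \<Sum>{1..card S} \<longrightarrow> S = {1..card S}" using insert by auto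
  have sum: "\<Sum>(insert b S) = b + \<Sum>S" "card (insert b S) = Suc (card S)"
    "\<Sum>{1..Suc (card S)} = Suc (card S) + \<Sum>{1..card S}"
    using insert b by (simp_all add: atLeastAtMostSuc_conv)
  have "insert b S = {1..Suc (card S)}" if "b + \<Sum>S = Suc (card S) + \<Sum>{1..card S}"
  proof -
    have "b = Suc (card S)" "S = {1..card S}" using that IH cb by auto
    then show ?thesis by (metis One_nat_def Suc_le_eq atLeastAtMostSuc_conv le_add1 plus_1_eq_Suc)
  qed
  then show ?case unfolding sum using IH(1) cb by simp
qed simp

text \<open>
  The exponents of this monomial form the conjugate partition. Among the monomials of the
  elementary product it is the unique one with the least sum of variable indices, which makes
  the transition matrix unitriangular.
\<close>

definition leading :: "nat list \<Rightarrow> nat multiset" where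
  "leading lam = (\<Sum>k\<leftarrow>lam. mset_set {1..k})"

lemma leading_simps [simp]: "leading [] = {#}" "leading (k # lam) = mset_set {1..k} + leading lam"
  by (simp_all add: leading_def)

lemma elementary_weight:
  assumes "elementary k M \<noteq> 0"
  shows "sum_mset (mset_set {1..k}) \<le> sum_mset M"
    and "sum_mset M = sum_mset (mset_set {1..k}) \<Longrightarrow> M = mset_set {1..k}"
proof -
  obtain S where S: "finite S" "card S = k" "S \<subseteq> {1..}" "M = mset_set S"
    using assms by (rule elementaryE)
  have eq: "sum_mset (mset_set T) = \<Sum>T" for T :: "nat set"
    by (simp add: sum_unfold_sum_mset)
  show "sum_mset (mset_set {1..k}) \<le> sum_mset M"
    "sum_mset M = sum_mset (mset_set {1..k}) \<Longrightarrow> M = mset_set {1..k}"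
    using sum_atLeast1_card_le[OF S(1,3)] unfolding S(4) eq S(2) by auto
qed

text \<open>The sum of the variable indices is additive over factors, so minimality of the total
  forces each factor to be minimal.\<close>

lemma elementary_product_weight:
  "elementary_product lam M \<noteq> 0 \<Longrightarrow>
    sum_mset (leading lam) \<le> sum_mset M \<and> (sum_mset M = sum_mset (leading lam) \<longrightarrow> M = leading lam)"
proof (induction lam arbitrary: M)
  case Nil
  then show ?case by (auto simp: series_one_def split: if_splits)
next
  case (Cons k lam)
  then obtain A where A: "A \<subseteq># M" "elementary k A \<noteq> 0" "elementary_product lam (M - A) \<noteq> 0"
    by (auto elim: series_mult_nonzeroE)
  define B where "B = M - A"
  have M: "M = A + B" using A(1) by (simp add: B_def)
  show ?case
    using elementary_weight[OF A(2)] Cons.IH[OF A(3)] unfolding B_def[symmetric] M by auto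
qed

lemma elementary_product_leading: "elementary_product lam (leading lam) = 1"
proof (induction lam)
  case Nil
  show ?case by (simp add: series_one_def)
next
  case (Cons k lam)
  let ?K = "mset_set {1..k}"
  let ?f = "\<lambda>A. elementary k A * elementary_product lam (?K + leading lam - A)"
  \<comment> \<open>A nonzero term splits the leading monomial into two factors whose weights add up
    to the minimum. Both are then minimal, which forces the first one to be
    \<open>?K\<close>.\<close>
  have "?f A = 0" if A: "A \<subseteq># ?K + leading lam" "A \<noteq> ?K" for A
  proof (rule ccontr)
    assume *: "?f A \<noteq> 0"
    define B where "B = ?K + leading lam - A"
    have "A + B = ?K + leading lam" using A(1) by (simp add: B_def)
    then have "sum_mset A + sum_mset B = sum_mset ?K + sum_mset (leading lam)"
      by (metis sum_mset.union)
    moreover have "elementary k A \<noteq> 0" "elementary_product lam B \<noteq> 0" using * by (auto simp: B_def)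
    ultimately show False
      using elementary_weight[of k A] elementary_product_weight[of lam B] A(2) by linarith
  qed
  then have "(\<Sum>A | A \<subseteq># ?K + leading lam. ?f A) = (\<Sum>A\<in>{?K}. ?f A)"
    by (intro sum.mono_neutral_right) (auto simp: finite_submultisets)
  also have "\<dots> = 1" using Cons by (simp add: elementary_mset_set)
  finally show ?case by (simp add: series_mult_def)
qed

lemma partitions_Cons_iff:
  "k # lam \<in> partitions n \<longleftrightarrow> 1 \<le> k \<and> k \<le> n \<and> (\<forall>j\<in>set lam. j \<le> k) \<and> lam \<in> partitions (n - k)"
  by (auto simp: partitions_def)

lemma set_mset_leading_Cons:
  "(\<forall>j\<in>set lam. j \<le> k) \<Longrightarrow> set_mset (leading (k # lam)) = {1..k}"
  by (auto simp: leading_def) 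

text \<open>The support of the leading monomial is {1..k} for the largest part k, so k can be read
  off, cancelled, and the argument repeated.\<close>

lemma leading_inject:
  "lam \<in> partitions n \<Longrightarrow> mu \<in> partitions m \<Longrightarrow> leading lam = leading mu \<Longrightarrow> lam = mu"
proof (induction lam arbitrary: mu n m)
  case Nil
  show ?case
  proof (cases mu)
    case (Cons k mu')
    then have "k \<ge> 1" using Nil by (simp add: partitions_Cons_iff)
    then show ?thesis using Nil Cons by (simp add: mset_set_empty_iff)
  qed simp
next
  case (Cons k lam)
  have k: "1 \<le> k" "\<forall>j\<in>set lam. j \<le> k" "lam \<in> partitions (n - k)"
    using Cons.prems by (auto simp: partitions_Cons_iff)
  show ?case
  proof (cases mu)
    case Nil
    then show ?thesis using Cons.prems k by (simp add: mset_set_empty_iff)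
  next
    case mu: (Cons l mu')
    have l: "1 \<le> l" "\<forall>j\<in>set mu'. j \<le> l" "mu' \<in> partitions (m - l)"
      using Cons.prems unfolding mu by (auto simp: partitions_Cons_iff)
    have "{1..k} = {1..l}"
      using set_mset_leading_Cons[OF k(2)] set_mset_leading_Cons[OF l(2)] Cons.prems(3) unfolding mu
      by metis
    then have "card {1..k} = card {1..l}" by (rule arg_cong)
    then have "k = l" by simp
    then have "lam = mu'" using Cons.IH[OF k(3) l(3)] Cons.prems(3) mu by simp
    with \<open>k = l\<close> mu show ?thesis by simp
  qed
qed

text \<open>Weakly decreasing exponents make the support an initial segment {1..k}. Its length is
  the largest part, and dividing by one copy of each variable in it keeps the exponents weakly
  decreasing.\<close>

lemma leading_surj:
  assumes "0 \<notin># M" "\<And>a. 1 \<le> a \<Longrightarrow> count M (Suc a) \<le> count M a"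
  shows "\<exists>lam\<in>partitions (size M). leading lam = M"
  using assms
proof (induction "size M" arbitrary: M rule: less_induct)
  case less
  show ?case
  proof (cases "M = {#}")
    case True
    then show ?thesis by (intro bexI[of _ "[]"]) (simp_all add: partitions_def)
  next
    case False
    define k where "k = Max (set_mset M)"
    have k: "k \<in># M" unfolding k_def using False by (intro Max_in) auto
    then have "1 \<le> k" using less.prems(1) by (cases k) auto
    have mono: "count M b \<le> count M a" if "1 \<le> a" "a \<le> b" for a b
      using that(2,1) by (induction b rule: dec_induct) (auto intro: order_trans[OF less.prems(2)])
    have set: "set_mset M = {1..k}"
    proof (intro equalityI subsetI)
      fix x assume x: "x \<in># M"
      then have "x \<le> k" unfolding k_def by simp
      moreover have "x \<noteq> 0" using x less.prems(1) by metis
      ultimately show "x \<in> {1..k}" by simp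
    next
      fix x assume "x \<in> {1..k}"
      then have "count M k \<le> count M x" by (intro mono) auto
      then show "x \<in># M" using k by (metis count_greater_zero_iff le_zero_eq neq0_conv)
    qed
    have sub: "mset_set {1..k} \<subseteq># M"
      using set by (metis mset_set_set_mset_msubset)
    define N where "N = M - mset_set {1..k}"
    have M: "M = mset_set {1..k} + N" using sub by (simp add: N_def)
    have size: "size M = k + size N" by (subst M) simp
    have "\<exists>mu\<in>partitions (size N). leading mu = N"
    proof (rule less.hyps)
      show "size N < size M" using size \<open>1 \<le> k\<close> by simp
      show "0 \<notin># N" using less.prems(1) M by (metis union_iff)
      show "count N (Suc a) \<le> count N a" if "1 \<le> a" for a
      proof (cases "Suc a \<le> k")
        case True
        then show ?thesis using less.prems(2)[OF that] that by (simp add: N_def)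
      next
        case False
        then have "Suc a \<notin># M" using set by auto
        then show ?thesis by (simp add: N_def not_in_iff)
      qed
    qed
    then obtain mu where mu: "mu \<in> partitions (size N)" "leading mu = N" by blast
    have "j \<le> k" if "j \<in> set mu" for j
    proof -
      have "1 \<le> j" using mu(1) that by (auto simp: partitions_def)
      then have "j \<in># leading mu" using that by (auto simp: leading_def)
      then have "j \<in># M" using mu M by simp
      then show ?thesis using set by auto
    qed
    then have "k # mu \<in> partitions (size M)"
      using mu size \<open>1 \<le> k\<close> by (simp add: partitions_Cons_iff)
    moreover have "leading (k # mu) = M" using mu M by simp
    ultimately show ?thesis by blast
  qed
qed

lemma sum_mset_transpose_less:
  assumes "count M a < count M (Suc a)"
  shows "sum_mset (image_mset (transpose a (Suc a)) M) < sum_mset M"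
proof -
  let ?t = "transpose a (Suc a)"
  define N where "N = filter_mset (\<lambda>x. x \<noteq> a \<and> x \<noteq> Suc a) M"
  have M: "M = replicate_mset (count M a) a + replicate_mset (count M (Suc a)) (Suc a) + N"
    by (rule multiset_eqI) (auto simp: N_def)
  have "image_mset ?t N = N"
    by (subst image_mset_cong[of N ?t "\<lambda>x. x"]) (auto simp: N_def)
  then have "image_mset ?t M = replicate_mset (count M a) (Suc a) + replicate_mset (count M (Suc a)) a + N"
    by (subst M) simp
  then have "sum_mset (image_mset ?t M) = count M a * Suc a + count M (Suc a) * a + sum_mset N" by simp
  moreover have "sum_mset M = count M a * a + count M (Suc a) * Suc a + sum_mset N"
    by (subst M) (simp only: sum_mset.union sum_mset_replicate_mset of_nat_id)
  ultimately show ?thesis using assms by simp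
qed

text \<open>Bubble sort of the exponents, with the sum of the variable indices as the decreasing
  measure. The partition is chosen before f, so that one partition serves a given series and all
  elementary products at once.\<close>

lemma exists_leading_rearrangement:
  assumes "0 \<notin># M"
  shows "\<exists>lam\<in>partitions (size M). \<forall>f. sym_series f \<longrightarrow> f M = f (leading lam)"
  using assms
proof (induction "sum_mset M" arbitrary: M rule: less_induct)
  case less
  show ?case
  proof (cases "\<exists>a\<ge>1. count M a < count M (Suc a)")
    case True
    then obtain a where a: "1 \<le> a" "count M a < count M (Suc a)" by blast
    let ?M = "image_mset (transpose a (Suc a)) M"
    have "0 \<notin># ?M" using less.prems a(1) by (auto simp: transpose_def split: if_splits)
    then obtain lam where "lam \<in> partitions (size ?M)" "\<forall>f. sym_series f \<longrightarrow> f ?M = f (leading lam)"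
      using less.hyps[OF sum_mset_transpose_less[OF a(2)]] by blast
    moreover have "f ?M = f M" if "sym_series f" for f using that a(1) by (simp add: sym_series_def)
    ultimately show ?thesis by (metis size_image_mset)
  next
    case False
    then show ?thesis using leading_surj[OF less.prems] by (metis not_le)
  qed
qed

text \<open>With a unit diagonal, a triangular system is solved without division, hence over any
  commutative ring.\<close>

lemma unitriangular_ex1:
  fixes e :: "'a \<Rightarrow> 'a \<Rightarrow> 'b::comm_ring_1" and b :: "'a \<Rightarrow> nat"
  assumes fin: "finite A" and diag: "\<And>l. l \<in> A \<Longrightarrow> e l l = 1"
    and tri: "\<And>l m. l \<in> A \<Longrightarrow> m \<in> A \<Longrightarrow> l \<noteq> m \<Longrightarrow> e l m \<noteq> 0 \<Longrightarrow> b l < b m"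
  shows "\<exists>!c. (\<forall>l. l \<notin> A \<longrightarrow> c l = 0) \<and> (\<forall>m\<in>A. x m = (\<Sum>l\<in>A. c l * e l m))"
proof (rule ex_ex1I)
  show "\<exists>c. (\<forall>l. l \<notin> A \<longrightarrow> c l = 0) \<and> (\<forall>m\<in>A. x m = (\<Sum>l\<in>A. c l * e l m))"
    using fin diag tri
  \<comment> \<open>The inserted index has maximal rank, so \<open>e a m\<close> vanishes for the
    earlier m: its coefficient repairs the equation at a without disturbing the others.\<close>
  proof (induction A rule: finite_ranking_induct[where f = b])
    case empty
    show ?case by (intro exI[of _ "\<lambda>_. 0"]) simp
  next
    case (insert a S)
    show ?case
    proof (cases "a \<in> S")
      case True
      then show ?thesis using insert by (simp add: insert_absorb)
    next
      case False
      have "\<exists>c. (\<forall>l. l \<notin> S \<longrightarrow> c l = 0) \<and> (\<forall>m\<in>S. x m = (\<Sum>l\<in>S. c l * e l m))"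
        by (rule insert.IH) (simp_all add: insert.prems)
      then obtain c where c: "\<forall>l. l \<notin> S \<longrightarrow> c l = 0" "\<forall>m\<in>S. x m = (\<Sum>l\<in>S. c l * e l m)"
        by blast
      define c' where "c' = c(a := x a - (\<Sum>l\<in>S. c l * e l a))"
      have c'_S: "(\<Sum>l\<in>S. c' l * e l m) = (\<Sum>l\<in>S. c l * e l m)" for m
        using False by (intro sum.cong) (auto simp: c'_def)
      have "x m = (\<Sum>l\<in>insert a S. c' l * e l m)" if m: "m \<in> insert a S" for m
      proof (cases "m = a")
        case True
        then show ?thesis
          using insert.hyps(1) insert.prems(1)[of a] False by (simp add: c'_S) (simp add: c'_def)
      next
        case F: False
        then have "m \<in> S" using m by simp
        then have "\<not> b a < b m" using insert.hyps(2) by (simp add: not_less)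
        then have "e a m = 0" using insert.prems(2)[of a m] F m by blast
        then show ?thesis using F m c(2) insert.hyps(1) False by (simp add: c'_S)
      qed
      moreover have "\<forall>l. l \<notin> insert a S \<longrightarrow> c' l = 0" using c(1) by (simp add: c'_def)
      ultimately show ?thesis by blast
    qed
  qed
next
  fix c d
  assume c: "(\<forall>l. l \<notin> A \<longrightarrow> c l = 0) \<and> (\<forall>m\<in>A. x m = (\<Sum>l\<in>A. c l * e l m))"
    and d: "(\<forall>l. l \<notin> A \<longrightarrow> d l = 0) \<and> (\<forall>m\<in>A. x m = (\<Sum>l\<in>A. d l * e l m))"
  have "c m = d m" if "m \<in> A" for m
    using that
  \<comment> \<open>The equation at m involves m and indices of smaller rank only, where the two
    solutions already agree.\<close>
  proof (induction "b m" arbitrary: m rule: less_induct)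
    case less
    have "(\<Sum>l\<in>A. (c l - d l) * e l m) = 0"
      using c d less.prems by (simp add: left_diff_distrib sum_subtractf)
    moreover have "(\<Sum>l\<in>A. (c l - d l) * e l m) = (\<Sum>l\<in>{m}. (c l - d l) * e l m)"
    proof (intro sum.mono_neutral_right ballI)
      fix l assume l: "l \<in> A - {m}"
      then have "c l = d l" if "e l m \<noteq> 0"
        using less.hyps[of l] tri[of l m] that less.prems by blast
      then show "(c l - d l) * e l m = 0" by fastforce
    qed (use fin less.prems in simp_all)
    ultimately show ?case using diag less.prems by simp
  qed
  then show "c = d" using c d by (metis ext)
qed

text \<open>Gives meaning to the definite description in \<open>elementary_coeffs\<close>. By
  symmetry and homogeneity the equations at all monomials reduce to those at the finitely many
  leading monomials, which form a unitriangular system.\<close>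

theorem elementary_expansion_ex1:
  assumes sym: "sym_series X" and hom: "\<And>M. X M \<noteq> 0 \<Longrightarrow> size M = n \<and> 0 \<notin># M"
  shows "\<exists>!c. (\<forall>lam. lam \<notin> partitions n \<longrightarrow> c lam = 0) \<and>
             (\<forall>M. X M = (\<Sum>lam\<in>partitions n. c lam * elementary_product lam M))"
proof -
  let ?e = "\<lambda>lam mu. elementary_product lam (leading mu)"
  have "(\<forall>M. X M = (\<Sum>lam\<in>partitions n. c lam * elementary_product lam M)) \<longleftrightarrow>
      (\<forall>mu\<in>partitions n. X (leading mu) = (\<Sum>lam\<in>partitions n. c lam * ?e lam mu))" for c
  proof (intro iffI allI ballI)
    fix M
    assume *: "\<forall>mu\<in>partitions n. X (leading mu) = (\<Sum>lam\<in>partitions n. c lam * ?e lam mu)"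
    show "X M = (\<Sum>lam\<in>partitions n. c lam * elementary_product lam M)"
    proof (cases "size M = n \<and> 0 \<notin># M")
      case True
      then obtain mu where mu: "mu \<in> partitions n" "\<And>f. sym_series f \<Longrightarrow> f M = f (leading mu)"
        using exists_leading_rearrangement[of M] by auto
      show ?thesis
        using * mu(1) by (simp add: mu(2)[OF sym] mu(2)[OF sym_series_elementary_product])
    next
      case False
      then have "X M = 0" using hom by blast
      moreover have "elementary_product lam M = 0" if "lam \<in> partitions n" for lam
        using False elementary_product_homogeneous[of lam M] that by (auto simp: partitions_def)
      ultimately show ?thesis by simp
    qed
  qed auto
  moreover have "\<exists>!c. (\<forall>lam. lam \<notin> partitions n \<longrightarrow> c lam = 0) \<and>
      (\<forall>mu\<in>partitions n. X (leading mu) = (\<Sum>lam\<in>partitions n. c lam * ?e lam mu))"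
  proof (rule unitriangular_ex1[where b = "\<lambda>lam. sum_mset (leading lam)"])
    show "sum_mset (leading lam) < sum_mset (leading mu)"
      if "lam \<in> partitions n" "mu \<in> partitions n" "lam \<noteq> mu" "?e lam mu \<noteq> 0" for lam mu
      using elementary_product_weight[OF that(4)] leading_inject[OF that(1,2)] that(3)
      by (metis le_neq_implies_less)
  qed (auto simp: finite_partitions elementary_product_leading)
  ultimately show ?thesis by simp
qed

lemma elementary_coeffs_expansion:
  assumes "sym_series X" and "\<And>M. X M \<noteq> 0 \<Longrightarrow> size M = n \<and> 0 \<notin># M"
  shows "X M = (\<Sum>lam\<in>partitions n. elementary_coeffs n X lam * elementary_product lam M)"
  using theI'[OF elementary_expansion_ex1[OF assms]] unfolding elementary_coeffs_def by blast

section \<open>Specialisation and extrapolation\<close>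

definition monomials :: "nat \<Rightarrow> nat \<Rightarrow> nat multiset set" where
  "monomials n k = {M. size M = n \<and> set_mset M \<subseteq> {1..k}}"

lemma finite_monomials [simp]: "finite (monomials n k)"
proof -
  have "monomials n k \<subseteq> mset ` {xs. set xs \<subseteq> {1..k} \<and> length xs = n}"
  proof
    fix M assume M: "M \<in> monomials n k"
    obtain xs where "mset xs = M" using ex_mset by blast
    with M show "M \<in> mset ` {xs. set xs \<subseteq> {1..k} \<and> length xs = n}"
      by (auto simp: monomials_def)
  qed
  moreover have "finite (mset ` {xs. set xs \<subseteq> {1..k} \<and> length xs = n})"
    by (intro finite_imageI finite_lists_length_eq) simp
  ultimately show ?thesis by (rule finite_subset)
qed

text \<open>
  The value of a series, homogeneous of degree \<open>n\<close>, at \<open>x\<^sub>1 = \<dots> = x\<^sub>k = 1\<close> and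
  \<open>x\<^sub>i = 0\<close> for \<open>i > k\<close>.
\<close>

definition spec :: "nat \<Rightarrow> nat \<Rightarrow> qseries \<Rightarrow> int poly" where
  "spec n k f = (\<Sum>M\<in>monomials n k. f M)"

text \<open>Homogeneity discards all splittings of a monomial except those with a first factor of
  size a, and these correspond to pairs of monomials.\<close>

lemma spec_series_mult:
  assumes f: "\<And>M. f M \<noteq> 0 \<Longrightarrow> size M = a" and g: "\<And>M. g M \<noteq> 0 \<Longrightarrow> size M = b"
  shows "spec (a + b) k (series_mult f g) = spec a k f * spec b k g"
proof -
  have "spec (a + b) k (series_mult f g) =
      (\<Sum>(M, A)\<in>Sigma (monomials (a + b) k) (\<lambda>M. {A. A \<subseteq># M}). f A * g (M - A))"
    unfolding spec_def series_mult_def by (subst sum.Sigma) (auto simp: finite_submultisets)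
  also have "\<dots> = (\<Sum>(M, A)\<in>{(M, A). M \<in> monomials (a + b) k \<and> A \<subseteq># M \<and> size A = a}. f A * g (M - A))"
  proof (rule sum.mono_neutral_right)
    show "finite (Sigma (monomials (a + b) k) (\<lambda>M. {A. A \<subseteq># M}))"
      by (intro finite_SigmaI) (auto simp: finite_submultisets)
    show "\<forall>p\<in>Sigma (monomials (a + b) k) (\<lambda>M. {A. A \<subseteq># M}) -
        {(M, A). M \<in> monomials (a + b) k \<and> A \<subseteq># M \<and> size A = a}.
        (case p of (M, A) \<Rightarrow> f A * g (M - A)) = 0"
      using f by fastforce
  qed auto
  also have "\<dots> = (\<Sum>(A, B)\<in>monomials a k \<times> monomials b k. f A * g B)"
  proof (rule sum.reindex_bij_witness[of _ "\<lambda>(A, B). (A + B, A)" "\<lambda>(M, A). (A, M - A)"])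
    fix p assume "p \<in> {(M, A). M \<in> monomials (a + b) k \<and> A \<subseteq># M \<and> size A = a}"
    then obtain M A where p: "p = (M, A)" "M \<in> monomials (a + b) k" "A \<subseteq># M" "size A = a" by auto
    then have M: "M = A + (M - A)" by simp
    show "(case case p of (M, A) \<Rightarrow> (A, M - A) of (A, B) \<Rightarrow> (A + B, A)) = p" using p by simp
    have "size M = a + b" "set_mset M \<subseteq> {1..k}" using p by (auto simp: monomials_def)
    moreover have "set_mset A \<subseteq> set_mset M" "set_mset (M - A) \<subseteq> set_mset M"
      using p(3) set_mset_mono by (auto dest: in_diffD)
    moreover have "size (M - A) = size M - size A" using p(3) by (rule size_Diff_submset)
    ultimately show "(case p of (M, A) \<Rightarrow> (A, M - A)) \<in> monomials a k \<times> monomials b k"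
      using p by (auto simp: monomials_def)
    show "(case case p of (M, A) \<Rightarrow> (A, M - A) of (A, B) \<Rightarrow> f A * g B) = (case p of (M, A) \<Rightarrow> f A * g (M - A))"
      using p by simp
  qed (auto simp: monomials_def subset_eq)
  also have "\<dots> = spec a k f * spec b k g"
    by (simp add: spec_def sum_product sum.cartesian_product)
  finally show ?thesis .
qed

lemma spec_elementary: "spec j k (elementary j) = of_nat (k choose j)"
proof -
  let ?S = "{S. S \<subseteq> {1..k} \<and> card S = j}"
  have "spec j k (elementary j) = (\<Sum>M\<in>mset_set ` ?S. 1)"
    unfolding spec_def
  proof (rule sum.mono_neutral_cong_right)
    show "mset_set ` ?S \<subseteq> monomials j k"
    proof
      fix M assume "M \<in> mset_set ` ?S"
      then obtain S where "M = mset_set S" "S \<subseteq> {1..k}" "card S = j" by blast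
      moreover from this have "finite S" by (blast intro: finite_subset)
      ultimately show "M \<in> monomials j k" by (auto simp: monomials_def)
    qed
    show "\<forall>M\<in>monomials j k - mset_set ` ?S. elementary j M = 0"
    proof (intro ballI, rule ccontr)
      fix M assume M: "M \<in> monomials j k - mset_set ` ?S" "elementary j M \<noteq> 0"
      from M(2) obtain S where "finite S" "card S = j" "M = mset_set S" by (rule elementaryE)
      then have "S \<in> ?S" using M(1) by (auto simp: monomials_def)
      then show False using M(1) \<open>M = mset_set S\<close> by blast
    qed
    show "elementary j M = 1" if "M \<in> mset_set ` ?S" for M
    proof -
      obtain S where S: "M = mset_set S" "S \<subseteq> {1..k}" "card S = j" using \<open>M \<in> mset_set ` ?S\<close> by blast
      moreover from S have "finite S" "S \<subseteq> {1..}" by (auto intro: finite_subset)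
      ultimately show ?thesis by (simp add: elementary_mset_set)
    qed
  qed simp
  also have "\<dots> = of_nat (card (mset_set ` ?S))" by simp
  also have "card (mset_set ` ?S) = card ?S"
  proof (rule card_image, rule inj_onI)
    fix S T assume "S \<in> ?S" "T \<in> ?S" and eq: "mset_set S = mset_set T"
    then have "finite S" "finite T" by (auto intro: finite_subset)
    then show "S = T" using eq by (metis finite_set_mset_mset_set)
  qed
  also have "card ?S = k choose j" using n_subsets[of "{1..k}" j] by simp
  finally show ?thesis .
qed

lemma spec_elementary_product:
  "spec (sum_list lam) k (elementary_product lam) = of_nat (\<Prod>j\<leftarrow>lam. k choose j)"
proof (induction lam)
  case Nil
  have "monomials 0 k = {{#}}" by (auto simp: monomials_def)
  then show ?case by (simp add: spec_def series_one_def)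
next
  case (Cons j lam)
  have "spec (j + sum_list lam) k (series_mult (elementary j) (elementary_product lam)) =
      spec j k (elementary j) * spec (sum_list lam) k (elementary_product lam)"
  proof (rule spec_series_mult)
    show "size M = j" if "elementary j M \<noteq> 0" for M using that by (rule elementaryE) simp
    show "size M = sum_list lam" if "elementary_product lam M \<noteq> 0" for M
      using elementary_product_homogeneous[OF that] by simp
  qed
  then show ?case using Cons by (simp add: spec_elementary)
qed

text \<open>Polynomial functions are represented by the vanishing of an iterated difference. The
  argument is an integer so that -1 is within reach.\<close>

fun poly_degree_le :: "nat \<Rightarrow> (int \<Rightarrow> 'a::comm_ring_1) \<Rightarrow> bool" where
  "poly_degree_le 0 f \<longleftrightarrow> (\<forall>x. f (x + 1) = f x)"
| "poly_degree_le (Suc n) f \<longleftrightarrow> poly_degree_le n (\<lambda>x. f (x + 1) - f x)"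

lemma poly_degree_le_add:
  "poly_degree_le n f \<Longrightarrow> poly_degree_le n g \<Longrightarrow> poly_degree_le n (\<lambda>x. f x + g x)"
proof (induction n arbitrary: f g)
  case (Suc n)
  then have "poly_degree_le n (\<lambda>x. (f (x + 1) - f x) + (g (x + 1) - g x))" by simp
  then show ?case by (simp add: algebra_simps)
qed simp

lemma poly_degree_le_shift:
  "poly_degree_le n f \<Longrightarrow> poly_degree_le n (\<lambda>x. f (x + 1))"
proof (induction n arbitrary: f)
  case (Suc n)
  then show ?case using Suc.IH[of "\<lambda>x. f (x + 1) - f x"] by simp
qed simp

lemma poly_degree_le_mult:
  "poly_degree_le m f \<Longrightarrow> poly_degree_le n g \<Longrightarrow> poly_degree_le (m + n) (\<lambda>x. f x * g x)"
proof (induction "m + n" arbitrary: m n f g)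
  case 0
  then show ?case by simp
next
  case (Suc s)
  \<comment> \<open>The Leibniz rule for differences. The shifted factor keeps its degree bound, and
    the difference of a constant is 0.\<close>
  have split: "f (x + 1) * g (x + 1) - f x * g x = (f (x + 1) - f x) * g (x + 1) + f x * (g (x + 1) - g x)" for x
    by (simp add: algebra_simps)
  have 1: "poly_degree_le s (\<lambda>x. (f (x + 1) - f x) * g (x + 1))"
  proof (cases m)
    case 0
    then have "(f (x + 1) - f x) * g (x + 1) = 0" for x using Suc.prems by simp
    moreover have "poly_degree_le s (\<lambda>x. 0 :: 'a)" by (induction s) simp_all
    ultimately show ?thesis by simp
  next
    case m: (Suc m')
    then show ?thesis
      using Suc.hyps(1)[of m' n "\<lambda>x. f (x + 1) - f x" "\<lambda>x. g (x + 1)"] Suc.hyps(2) Suc.prems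
      by (simp add: poly_degree_le_shift)
  qed
  have 2: "poly_degree_le s (\<lambda>x. f x * (g (x + 1) - g x))"
  proof (cases n)
    case 0
    then have "f x * (g (x + 1) - g x) = 0" for x using Suc.prems by simp
    moreover have "poly_degree_le s (\<lambda>x. 0 :: 'a)" by (induction s) simp_all
    ultimately show ?thesis by simp
  next
    case n: (Suc n')
    then show ?thesis
      using Suc.hyps(1)[of m n' f "\<lambda>x. g (x + 1) - g x"] Suc.hyps(2) Suc.prems by simp
  qed
  have "poly_degree_le (Suc s) (\<lambda>x. f x * g x)"
    unfolding poly_degree_le.simps split using 1 2 by (rule poly_degree_le_add)
  then show ?case using Suc.hyps(2) by simp
qed

text \<open>Up to sign this is the difference of order n + 1 at a. The induction step is Pascal's
  rule.\<close>

lemma alternating_binomial_sum: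
  "poly_degree_le n f \<Longrightarrow> (\<Sum>i\<le>Suc n. (-1) ^ i * of_nat (Suc n choose i) * f (a + int i)) = 0"
proof (induction n arbitrary: f a)
  case 0
  then have "f (a + 1) = f a" by simp
  then show ?case by simp
next
  case (Suc n)
  let ?c = "\<lambda>i. of_nat (Suc n choose i) :: 'a"
  let ?g = "\<lambda>x. f (x + 1) - f x"
  have "(\<Sum>i\<le>Suc (Suc n). (-1) ^ i * of_nat (Suc (Suc n) choose i) * f (a + int i)) =
      f a + (\<Sum>i\<le>Suc n. (-1) ^ Suc i * (?c i + ?c (Suc i)) * f (a + int (Suc i)))"
    by (subst sum.atMost_Suc_shift) simp
  also have "\<dots> = f a + (\<Sum>i\<le>Suc n. (-1) ^ Suc i * ?c (Suc i) * f (a + int (Suc i))) -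
      (\<Sum>i\<le>Suc n. (-1) ^ i * ?c i * f (a + int i + 1))"
    by (simp add: algebra_simps sum.distrib sum_subtractf sum_negf del: sum.atMost_Suc)
  also have "f a + (\<Sum>i\<le>Suc n. (-1) ^ Suc i * ?c (Suc i) * f (a + int (Suc i))) =
      (\<Sum>i\<le>Suc (Suc n). (-1) ^ i * ?c i * f (a + int i))"
    by (subst (2) sum.atMost_Suc_shift) simp
  also have "\<dots> = (\<Sum>i\<le>Suc n. (-1) ^ i * ?c i * f (a + int i))"
    by (subst sum.atMost_Suc) (simp add: binomial_eq_0 del: binomial_Suc_Suc)
  finally have "(\<Sum>i\<le>Suc (Suc n). (-1) ^ i * of_nat (Suc (Suc n) choose i) * f (a + int i)) =
      - (\<Sum>i\<le>Suc n. (-1) ^ i * ?c i * ?g (a + int i))"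
    by (simp add: algebra_simps sum_subtractf del: sum.atMost_Suc)
  also have "\<dots> = 0" using Suc.IH[of ?g a] Suc.prems by simp
  finally show ?case .
qed

text \<open>By Pascal's rule, taking the difference lowers the index k by one.\<close>

lemma poly_degree_le_gbinomial: "poly_degree_le k (\<lambda>x. (of_int x :: rat) gchoose k)"
proof (induction k)
  case (Suc k)
  have "((of_int (x + 1) :: rat) gchoose Suc k) - (of_int x gchoose Suc k) = of_int x gchoose k" for x
    using gbinomial_Suc_Suc[of "of_int x :: rat" k] by simp
  then show ?case using Suc by simp
qed simp

lemma poly_degree_le_prod_gbinomial:
  "poly_degree_le (sum_list lam) (\<lambda>x. \<Prod>j\<leftarrow>lam. (of_int x :: rat) gchoose j)"
proof (induction lam)
  case (Cons j lam)
  show ?case using poly_degree_le_mult[OF poly_degree_le_gbinomial[of j] Cons] by simp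
qed simp

lemma poly_degree_le_mono:
  assumes "poly_degree_le m f" "m \<le> n"
  shows "poly_degree_le n f"
proof -
  \<comment> \<open>Multiplying by 1, regarded as a function of degree at most n - m, raises the
    bound from m to n.\<close>
  have "poly_degree_le (n - m) (\<lambda>x. 1 :: 'a)"
  proof (induction "n - m")
    case (Suc k)
    have "poly_degree_le k (\<lambda>x. 0 :: 'a)" by (induction k) simp_all
    then show ?case unfolding Suc.hyps(2)[symmetric] by simp
  qed simp
  from poly_degree_le_mult[OF assms(1) this] show ?thesis using assms(2) by simp
qed

text \<open>The difference of order n + 1 starting at -1 vanishes; solving for its first term
  expresses the value at -1 through those at 0, ..., n. At -1 the factor with index j equals
  \<open>(-1) ^ j\<close>.\<close>

lemma alternating_sum_prod_binomial:
  assumes "sum_list lam \<le> n"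
  shows "(\<Sum>i\<le>n. (-1) ^ i * int (Suc n choose Suc i) * int (\<Prod>j\<leftarrow>lam. i choose j)) = (-1) ^ sum_list lam"
proof -
  let ?f = "\<lambda>x. \<Prod>j\<leftarrow>lam. (of_int x :: rat) gchoose j"
  have nat: "?f (int i) = of_nat (\<Prod>j\<leftarrow>lam. i choose j)" for i
    by (induction lam) (simp_all add: binomial_gbinomial)
  have neg: "?f (-1) = (-1) ^ sum_list lam"
  proof (induction lam)
    case (Cons j lam)
    have "(-1 :: rat) gchoose j = (-1) ^ j"
      using gbinomial_minus[of "1 :: rat" j] by (simp add: binomial_gbinomial[symmetric])
    then show ?case using Cons by (simp add: power_add)
  qed simp
  have "poly_degree_le n ?f"
    using poly_degree_le_mono[OF poly_degree_le_prod_gbinomial assms] .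
  then have "(\<Sum>i\<le>Suc n. (-1) ^ i * of_nat (Suc n choose i) * ?f (-1 + int i)) = 0"
    by (rule alternating_binomial_sum)
  then have "?f (-1) = (\<Sum>i\<le>n. (-1) ^ i * of_nat (Suc n choose Suc i) * ?f (int i))"
    by (subst (asm) sum.atMost_Suc_shift) (simp add: sum_negf del: binomial_Suc_Suc)
  then have "(\<Sum>i\<le>n. (-1) ^ i * of_nat (Suc n choose Suc i) * of_nat (\<Prod>j\<leftarrow>lam. i choose j)) =
      (-1 :: rat) ^ sum_list lam"
    unfolding nat neg by simp
  then have "of_int (\<Sum>i\<le>n. (-1) ^ i * int (Suc n choose Suc i) * int (\<Prod>j\<leftarrow>lam. i choose j)) =
      (of_int ((-1) ^ sum_list lam) :: rat)"
    by (simp del: binomial_Suc_Suc)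
  then show ?thesis by (simp only: of_int_eq_iff)
qed

text \<open>
  If \<open>F\<close> is a polynomial of degree at most \<open>n\<close>, this is \<open>(-1)^n\<close> times its value at \<open>-1\<close>.
\<close>

definition extrapolate :: "nat \<Rightarrow> (nat \<Rightarrow> int poly) \<Rightarrow> int poly" where
  "extrapolate n F = (\<Sum>i\<le>n. of_int ((-1) ^ (n + i) * int (Suc n choose Suc i)) * F i)"

text \<open>Applied in two ways: to partitions of n, where the sign is 1, and to one-entry lists,
  where it becomes the sign of a packed coloring.\<close>

lemma extrapolate_prod_binomial:
  assumes "sum_list lam \<le> n"
  shows "extrapolate n (\<lambda>i. of_nat (\<Prod>j\<leftarrow>lam. i choose j)) = (-1) ^ (n + sum_list lam)"
proof -
  have "extrapolate n (\<lambda>i. of_nat (\<Prod>j\<leftarrow>lam. i choose j)) =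
      of_int ((-1) ^ n * (\<Sum>i\<le>n. (-1) ^ i * int (Suc n choose Suc i) * int (\<Prod>j\<leftarrow>lam. i choose j)))"
    by (simp add: extrapolate_def sum_distrib_left power_add mult.assoc del: binomial_Suc_Suc)
  also have "\<dots> = (-1) ^ (n + sum_list lam)"
    unfolding alternating_sum_prod_binomial[OF assms] by (simp add: power_add)
  finally show ?thesis .
qed

text \<open>The linear form \<open>extrapolate n\<close> sends the specialisation of every
  elementary product of degree n to 1, so it adds up the coefficients.\<close>

lemma sum_elementary_coeffs:
  assumes "sym_series X" and "\<And>M. X M \<noteq> 0 \<Longrightarrow> size M = n \<and> 0 \<notin># M"
  shows "(\<Sum>lam\<in>partitions n. elementary_coeffs n X lam) = extrapolate n (\<lambda>k. spec n k X)"
proof -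
  let ?c = "elementary_coeffs n X"
  have "spec n k X = (\<Sum>lam\<in>partitions n. ?c lam * of_nat (\<Prod>j\<leftarrow>lam. k choose j))" for k
  proof -
    have "spec n k X = (\<Sum>lam\<in>partitions n. ?c lam * spec n k (elementary_product lam))"
    proof -
      have "spec n k X = (\<Sum>M\<in>monomials n k. \<Sum>lam\<in>partitions n. ?c lam * elementary_product lam M)"
        unfolding spec_def by (intro sum.cong refl elementary_coeffs_expansion[OF assms])
      then show ?thesis unfolding spec_def sum_distrib_left by (subst sum.swap) simp
    qed
    also have "\<dots> = (\<Sum>lam\<in>partitions n. ?c lam * of_nat (\<Prod>j\<leftarrow>lam. k choose j))"
    proof (intro sum.cong refl)
      fix lam assume "lam \<in> partitions n"
      then have "sum_list lam = n" by (simp add: partitions_def)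
      then show "?c lam * spec n k (elementary_product lam) = ?c lam * of_nat (\<Prod>j\<leftarrow>lam. k choose j)"
        using spec_elementary_product[of lam k] by simp
    qed
    finally show ?thesis .
  qed
  then have "extrapolate n (\<lambda>k. spec n k X) = (\<Sum>i\<le>n. \<Sum>lam\<in>partitions n.
      of_int ((-1) ^ (n + i) * int (Suc n choose Suc i)) * (?c lam * of_nat (\<Prod>j\<leftarrow>lam. i choose j)))"
    unfolding extrapolate_def by (simp only: sum_distrib_left)
  also have "\<dots> = (\<Sum>lam\<in>partitions n. ?c lam * extrapolate n (\<lambda>i. of_nat (\<Prod>j\<leftarrow>lam. i choose j)))"
    unfolding extrapolate_def sum_distrib_left by (subst sum.swap) (simp only: mult.left_commute)
  also have "\<dots> = (\<Sum>lam\<in>partitions n. ?c lam)"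
  proof (intro sum.cong refl)
    fix lam assume "lam \<in> partitions n"
    then have "sum_list lam = n" by (simp add: partitions_def)
    then have "extrapolate n (\<lambda>i. of_nat (\<Prod>j\<leftarrow>lam. i choose j)) = (-1) ^ (n + n)"
      using extrapolate_prod_binomial[of lam n] by simp
    then show "?c lam * extrapolate n (\<lambda>i. of_nat (\<Prod>j\<leftarrow>lam. i choose j)) = ?c lam"
      by simp
  qed
  finally show ?thesis by simp
qed

section \<open>Symmetry of the chromatic quasisymmetric function\<close>

definition independent :: "'a set set \<Rightarrow> 'a set \<Rightarrow> bool" where
  "independent E T \<longleftrightarrow> (\<forall>x\<in>T. \<forall>y\<in>T. {x, y} \<notin> E)"

definition bipartitions :: "'a set set \<Rightarrow> 'a set \<Rightarrow> 'a set set" where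
  "bipartitions E W = {T. T \<subseteq> W \<and> independent E T \<and> independent E (W - T)}"

definition bipartition_inv :: "nat set set \<Rightarrow> nat set \<Rightarrow> nat set \<Rightarrow> nat" where
  "bipartition_inv E W T = card {(i, j). i \<in> T \<and> j \<in> W - T \<and> i < j \<and> {i, j} \<in> E}"

text \<open>
  The set \<open>T\<close> is the class with the larger of the two colors; the exponent of the outer
  polynomial variable is its size.
\<close>

definition bipartition_weight :: "nat set set \<Rightarrow> nat set \<Rightarrow> nat set \<Rightarrow> int poly poly" where
  "bipartition_weight E W T = monom (monom 1 (bipartition_inv E W T)) (card T)"

definition bipartition_poly :: "nat set set \<Rightarrow> nat set \<Rightarrow> int poly poly" where
  "bipartition_poly E W = (\<Sum>T\<in>bipartitions E W. bipartition_weight E W T)"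

text \<open>The center m / 2 is prescribed independently of the degree; in particular 0 is
  palindromic for every m.\<close>

definition palindromic :: "nat \<Rightarrow> 'a::comm_ring_1 poly \<Rightarrow> bool" where
  "palindromic m A \<longleftrightarrow> (\<forall>i. coeff A i = (if i \<le> m then coeff A (m - i) else 0))"

lemma palindromicD: "palindromic m A \<Longrightarrow> i \<le> m \<Longrightarrow> coeff A (m - i) = coeff A i"
  by (metis palindromic_def)

lemma palindromic_0: "palindromic m A \<Longrightarrow> m < i \<Longrightarrow> coeff A i = 0"
  by (metis palindromic_def not_le)

lemma palindromic_smult: "palindromic m A \<Longrightarrow> palindromic m (smult c A)"
  unfolding palindromic_def coeff_smult by (metis mult_zero_right)

lemma palindromic_add: "palindromic m A \<Longrightarrow> palindromic m B \<Longrightarrow> palindromic m (A + B)"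
  unfolding palindromic_def coeff_add by (metis add.right_neutral)

lemma palindromic_pCons:
  assumes "palindromic m A"
  shows "palindromic (Suc (Suc m)) (pCons 0 A)"
  unfolding palindromic_def
proof
  fix i
  show "coeff (pCons 0 A) i = (if i \<le> Suc (Suc m) then coeff (pCons 0 A) (Suc (Suc m) - i) else 0)"
  proof (cases i)
    case 0
    then show ?thesis using palindromic_0[OF assms, of "Suc m"] by simp
  next
    case (Suc j)
    consider "j \<le> m" | "j = Suc m" | "j > Suc m" by linarith
    then show ?thesis
    proof cases
      case 1
      then have "Suc (Suc m) - i = Suc (m - j)" using Suc by simp
      then show ?thesis using 1 Suc palindromicD[OF assms 1] by simp
    qed (use Suc palindromic_0[OF assms] in simp_all)
  qed
qed

lemma palindromic_add_pCons:
  assumes "palindromic m A"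
  shows "palindromic (Suc m) (A + pCons 0 A)"
  unfolding palindromic_def
proof
  fix i
  show "coeff (A + pCons 0 A) i = (if i \<le> Suc m then coeff (A + pCons 0 A) (Suc m - i) else 0)"
  proof (cases i)
    case 0
    then show ?thesis using palindromic_0[OF assms, of "Suc m"] palindromicD[OF assms, of 0] by simp
  next
    case (Suc j)
    consider "j < m" | "j = m" | "j > m" by linarith
    then show ?thesis
    proof cases
      case 1
      then have "Suc m - i = Suc (m - Suc j)" "m - j = Suc (m - Suc j)" using Suc by auto
      then show ?thesis
        using 1 Suc palindromicD[OF assms, of j] palindromicD[OF assms, of "Suc j"] by simp
    qed (use Suc palindromic_0[OF assms] palindromicD[OF assms, of 0] in simp_all)
  qed
qed

text \<open>The poset enters the coloring argument only through these properties of its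
  incomparability graph.\<close>

locale interval_graph =
  fixes V :: "nat set" and E :: "nat set set"
  assumes finite_V: "finite V"
    and edge: "{i, j} \<in> E \<Longrightarrow> i \<in> V \<and> j \<in> V \<and> i \<noteq> j"
    and interval: "{i, j} \<in> E \<Longrightarrow> i \<le> i' \<Longrightarrow> i' < j' \<Longrightarrow> j' \<le> j \<Longrightarrow> i' \<in> V \<Longrightarrow> j' \<in> V \<Longrightarrow> {i', j'} \<in> E"
begin

lemma no_loop: "{i, i} \<notin> E"
  using edge by blast

lemma finite_edge_pairs: "finite {(i, j). {i, j} \<in> E \<and> Q i j}"
  by (rule finite_subset[of _ "V \<times> V"]) (use edge finite_V in auto)

lemma edge_swap: "{x, y} \<in> E \<longleftrightarrow> {y, x} \<in> E"
  by (simp add: insert_commute)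

context
  fixes A b
  assumes A: "finite A" "A \<subseteq> V" "\<forall>a\<in>A. a < b" and b: "b \<in> V"
begin

lemma bipartitions_insert_without:
  "{T\<in>bipartitions E (insert b A). b \<notin> T} = {T\<in>bipartitions E A. \<forall>i\<in>A - T. {i, b} \<notin> E}"
proof -
  have "b \<notin> A" using A(3) by blast
  have "T \<subseteq> insert b A \<and> b \<notin> T \<longleftrightarrow> T \<subseteq> A \<and> b \<notin> T" for T by blast
  moreover have "independent E (insert b A - T) \<longleftrightarrow> independent E (A - T) \<and> (\<forall>i\<in>A - T. {i, b} \<notin> E)"
    if "b \<notin> T" for T
  proof -
    have "insert b A - T = insert b (A - T)" using that by blast
    then show ?thesis using no_loop[of b] by (auto simp: independent_def edge_swap[of b])
  qed
  ultimately show ?thesis using \<open>b \<notin> A\<close> by (auto simp: bipartitions_def)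
qed

lemma bipartitions_insert_with:
  "{T\<in>bipartitions E (insert b A). b \<in> T} = insert b ` {T\<in>bipartitions E A. \<forall>i\<in>T. {i, b} \<notin> E}"
proof -
  have bA: "b \<notin> A" using A(3) by blast
  have ind: "independent E (insert b T) \<longleftrightarrow> independent E T \<and> (\<forall>i\<in>T. {i, b} \<notin> E)" for T
    using no_loop[of b] by (auto simp: independent_def edge_swap[of b])
  show ?thesis
  proof (intro equalityI subsetI)
    fix T assume T: "T \<in> {T\<in>bipartitions E (insert b A). b \<in> T}"
    then have eq: "T = insert b (T - {b})" "insert b A - T = A - (T - {b})" using bA by auto
    have "independent E (insert b (T - {b}))" "independent E (A - (T - {b}))"
      using T eq by (auto simp: bipartitions_def)
    then have "T - {b} \<in> {T\<in>bipartitions E A. \<forall>i\<in>T. {i, b} \<notin> E}"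
      using T unfolding ind by (auto simp: bipartitions_def)
    then show "T \<in> insert b ` {T\<in>bipartitions E A. \<forall>i\<in>T. {i, b} \<notin> E}" using eq(1) by blast
  next
    fix T assume "T \<in> insert b ` {T\<in>bipartitions E A. \<forall>i\<in>T. {i, b} \<notin> E}"
    then obtain T' where T': "T = insert b T'" "T' \<in> bipartitions E A" "\<forall>i\<in>T'. {i, b} \<notin> E" by blast
    then have "insert b A - T = A - T'" using bA by (auto simp: bipartitions_def)
    then show "T \<in> {T\<in>bipartitions E (insert b A). b \<in> T}"
      using T' ind[of T'] by (auto simp: bipartitions_def)
  qed
qed

text \<open>The largest vertex b receives the smaller color, so its edges to \<open>T\<close> are
  exactly the new inversions. With the larger color it creates none, as the next lemma
  records.\<close>

lemma bipartition_inv_insert_without: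
  assumes "T \<subseteq> A"
  shows "bipartition_inv E (insert b A) T = bipartition_inv E A T + card {i\<in>T. {i, b} \<in> E}"
proof -
  have "b \<notin> A" using A(3) by blast
  let ?P = "{(i, j). i \<in> T \<and> j \<in> A - T \<and> i < j \<and> {i, j} \<in> E}"
  let ?Q = "(\<lambda>i. (i, b)) ` {i\<in>T. {i, b} \<in> E}"
  have "{(i, j). i \<in> T \<and> j \<in> insert b A - T \<and> i < j \<and> {i, j} \<in> E} = ?P \<union> ?Q"
    using assms A \<open>b \<notin> A\<close> by auto
  moreover have "?P \<inter> ?Q = {}" using \<open>b \<notin> A\<close> by auto
  moreover have "finite ?P" by (rule finite_subset[OF _ finite_edge_pairs[of "\<lambda>_ _. True"]]) auto
  moreover have "finite ?Q" using finite_subset[OF assms A(1)] by simp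
  moreover have "card ?Q = card {i\<in>T. {i, b} \<in> E}" by (intro card_image inj_onI) auto
  ultimately show ?thesis unfolding bipartition_inv_def by (simp add: card_Un_disjoint)
qed

lemma bipartition_inv_insert_with:
  assumes "T \<subseteq> A"
  shows "bipartition_inv E (insert b A) (insert b T) = bipartition_inv E A T"
proof -
  have "b \<notin> A" using A(3) by blast
  have "{(i, j). i \<in> insert b T \<and> j \<in> insert b A - insert b T \<and> i < j \<and> {i, j} \<in> E} =
      {(i, j). i \<in> T \<and> j \<in> A - T \<and> i < j \<and> {i, j} \<in> E}"
  proof -
    have "\<not> b < j" if "j \<in> A" for j using A(3) that by force
    then show ?thesis using assms \<open>b \<notin> A\<close> by blast
  qed
  then show ?thesis by (simp add: bipartition_inv_def)
qed

end

lemma finite_bipartitions: "finite W \<Longrightarrow> finite (bipartitions E W)"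
  by (rule finite_subset[of _ "Pow W"]) (auto simp: bipartitions_def)

text \<open>The class of the largest vertex is all that a recursion needs: a further, larger vertex
  is adjacent to no earlier vertex, or only to the largest one, or else there is no
  bipartition.\<close>

definition poly_without_max :: "nat set \<Rightarrow> int poly poly" where
  "poly_without_max W = (\<Sum>T | T \<in> bipartitions E W \<and> Max W \<notin> T. bipartition_weight E W T)"

definition poly_with_max :: "nat set \<Rightarrow> int poly poly" where
  "poly_with_max W = (\<Sum>T | T \<in> bipartitions E W \<and> Max W \<in> T. bipartition_weight E W T)"

lemma bipartition_poly_split:
  assumes "finite W"
  shows "bipartition_poly E W = poly_without_max W + poly_with_max W"
proof -
  have "bipartitions E W = {T\<in>bipartitions E W. Max W \<notin> T} \<union> {T\<in>bipartitions E W. Max W \<in> T}"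
    by blast
  then show ?thesis
    unfolding bipartition_poly_def poly_without_max_def poly_with_max_def
    by (subst sum.union_disjoint[symmetric]) (auto simp: finite_bipartitions assms)
qed

text \<open>
  Within two color classes, adjacent vertices are consecutive, so the two-colored subgraph
  is a disjoint union of paths. The two alternatives describe whether the path containing the
  largest vertex has an odd or an even number of vertices.
\<close>

lemma palindromic_bipartition_poly:
  assumes "finite W" "W \<subseteq> V"
  shows "palindromic (card W) (bipartition_poly E W) \<and>
    (W \<noteq> {} \<longrightarrow>
      poly_with_max W = pCons 0 (poly_without_max W) \<and> palindromic (card W - 1) (poly_without_max W) \<or>
      poly_without_max W = smult (monom 1 1) (poly_with_max W) \<and> palindromic (card W) (poly_with_max W))"
  using assms
proof (induction W rule: finite_linorder_max_induct)
  case empty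
  have "bipartitions E {} = {{}}" by (auto simp: bipartitions_def independent_def)
  then have "bipartition_poly E {} = 1"
    by (simp add: bipartition_poly_def bipartition_weight_def bipartition_inv_def monom_0 one_pCons)
  moreover have "palindromic 0 (1 :: int poly poly)"
    unfolding palindromic_def
  proof
    show "coeff (1 :: int poly poly) i = (if i \<le> 0 then coeff 1 (0 - i) else 0)" for i by (cases i) simp_all
  qed
  ultimately show ?case by simp
next
  case (insert b A)
  have A: "finite A" "A \<subseteq> V" "\<forall>a\<in>A. a < b" "b \<in> V" using insert by auto
  have bA: "b \<notin> A" using A(3) by blast
  have Max: "Max (insert b A) = b" using A by (intro Max_eqI) (auto intro: less_imp_le)
  have card: "card (insert b A) = Suc (card A)" using A bA by simp
  have IH: "palindromic (card A) (bipartition_poly E A)"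
    "A \<noteq> {} \<Longrightarrow> poly_with_max A = pCons 0 (poly_without_max A) \<and> palindromic (card A - 1) (poly_without_max A) \<or>
      poly_without_max A = smult (monom 1 1) (poly_with_max A) \<and> palindromic (card A) (poly_with_max A)"
    using insert by auto
  have without: "poly_without_max (insert b A) =
    (\<Sum>T | T \<in> bipartitions E A \<and> (\<forall>i\<in>A - T. {i, b} \<notin> E).
      smult (monom 1 (card {i\<in>T. {i, b} \<in> E})) (bipartition_weight E A T))"
    unfolding poly_without_max_def Max bipartitions_insert_without[OF A]
  proof (intro sum.cong refl)
    fix T assume "T \<in> {T\<in>bipartitions E A. \<forall>i\<in>A - T. {i, b} \<notin> E}"
    then have "T \<subseteq> A" by (auto simp: bipartitions_def)
    then show "bipartition_weight E (insert b A) T =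
        smult (monom 1 (card {i\<in>T. {i, b} \<in> E})) (bipartition_weight E A T)"
      by (simp add: bipartition_weight_def bipartition_inv_insert_without[OF A] smult_monom mult_monom add.commute)
  qed
  have "with": "poly_with_max (insert b A) =
    (\<Sum>T | T \<in> bipartitions E A \<and> (\<forall>i\<in>T. {i, b} \<notin> E). pCons 0 (bipartition_weight E A T))"
    unfolding poly_with_max_def Max bipartitions_insert_with[OF A]
  proof (subst sum.reindex)
    have TA: "T \<subseteq> A" if "T \<in> {T\<in>bipartitions E A. \<forall>i\<in>T. {i, b} \<notin> E}" for T
      using that by (auto simp: bipartitions_def)
    show "inj_on (insert b) {T\<in>bipartitions E A. \<forall>i\<in>T. {i, b} \<notin> E}"
    proof (rule inj_onI)
      fix S T
      assume "S \<in> {T\<in>bipartitions E A. \<forall>i\<in>T. {i, b} \<notin> E}" "T \<in> {T\<in>bipartitions E A. \<forall>i\<in>T. {i, b} \<notin> E}"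
        and eq: "insert b S = insert b T"
      then have "b \<notin> S" "b \<notin> T" using TA bA by blast+
      then show "S = T" using eq by (simp add: insert_ident)
    qed
    show "sum (bipartition_weight E (insert b A) \<circ> insert b) {T\<in>bipartitions E A. \<forall>i\<in>T. {i, b} \<notin> E} =
      (\<Sum>T | T \<in> bipartitions E A \<and> (\<forall>i\<in>T. {i, b} \<notin> E). pCons 0 (bipartition_weight E A T))"
    proof (intro sum.cong refl)
      fix T assume "T \<in> {T\<in>bipartitions E A. \<forall>i\<in>T. {i, b} \<notin> E}"
      then have T: "T \<subseteq> A" using TA by blast
      then have "card (insert b T) = Suc (card T)"
        using bA finite_subset[OF T A(1)] by (subst card_insert_disjoint) auto
      then show "(bipartition_weight E (insert b A) \<circ> insert b) T = pCons 0 (bipartition_weight E A T)"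
        using T by (simp add: bipartition_weight_def bipartition_inv_insert_with[OF A] monom_Suc)
    qed
  qed
  have pCons_sum: "(\<Sum>x\<in>S. pCons 0 (f x)) = pCons 0 (\<Sum>x\<in>S. f x)" for S and f :: "nat set \<Rightarrow> int poly poly"
    by (induction S rule: infinite_finite_induct) simp_all
  have smult_sum: "(\<Sum>x\<in>S. smult c (f x)) = smult c (\<Sum>x\<in>S. f x)" for S c and f :: "nat set \<Rightarrow> int poly poly"
    by (induction S rule: infinite_finite_induct) (simp_all add: smult_add_right)
  let ?N = "{i\<in>A. {i, b} \<in> E}"
  \<comment> \<open>In the first case b starts a new path; in the second it prolongs the path ending
    in \<open>Max A\<close> and changes its parity; in the third i, \<open>Max A\<close> and b form
    a triangle, so no bipartition exists.\<close>
  consider "?N = {}" | "A \<noteq> {}" "?N = {Max A}" | i where "A \<noteq> {}" "i \<in> ?N" "i \<noteq> Max A" by blast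
  then have cases: "poly_with_max (insert b A) = pCons 0 (poly_without_max (insert b A)) \<and>
        palindromic (card A) (poly_without_max (insert b A)) \<or>
      poly_without_max (insert b A) = smult (monom 1 1) (poly_with_max (insert b A)) \<and>
        palindromic (Suc (card A)) (poly_with_max (insert b A))"
  proof cases
    case 1
    have nb: "{i, b} \<notin> E" if "i \<in> A" for i using 1 that by blast
    have 2: "card {i\<in>T. {i, b} \<in> E} = 0" if "T \<in> bipartitions E A" for T
    proof -
      have "{i\<in>T. {i, b} \<in> E} = {}" using nb that by (auto simp: bipartitions_def)
      then show ?thesis by (simp only: card.empty)
    qed
    have 3: "{T. T \<in> bipartitions E A \<and> (\<forall>i\<in>A - T. {i, b} \<notin> E)} = bipartitions E A"
      "{T. T \<in> bipartitions E A \<and> (\<forall>i\<in>T. {i, b} \<notin> E)} = bipartitions E A"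
      using nb by (auto simp: bipartitions_def)
    have "poly_without_max (insert b A) = bipartition_poly E A"
      unfolding without 3 bipartition_poly_def by (intro sum.cong refl) (simp add: 2)
    moreover have "poly_with_max (insert b A) = pCons 0 (bipartition_poly E A)"
      unfolding "with" 3 bipartition_poly_def pCons_sum ..
    ultimately show ?thesis using IH(1) by simp
  next
    case 2
    have max: "Max A \<in> A" using 2 A(1) by simp
    have N: "{i, b} \<in> E \<longleftrightarrow> i = Max A" if "i \<in> A" for i
    proof -
      have "i \<in> ?N \<longleftrightarrow> i \<in> {Max A}" unfolding 2(2) ..
      then show ?thesis using that by simp
    qed
    have sub: "T \<subseteq> A" if "T \<in> bipartitions E A" for T using that by (simp add: bipartitions_def)
    have "(\<forall>i\<in>A - T. {i, b} \<notin> E) \<longleftrightarrow> Max A \<in> T" "(\<forall>i\<in>T. {i, b} \<notin> E) \<longleftrightarrow> Max A \<notin> T"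
      if "T \<in> bipartitions E A" for T
      using N max sub[OF that] by blast+
    then have eq1: "{T. T \<in> bipartitions E A \<and> (\<forall>i\<in>A - T. {i, b} \<notin> E)} = {T. T \<in> bipartitions E A \<and> Max A \<in> T}"
      and eq2: "{T. T \<in> bipartitions E A \<and> (\<forall>i\<in>T. {i, b} \<notin> E)} = {T. T \<in> bipartitions E A \<and> Max A \<notin> T}"
      by blast+
    have c1: "card {i\<in>T. {i, b} \<in> E} = 1" if "T \<in> bipartitions E A" "Max A \<in> T" for T
    proof -
      have "{i\<in>T. {i, b} \<in> E} = {Max A}" using N max that sub[OF that(1)] by blast
      then show ?thesis by simp
    qed
    \<comment> \<open>b must take the class opposite to \<open>Max A\<close>: outside
      \<open>T\<close> it creates one inversion, inside \<open>T\<close> it raises the class size by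
      one.\<close>
    have wo: "poly_without_max (insert b A) = smult (monom 1 1) (poly_with_max A)"
      unfolding without eq1 poly_with_max_def smult_sum[symmetric] by (intro sum.cong refl) (simp add: c1)
    have wi: "poly_with_max (insert b A) = pCons 0 (poly_without_max A)"
      unfolding "with" eq2 poly_without_max_def pCons_sum ..
    have "card A \<noteq> 0" using 2 A(1) by simp
    then obtain m where m: "card A = Suc m" by (cases "card A") auto
    from IH(2)[OF 2(1)] show ?thesis
    proof
      assume "poly_with_max A = pCons 0 (poly_without_max A) \<and> palindromic (card A - 1) (poly_without_max A)"
      then show ?thesis using palindromic_pCons[of m "poly_without_max A"] by (simp add: wo wi m)
    next
      assume "poly_without_max A = smult (monom 1 1) (poly_with_max A) \<and> palindromic (card A) (poly_with_max A)"
      then show ?thesis by (simp add: wo wi palindromic_smult)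
    qed
  next
    case 3
    let ?m = "Max A"
    have max: "?m \<in> A" "i < ?m" using 3 A(1) by (auto simp: le_neq_implies_less)
    have e1: "{i, b} \<in> E" "i \<in> A" using 3 by auto
    have e2: "{?m, b} \<in> E" using interval[OF e1(1), of ?m b] max A by auto
    have e3: "{i, ?m} \<in> E" using interval[OF e1(1), of i ?m] max A e1 by (auto intro: less_imp_le)
    have "(\<exists>j\<in>A - T. {j, b} \<in> E) \<and> (\<exists>j\<in>T. {j, b} \<in> E)" if "T \<in> bipartitions E A" for T
    proof -
      have "\<not> (i \<in> T \<and> ?m \<in> T)" "\<not> (i \<in> A - T \<and> ?m \<in> A - T)"
        using that e3 unfolding bipartitions_def independent_def by blast+
      then show ?thesis using e1 e2 max by blast
    qed
    then have "{T. T \<in> bipartitions E A \<and> (\<forall>i\<in>A - T. {i, b} \<notin> E)} = {}"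
      "{T. T \<in> bipartitions E A \<and> (\<forall>i\<in>T. {i, b} \<notin> E)} = {}"
      by blast+
    then have "poly_without_max (insert b A) = 0" "poly_with_max (insert b A) = 0"
      unfolding without "with" by (simp_all only: sum.empty)
    then show ?thesis by (simp add: palindromic_def)
  qed
  have "palindromic (Suc (card A)) (bipartition_poly E (insert b A))"
    unfolding bipartition_poly_split[OF finite.insertI[OF A(1)]]
    using cases
  proof
    assume "poly_with_max (insert b A) = pCons 0 (poly_without_max (insert b A)) \<and>
        palindromic (card A) (poly_without_max (insert b A))"
    then show "palindromic (Suc (card A)) (poly_without_max (insert b A) + poly_with_max (insert b A))"
      using palindromic_add_pCons by metis
  next
    assume "poly_without_max (insert b A) = smult (monom 1 1) (poly_with_max (insert b A)) \<and>
        palindromic (Suc (card A)) (poly_with_max (insert b A))"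
    then show "palindromic (Suc (card A)) (poly_without_max (insert b A) + poly_with_max (insert b A))"
      using palindromic_add palindromic_smult by metis
  qed
  then show ?case unfolding card using cases by simp
qed

text \<open>Palindromicity says that class sizes r and \<open>card W - r\<close> carry the same
  distribution of inversions; grouping by size extends this to any condition on the size.\<close>

lemma sum_bipartitions_flip:
  assumes W: "W \<subseteq> V"
  shows "(\<Sum>T | T \<in> bipartitions E W \<and> Q (card T). monom (1::int) (bipartition_inv E W T)) =
    (\<Sum>T | T \<in> bipartitions E W \<and> Q (card W - card T). monom 1 (bipartition_inv E W T))"
proof -
  have fin: "finite W" using W finite_V finite_subset by blast
  have le: "card T \<le> card W" if "T \<in> bipartitions E W" for T
    using that fin by (intro card_mono) (auto simp: bipartitions_def)
  let ?c = "coeff (bipartition_poly E W)"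
  have coeff: "?c r = (\<Sum>T | T \<in> bipartitions E W \<and> card T = r. monom 1 (bipartition_inv E W T))" for r
    unfolding bipartition_poly_def bipartition_weight_def coeff_sum coeff_monom
    by (simp add: sum.inter_filter finite_bipartitions fin)
  have group: "(\<Sum>T | T \<in> bipartitions E W \<and> R (card T). monom 1 (bipartition_inv E W T)) =
      (\<Sum>r | r \<le> card W \<and> R r. ?c r)" for R
  proof -
    have "(\<Sum>T | T \<in> bipartitions E W \<and> R (card T). monom (1::int) (bipartition_inv E W T)) =
      (\<Sum>r | r \<le> card W \<and> R r. \<Sum>T | T \<in> {T. T \<in> bipartitions E W \<and> R (card T)} \<and> card T = r.
         monom 1 (bipartition_inv E W T))"
      using le finite_bipartitions[OF fin] by (intro sum.group[symmetric]) auto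
    also have "\<dots> = (\<Sum>r | r \<le> card W \<and> R r. ?c r)"
      unfolding coeff by (intro sum.cong refl) auto
    finally show ?thesis .
  qed
  have pal: "?c (card W - r) = ?c r" if "r \<le> card W" for r
    using palindromic_bipartition_poly[OF fin W] that palindromicD by blast
  have "(\<Sum>r | r \<le> card W \<and> Q r. ?c r) = (\<Sum>r | r \<le> card W \<and> Q (card W - r). ?c r)"
    by (rule sum.reindex_bij_witness[of _ "\<lambda>r. card W - r" "\<lambda>r. card W - r"]) (auto simp: pal)
  then show ?thesis using group[of Q] group[of "\<lambda>r. Q (card W - r)"] by simp
qed

end

section \<open>Exchanging two adjacent colors\<close>

context interval_graph
begin

definition colorings_of :: "nat multiset \<Rightarrow> (nat \<Rightarrow> nat) set" where
  "colorings_of M = {\<kappa> \<in> proper_colorings V E. image_mset \<kappa> (mset_set V) = M}"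

lemma chromatic_qsym_eq: "chromatic_qsym V E M = (\<Sum>\<kappa>\<in>colorings_of M. monom 1 (coloring_inv E \<kappa>))"
  by (simp add: chromatic_qsym_def colorings_of_def)

lemma colorings_of_subset: "colorings_of M \<subseteq> V \<rightarrow>\<^sub>E set_mset M"
proof
  fix \<kappa> assume "\<kappa> \<in> colorings_of M"
  then have "\<kappa> \<in> extensional V" "set_mset M = \<kappa> ` V"
    using finite_V by (auto simp: colorings_of_def proper_colorings_def PiE_iff)
  then show "\<kappa> \<in> V \<rightarrow>\<^sub>E set_mset M" by (auto simp: PiE_iff)
qed

lemma finite_colorings_of: "finite (colorings_of M)"
  by (rule finite_subset[OF colorings_of_subset]) (simp add: finite_PiE finite_V)

lemma colorings_of_nonempty:
  assumes "colorings_of M \<noteq> {}"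
  shows "size M = card V" "0 \<notin># M"
proof -
  obtain \<kappa> where \<kappa>: "\<kappa> \<in> proper_colorings V E" "image_mset \<kappa> (mset_set V) = M"
    using assms by (auto simp: colorings_of_def)
  then have "\<kappa> v \<noteq> 0" if "v \<in> V" for v using that by (force simp: proper_colorings_def PiE_iff)
  then have "0 \<notin> \<kappa> ` V" by (metis imageE)
  then show "size M = card V" "0 \<notin># M" using finite_V unfolding \<kappa>(2)[symmetric] by simp_all
qed

lemma chromatic_qsym_homogeneous:
  assumes "chromatic_qsym V E M \<noteq> 0"
  shows "size M = card V \<and> 0 \<notin># M"
  using assms colorings_of_nonempty[of M] by (cases "colorings_of M = {}") (auto simp: chromatic_qsym_eq)

context
  fixes a :: nat
  assumes a: "1 \<le> a"
begin

text \<open>Forgets the distinction between the colors \<open>a\<close> and \<open>Suc a\<close>.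
  Edges inside the merged class become monochromatic, so the result need not be proper; its fibers
  correspond to bipartitions of that class.\<close>

definition merge :: "(nat \<Rightarrow> nat) \<Rightarrow> nat \<Rightarrow> nat" where
  "merge \<kappa> = (\<lambda>v\<in>V. if \<kappa> v = Suc a then a else \<kappa> v)"

definition recolor :: "(nat \<Rightarrow> nat) \<Rightarrow> nat set \<Rightarrow> nat \<Rightarrow> nat" where
  "recolor \<gamma> T = (\<lambda>v\<in>V. if v \<in> T then Suc a else \<gamma> v)"

context
  fixes \<gamma> :: "nat \<Rightarrow> nat" and W :: "nat set"
  assumes \<gamma>: "\<exists>\<kappa>\<in>proper_colorings V E. merge \<kappa> = \<gamma>"
  defines "W \<equiv> {v\<in>V. \<gamma> v = a}"
begin

lemma \<gamma>_ext: "\<gamma> \<in> V \<rightarrow>\<^sub>E {1..}" and \<gamma>_neq: "v \<in> V \<Longrightarrow> \<gamma> v \<noteq> Suc a"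
  and \<gamma>_proper: "{x, y} \<in> E \<Longrightarrow> x \<notin> W \<or> y \<notin> W \<Longrightarrow> \<gamma> x \<noteq> \<gamma> y"
proof -
  obtain \<kappa> where \<kappa>: "\<kappa> \<in> V \<rightarrow>\<^sub>E {1..}" "\<And>x y. {x, y} \<in> E \<Longrightarrow> \<kappa> x \<noteq> \<kappa> y" "merge \<kappa> = \<gamma>"
    using \<gamma> edge unfolding proper_colorings_def by blast
  show "\<gamma> \<in> V \<rightarrow>\<^sub>E {1..}" using \<kappa>(1) a unfolding \<kappa>(3)[symmetric] merge_def by (auto simp: PiE_iff)
  show "\<gamma> v \<noteq> Suc a" if "v \<in> V" for v using that unfolding \<kappa>(3)[symmetric] merge_def by simp
  show "\<gamma> x \<noteq> \<gamma> y" if xy: "{x, y} \<in> E" "x \<notin> W \<or> y \<notin> W" for x y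
  proof -
    have "x \<in> V" "y \<in> V" using edge xy by auto
    moreover have "\<gamma> x \<noteq> a \<or> \<gamma> y \<noteq> a" using xy calculation by (auto simp: W_def)
    ultimately show ?thesis using \<kappa>(2)[OF xy(1)] unfolding \<kappa>(3)[symmetric] merge_def by (auto split: if_splits)
  qed
qed

lemma W_subset: "W \<subseteq> V"
  by (auto simp: W_def)

lemma recolor_apply:
  assumes "T \<subseteq> W" "v \<in> V"
  shows "recolor \<gamma> T v = (if v \<in> T then Suc a else if v \<in> W then a else \<gamma> v)"
  using assms by (auto simp: recolor_def W_def)

lemma recolor_neq_iff:
  assumes T: "T \<subseteq> W" and xy: "{x, y} \<in> E"
  shows "recolor \<gamma> T x \<noteq> recolor \<gamma> T y \<longleftrightarrow> \<not> (x \<in> W \<and> y \<in> W \<and> (x \<in> T \<longleftrightarrow> y \<in> T))"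
proof -
  have v: "x \<in> V" "y \<in> V" using edge[OF xy] by auto
  have "\<gamma> x \<noteq> Suc a" "\<gamma> y \<noteq> Suc a" using \<gamma>_neq v by auto
  moreover have "\<gamma> x = a \<longleftrightarrow> x \<in> W" "\<gamma> y = a \<longleftrightarrow> y \<in> W" using v by (auto simp: W_def)
  ultimately show ?thesis
    using T \<gamma>_proper[OF xy] by (cases "x \<in> T"; cases "y \<in> T") (auto simp: recolor_apply[OF T] v)
qed

lemma recolor_proper_iff:
  assumes T: "T \<subseteq> W"
  shows "recolor \<gamma> T \<in> proper_colorings V E \<longleftrightarrow> T \<in> bipartitions E W"
proof -
  have "recolor \<gamma> T \<in> V \<rightarrow>\<^sub>E {1..}" using \<gamma>_ext by (auto simp: recolor_def PiE_iff)
  then have "recolor \<gamma> T \<in> proper_colorings V E \<longleftrightarrow>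
      (\<forall>x\<in>V. \<forall>y\<in>V. {x, y} \<in> E \<longrightarrow> recolor \<gamma> T x \<noteq> recolor \<gamma> T y)"
    by (simp add: proper_colorings_def)
  also have "\<dots> \<longleftrightarrow> (\<forall>x y. {x, y} \<in> E \<longrightarrow> \<not> (x \<in> W \<and> y \<in> W \<and> (x \<in> T \<longleftrightarrow> y \<in> T)))"
    using recolor_neq_iff[OF T] edge by meson
  also have "\<dots> \<longleftrightarrow> T \<in> bipartitions E W"
    using T by (auto simp: bipartitions_def independent_def)
  finally show ?thesis .
qed

lemma merge_fiber:
  "{\<kappa>\<in>proper_colorings V E. merge \<kappa> = \<gamma>} = recolor \<gamma> ` bipartitions E W"
proof (intro equalityI subsetI)
  fix \<kappa> assume \<kappa>: "\<kappa> \<in> {\<kappa>\<in>proper_colorings V E. merge \<kappa> = \<gamma>}"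
  define T where "T = {v\<in>V. \<kappa> v = Suc a}"
  have \<gamma>_eq: "\<gamma> v = (if \<kappa> v = Suc a then a else \<kappa> v)" if "v \<in> V" for v
    using \<kappa> that by (auto simp: merge_def)
  then have "T \<subseteq> W" by (auto simp: T_def W_def)
  moreover have "recolor \<gamma> T = \<kappa>"
  proof
    fix v
    show "recolor \<gamma> T v = \<kappa> v"
    proof (cases "v \<in> V")
      case True
      then show ?thesis using \<gamma>_eq[OF True] by (auto simp: recolor_def T_def)
    next
      case False
      then show ?thesis using \<kappa> by (auto simp: recolor_def proper_colorings_def PiE_iff extensional_def)
    qed
  qed
  ultimately show "\<kappa> \<in> recolor \<gamma> ` bipartitions E W"
    using recolor_proper_iff[of T] \<kappa> by auto
next
  fix \<kappa> assume "\<kappa> \<in> recolor \<gamma> ` bipartitions E W"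
  then obtain T where T: "T \<in> bipartitions E W" "\<kappa> = recolor \<gamma> T" by blast
  then have TW: "T \<subseteq> W" by (simp add: bipartitions_def)
  have "merge \<kappa> = \<gamma>"
  proof
    fix v
    show "merge \<kappa> v = \<gamma> v"
    proof (cases "v \<in> V")
      case True
      then show ?thesis using TW \<gamma>_neq[OF True]
        by (auto simp: merge_def T(2) recolor_apply[OF TW] W_def)
    next
      case False
      then show ?thesis using \<gamma>_ext by (auto simp: merge_def PiE_iff extensional_def)
    qed
  qed
  then show "\<kappa> \<in> {\<kappa>\<in>proper_colorings V E. merge \<kappa> = \<gamma>}"
    using T recolor_proper_iff[OF TW] by simp
qed

lemma inj_on_recolor: "inj_on (recolor \<gamma>) (bipartitions E W)"
proof (rule inj_on_inverseI[of _ "\<lambda>\<kappa>. {v\<in>V. \<kappa> v = Suc a}"])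
  fix T assume "T \<in> bipartitions E W"
  then have T: "T \<subseteq> W" by (simp add: bipartitions_def)
  then have "T \<subseteq> V" using W_subset by blast
  then show "{v\<in>V. recolor \<gamma> T v = Suc a} = T"
    using \<gamma>_neq by (auto simp: recolor_apply[OF T] split: if_splits)
qed

definition fixed_inv :: nat where
  "fixed_inv = card {(i, j). {i, j} \<in> E \<and> i < j \<and> \<not> (i \<in> W \<and> j \<in> W) \<and> \<gamma> i > \<gamma> j}"

text \<open>Colors outside the merged class are neither \<open>a\<close> nor \<open>Suc a\<close>
  and compare in the same way with both, so only edges inside the class feel the choice of
  \<open>T\<close>.\<close>

lemma coloring_inv_recolor:
  assumes "T \<subseteq> W"
  shows "coloring_inv E (recolor \<gamma> T) = bipartition_inv E W T + fixed_inv"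
proof -
  let ?A = "{(i, j). i \<in> T \<and> j \<in> W - T \<and> i < j \<and> {i, j} \<in> E}"
  let ?B = "{(i, j). {i, j} \<in> E \<and> i < j \<and> \<not> (i \<in> W \<and> j \<in> W) \<and> \<gamma> i > \<gamma> j}"
  have "recolor \<gamma> T i > recolor \<gamma> T j \<longleftrightarrow>
      i \<in> T \<and> j \<in> W - T \<or> \<not> (i \<in> W \<and> j \<in> W) \<and> \<gamma> i > \<gamma> j" if "{i, j} \<in> E" for i j
  proof -
    have v: "i \<in> V" "j \<in> V" using edge[OF that] by auto
    have "\<gamma> i \<noteq> Suc a" "\<gamma> j \<noteq> Suc a" using \<gamma>_neq v by auto
    moreover have "\<gamma> i = a \<longleftrightarrow> i \<in> W" "\<gamma> j = a \<longleftrightarrow> j \<in> W" using v by (auto simp: W_def)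
    ultimately show ?thesis
      using assms by (cases "i \<in> T"; cases "j \<in> T") (auto simp: recolor_apply[OF assms] v)
  qed
  then have "{(i, j). {i, j} \<in> E \<and> i < j \<and> recolor \<gamma> T i > recolor \<gamma> T j} = ?A \<union> ?B" by blast
  moreover have "?A \<inter> ?B = {}" using assms by blast
  moreover have "finite ?A" by (rule finite_subset[OF _ finite_edge_pairs[of "\<lambda>_ _. True"]]) auto
  moreover have "finite ?B" by (rule finite_edge_pairs)
  ultimately show ?thesis
    unfolding coloring_inv_def bipartition_inv_def fixed_inv_def by (simp add: card_Un_disjoint)
qed

definition fixed_content :: "nat multiset" where
  "fixed_content = image_mset \<gamma> (mset_set (V - W))"

lemma content_recolor:
  assumes T: "T \<subseteq> W"
  shows "image_mset (recolor \<gamma> T) (mset_set V) =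
    fixed_content + replicate_mset (card T) (Suc a) + replicate_mset (card W - card T) a"
proof -
  have fin: "finite V" "finite W" "finite T"
    using finite_V W_subset T by (auto intro: finite_subset)
  have "V = (V - W) \<union> (T \<union> (W - T))" using T W_subset by blast
  then have "mset_set V = mset_set ((V - W) \<union> (T \<union> (W - T)))" by simp
  also have "\<dots> = mset_set (V - W) + mset_set (T \<union> (W - T))"
    using fin T by (intro mset_set_Union) auto
  also have "mset_set (T \<union> (W - T)) = mset_set T + mset_set (W - T)"
    using fin by (intro mset_set_Union) auto
  finally have V: "mset_set V = mset_set (V - W) + (mset_set T + mset_set (W - T))" .
  have "image_mset (recolor \<gamma> T) (mset_set (V - W)) = fixed_content"
    unfolding fixed_content_def using fin T
    by (intro image_mset_cong) (auto simp: recolor_apply[OF T])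
  moreover have "image_mset (recolor \<gamma> T) (mset_set T) = image_mset (\<lambda>_. Suc a) (mset_set T)"
    using fin T W_subset by (intro image_mset_cong) (auto simp: recolor_def)
  moreover have "image_mset (recolor \<gamma> T) (mset_set (W - T)) = image_mset (\<lambda>_. a) (mset_set (W - T))"
    using fin T W_subset by (intro image_mset_cong) (auto simp: recolor_def W_def)
  moreover have "card (W - T) = card W - card T" using T fin by (simp add: card_Diff_subset)
  ultimately show ?thesis unfolding V by (simp add: image_mset_const_eq add.assoc)
qed

lemma transpose_fixed_content: "image_mset (transpose a (Suc a)) fixed_content = fixed_content"
proof -
  have "image_mset (transpose a (Suc a)) fixed_content = image_mset (\<lambda>x. x) fixed_content"
  proof (rule image_mset_cong)
    fix x assume "x \<in># fixed_content"
    then obtain v where "v \<in> V" "v \<notin> W" "x = \<gamma> v"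
      using finite_V by (auto simp: fixed_content_def)
    then show "transpose a (Suc a) x = x" using \<gamma>_neq by (auto simp: W_def)
  qed
  then show ?thesis by simp
qed

text \<open>Within a fiber, exchanging the exponents of the two colors replaces the size of
  \<open>T\<close> by that of its complement in \<open>W\<close>, so the palindromic property
  applies.\<close>

lemma fiber_sum:
  "(\<Sum>\<kappa> | \<kappa> \<in> colorings_of M \<and> merge \<kappa> = \<gamma>. monom (1::int) (coloring_inv E \<kappa>)) =
    (\<Sum>\<kappa> | \<kappa> \<in> colorings_of (image_mset (transpose a (Suc a)) M) \<and> merge \<kappa> = \<gamma>. monom 1 (coloring_inv E \<kappa>))"
proof -
  let ?t = "image_mset (transpose a (Suc a))"
  define content where "content r = fixed_content + replicate_mset r (Suc a) + replicate_mset (card W - r) a" for r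
  have tt: "?t (?t N) = N" for N by (simp add: multiset.map_comp)
  have flip: "content r = ?t M \<longleftrightarrow> content (card W - r) = M" if "r \<le> card W" for r
  proof -
    have "?t (content r) = content (card W - r)"
      using that by (simp add: content_def transpose_fixed_content add_ac)
    then show ?thesis using tt by metis
  qed
  have sum: "(\<Sum>\<kappa> | \<kappa> \<in> colorings_of N \<and> merge \<kappa> = \<gamma>. monom (1::int) (coloring_inv E \<kappa>)) =
      monom 1 fixed_inv * (\<Sum>T | T \<in> bipartitions E W \<and> content (card T) = N. monom 1 (bipartition_inv E W T))" for N
  proof -
    have "{\<kappa>. \<kappa> \<in> colorings_of N \<and> merge \<kappa> = \<gamma>} =
        recolor \<gamma> ` {T. T \<in> bipartitions E W \<and> content (card T) = N}"
    proof -
      have "{\<kappa>. \<kappa> \<in> colorings_of N \<and> merge \<kappa> = \<gamma>} =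
          {\<kappa>\<in>{\<kappa>\<in>proper_colorings V E. merge \<kappa> = \<gamma>}. image_mset \<kappa> (mset_set V) = N}"
        by (auto simp: colorings_of_def)
      also have "\<dots> = recolor \<gamma> ` {T \<in> bipartitions E W. image_mset (recolor \<gamma> T) (mset_set V) = N}"
        unfolding merge_fiber by blast
      also have "{T \<in> bipartitions E W. image_mset (recolor \<gamma> T) (mset_set V) = N} =
          {T. T \<in> bipartitions E W \<and> content (card T) = N}"
        using content_recolor by (auto simp: bipartitions_def content_def)
      finally show ?thesis .
    qed
    moreover have "inj_on (recolor \<gamma>) {T. T \<in> bipartitions E W \<and> content (card T) = N}"
      using inj_on_recolor by (rule inj_on_subset) auto
    moreover have "coloring_inv E (recolor \<gamma> T) = fixed_inv + bipartition_inv E W T"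
      if "T \<in> bipartitions E W" for T
      using coloring_inv_recolor[of T] that by (simp add: bipartitions_def)
    ultimately show ?thesis
      by (simp add: sum.reindex sum_distrib_left mult_monom)
  qed
  have le: "card T \<le> card W" if "T \<in> bipartitions E W" for T
    using that finite_subset[OF W_subset finite_V] by (intro card_mono) (auto simp: bipartitions_def)
  have "(\<Sum>T | T \<in> bipartitions E W \<and> content (card T) = M. monom (1::int) (bipartition_inv E W T)) =
      (\<Sum>T | T \<in> bipartitions E W \<and> content (card W - card T) = M. monom 1 (bipartition_inv E W T))"
    by (rule sum_bipartitions_flip[OF W_subset, of "\<lambda>r. content r = M"])
  also have "\<dots> = (\<Sum>T | T \<in> bipartitions E W \<and> content (card T) = ?t M. monom 1 (bipartition_inv E W T))"
    using flip le by (intro sum.cong) auto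
  finally show ?thesis unfolding sum by simp
qed

end

lemma chromatic_qsym_transpose:
  "chromatic_qsym V E (image_mset (transpose a (Suc a)) M) = chromatic_qsym V E M"
proof -
  let ?M = "image_mset (transpose a (Suc a)) M"
  \<comment> \<open>A common index set for both contents. A merged coloring without a preimage of
    one of the contents contributes an empty sum there.\<close>
  define G where "G = merge ` (colorings_of M \<union> colorings_of ?M)"
  have group: "chromatic_qsym V E N =
      (\<Sum>\<gamma>\<in>G. \<Sum>\<kappa> | \<kappa> \<in> colorings_of N \<and> merge \<kappa> = \<gamma>. monom 1 (coloring_inv E \<kappa>))"
    if "merge ` colorings_of N \<subseteq> G" for N
    unfolding chromatic_qsym_eq
    using that finite_colorings_of by (intro sum.group[symmetric]) (auto simp: G_def)
  have "\<exists>\<kappa>\<in>proper_colorings V E. merge \<kappa> = \<gamma>" if "\<gamma> \<in> G" for \<gamma>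
    using that by (auto simp: G_def colorings_of_def)
  then have "(\<Sum>\<gamma>\<in>G. \<Sum>\<kappa> | \<kappa> \<in> colorings_of M \<and> merge \<kappa> = \<gamma>. monom (1::int) (coloring_inv E \<kappa>)) =
      (\<Sum>\<gamma>\<in>G. \<Sum>\<kappa> | \<kappa> \<in> colorings_of ?M \<and> merge \<kappa> = \<gamma>. monom 1 (coloring_inv E \<kappa>))"
    by (intro sum.cong[OF refl] fiber_sum) blast
  moreover have "merge ` colorings_of M \<subseteq> G" "merge ` colorings_of ?M \<subseteq> G" by (auto simp: G_def)
  ultimately show ?thesis using group[of M] group[of ?M] by simp
qed

end

lemma sym_series_chromatic_qsym: "sym_series (chromatic_qsym V E)"
  using chromatic_qsym_transpose by (simp add: sym_series_def)

end

section \<open>Packed colorings\<close>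

definition rank :: "nat set \<Rightarrow> nat \<Rightarrow> nat" where
  "rank A c = card {a\<in>A. a \<le> c}"

lemma rank_less_iff:
  assumes "finite A" "b \<in> A" "c \<in> A"
  shows "rank A b < rank A c \<longleftrightarrow> b < c"
proof -
  have mono: "rank A x \<le> rank A y" if "x \<le> y" for x y
    unfolding rank_def using assms(1) that by (intro card_mono) auto
  have "rank A x < rank A y" if "x < y" "y \<in> A" for x y
  proof -
    have "{a\<in>A. a \<le> x} \<subseteq> {a\<in>A. a \<le> y}" "y \<in> {a\<in>A. a \<le> y}" "y \<notin> {a\<in>A. a \<le> x}"
      using that by auto
    then have "{a\<in>A. a \<le> x} \<subset> {a\<in>A. a \<le> y}" by blast
    then show ?thesis unfolding rank_def using assms(1) by (intro psubset_card_mono) auto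
  qed
  then show ?thesis using assms mono[of c b] by (meson leD not_le_imp_less)
qed

lemma rank_eq_iff:
  assumes "finite A" "b \<in> A" "c \<in> A"
  shows "rank A b = rank A c \<longleftrightarrow> b = c"
  using rank_less_iff[OF assms] rank_less_iff[OF assms(1,3,2)] by (metis nat_neq_iff)

lemma rank_image:
  assumes "finite A"
  shows "rank A ` A = {1..card A}"
proof (rule card_seteq)
  show "rank A ` A \<subseteq> {1..card A}"
  proof
    fix r assume "r \<in> rank A ` A"
    then obtain c where c: "c \<in> A" "r = rank A c" by blast
    have "rank A c \<le> card A" unfolding rank_def using assms by (intro card_mono) auto
    moreover have "{a\<in>A. a \<le> c} \<noteq> {}" using c by auto
    then have "0 < rank A c" unfolding rank_def using assms by (simp add: card_gt_0_iff)
    ultimately show "r \<in> {1..card A}" using c by simp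
  qed
  have "inj_on (rank A) A" using rank_eq_iff[OF assms] by (intro inj_onI) blast
  then show "card {1..card A} \<le> card (rank A ` A)" by (simp add: card_image)
qed simp

text \<open>A new color inserted just below color p cancels against reusing color p, unless p lies
  in \<open>C\<close>. What remains are the positions in \<open>C\<close> and the top position
  \<open>Suc k\<close>, where the count takes each value 0, ..., \<open>card C\<close> once.\<close>

lemma telescoping_gaps:
  fixes f :: "nat \<Rightarrow> 'a::comm_ring_1"
  assumes C: "C \<subseteq> {1..k}"
  shows "(\<Sum>p\<in>{1..Suc k}. f (card {c\<in>C. c < p})) - (\<Sum>p\<in>{1..k} - C. f (card {c\<in>C. c < p})) =
    (\<Sum>i<Suc (card C). f i)"
proof -
  have fin: "finite C" using C finite_subset by blast
  have "{c\<in>C. c < Suc k} = C" using C by auto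
  moreover have "{1..Suc k} = insert (Suc k) {1..k}" by auto
  ultimately have "(\<Sum>p\<in>{1..Suc k}. f (card {c\<in>C. c < p})) =
      f (card C) + (\<Sum>p\<in>{1..k}. f (card {c\<in>C. c < p}))" by simp
  also have "(\<Sum>p\<in>{1..k}. f (card {c\<in>C. c < p})) =
      (\<Sum>p\<in>{1..k} - C. f (card {c\<in>C. c < p})) + (\<Sum>p\<in>C. f (card {c\<in>C. c < p}))"
    using C by (intro sum.subset_diff) auto
  also have "(\<Sum>p\<in>C. f (card {c\<in>C. c < p})) = (\<Sum>i<card C. f i)"
    by (rule sum_card_less[OF fin])
  finally show ?thesis by (simp add: algebra_simps)
qed

context interval_graph
begin

definition packed :: "nat set \<Rightarrow> (nat \<Rightarrow> nat) set" where
  "packed U = {\<kappa> \<in> proper_colorings U E. \<kappa> ` U = {1..card (\<kappa> ` U)}}"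

definition inv_on :: "nat set \<Rightarrow> (nat \<Rightarrow> nat) \<Rightarrow> nat" where
  "inv_on U \<kappa> = card {(i, j). i \<in> U \<and> j \<in> U \<and> {i, j} \<in> E \<and> i < j \<and> \<kappa> i > \<kappa> j}"

text \<open>An added vertex flips the sign when it reuses a color and keeps it when it brings a
  color of its own.\<close>

definition signed_weight :: "nat set \<Rightarrow> (nat \<Rightarrow> nat) \<Rightarrow> int poly" where
  "signed_weight U \<kappa> = (-1) ^ (card U + card (\<kappa> ` U)) * monom 1 (inv_on U \<kappa>)"

definition packed_sum :: "nat set \<Rightarrow> int poly" where
  "packed_sum U = (\<Sum>\<kappa>\<in>packed U. signed_weight U \<kappa>)"

lemma finite_packed: "finite U \<Longrightarrow> finite (packed U)"
proof -
  assume U: "finite U"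
  have "packed U \<subseteq> U \<rightarrow>\<^sub>E {1..card U}"
  proof
    fix \<kappa> assume \<kappa>: "\<kappa> \<in> packed U"
    have "card (\<kappa> ` U) \<le> card U" using U by (rule card_image_le)
    then have "{1..card (\<kappa> ` U)} \<subseteq> {1..card U}" by simp
    moreover have im: "\<kappa> ` U = {1..card (\<kappa> ` U)}" and "\<kappa> \<in> extensional U"
      using \<kappa> by (auto simp: packed_def proper_colorings_def PiE_iff)
    ultimately have "\<kappa> ` U \<subseteq> {1..card U}" by (metis im)
    then show "\<kappa> \<in> U \<rightarrow>\<^sub>E {1..card U}" using \<open>\<kappa> \<in> extensional U\<close>
      by (simp add: PiE_iff image_subset_iff)
  qed
  moreover have "finite (U \<rightarrow>\<^sub>E {1..card U})" using U by (intro finite_PiE) auto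
  ultimately show ?thesis by (rule finite_subset)
qed

lemma inv_on_V: "inv_on V \<kappa> = coloring_inv E \<kappa>"
  unfolding inv_on_def coloring_inv_def using edge by (intro arg_cong[of _ _ card]) blast

definition bounded_colorings :: "nat \<Rightarrow> (nat \<Rightarrow> nat) set" where
  "bounded_colorings k = {\<kappa> \<in> proper_colorings V E. \<kappa> ` V \<subseteq> {1..k}}"

lemma finite_bounded_colorings: "finite (bounded_colorings k)"
proof (rule finite_subset)
  show "bounded_colorings k \<subseteq> V \<rightarrow>\<^sub>E {1..k}"
    by (rule subsetI) (simp add: bounded_colorings_def proper_colorings_def PiE_iff image_subset_iff)
qed (simp add: finite_PiE finite_V)

lemma spec_chromatic_qsym:
  "spec (card V) k (chromatic_qsym V E) = (\<Sum>\<kappa>\<in>bounded_colorings k. monom 1 (inv_on V \<kappa>))"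
proof -
  have "(\<Sum>\<kappa>\<in>bounded_colorings k. monom (1::int) (inv_on V \<kappa>)) =
      (\<Sum>M\<in>monomials (card V) k. \<Sum>\<kappa> | \<kappa> \<in> bounded_colorings k \<and> image_mset \<kappa> (mset_set V) = M.
        monom 1 (inv_on V \<kappa>))"
  proof (intro sum.group[symmetric] finite_bounded_colorings finite_monomials)
    show "(\<lambda>\<kappa>. image_mset \<kappa> (mset_set V)) ` bounded_colorings k \<subseteq> monomials (card V) k"
      using finite_V by (auto simp: monomials_def bounded_colorings_def)
  qed
  also have "\<dots> = (\<Sum>M\<in>monomials (card V) k. chromatic_qsym V E M)"
    unfolding chromatic_qsym_eq inv_on_V
  proof (intro sum.cong[OF refl] sum.cong)
    fix M assume "M \<in> monomials (card V) k"
    then show "{\<kappa>. \<kappa> \<in> bounded_colorings k \<and> image_mset \<kappa> (mset_set V) = M} = colorings_of M"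
      using finite_V by (auto simp: monomials_def bounded_colorings_def colorings_of_def)
  qed simp
  finally show ?thesis by (simp add: spec_def)
qed

definition pack :: "(nat \<Rightarrow> nat) \<Rightarrow> nat \<Rightarrow> nat" where
  "pack \<kappa> = (\<lambda>v\<in>V. rank (\<kappa> ` V) (\<kappa> v))"

lemma pack_image: "pack \<kappa> ` V = {1..card (\<kappa> ` V)}"
proof -
  have "pack \<kappa> ` V = rank (\<kappa> ` V) ` \<kappa> ` V" by (auto simp: pack_def)
  then show ?thesis using rank_image[of "\<kappa> ` V"] finite_V by simp
qed

lemma pack_less_iff: "v \<in> V \<Longrightarrow> w \<in> V \<Longrightarrow> pack \<kappa> v < pack \<kappa> w \<longleftrightarrow> \<kappa> v < \<kappa> w"
  using rank_less_iff[of "\<kappa> ` V" "\<kappa> v" "\<kappa> w"] finite_V by (simp add: pack_def)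

lemma pack_eq_iff: "v \<in> V \<Longrightarrow> w \<in> V \<Longrightarrow> pack \<kappa> v = pack \<kappa> w \<longleftrightarrow> \<kappa> v = \<kappa> w"
  using rank_eq_iff[of "\<kappa> ` V" "\<kappa> v" "\<kappa> w"] finite_V by (simp add: pack_def)

lemma pack_packed:
  assumes "\<kappa> \<in> proper_colorings V E"
  shows "pack \<kappa> \<in> packed V"
proof -
  have im: "pack \<kappa> ` V = {1..card (\<kappa> ` V)}" by (rule pack_image)
  then have "pack \<kappa> \<in> V \<rightarrow>\<^sub>E {1..}" by (auto simp: pack_def PiE_iff)
  moreover have "pack \<kappa> x \<noteq> pack \<kappa> y" if "x \<in> V" "y \<in> V" "{x, y} \<in> E" for x y
    using assms that by (simp add: pack_eq_iff proper_colorings_def)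
  ultimately show ?thesis using im by (auto simp: packed_def proper_colorings_def)
qed

lemma inv_on_pack: "inv_on V (pack \<kappa>) = inv_on V \<kappa>"
  unfolding inv_on_def by (intro arg_cong[of _ _ card]) (auto simp: pack_less_iff)

text \<open>A coloring with a given packed form is determined by its set of colors, which can be any
  subset of {1..k} of the right size.\<close>

lemma card_pack_fiber:
  assumes \<kappa>: "\<kappa> \<in> packed V"
  shows "card {\<mu>\<in>bounded_colorings k. pack \<mu> = \<kappa>} = k choose card (\<kappa> ` V)"
proof -
  let ?j = "card (\<kappa> ` V)"
  let ?F = "{\<mu>\<in>bounded_colorings k. pack \<mu> = \<kappa>}"
  have \<kappa>_props: "\<kappa> \<in> extensional V" "\<kappa> ` V = {1..?j}" "\<And>x y. x \<in> V \<Longrightarrow> y \<in> V \<Longrightarrow> {x, y} \<in> E \<Longrightarrow> \<kappa> x \<noteq> \<kappa> y"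
    using \<kappa> by (auto simp: packed_def proper_colorings_def PiE_iff)
  have "bij_betw (\<lambda>\<mu>. \<mu> ` V) ?F {A. A \<subseteq> {1..k} \<and> card A = ?j}"
  proof (rule bij_betw_imageI)
    show "inj_on (\<lambda>\<mu>. \<mu> ` V) ?F"
    proof (rule inj_onI, rule ext)
      fix \<mu> \<nu> v assume \<mu>: "\<mu> \<in> ?F" and \<nu>: "\<nu> \<in> ?F" and eq: "\<mu> ` V = \<nu> ` V"
      show "\<mu> v = \<nu> v"
      proof (cases "v \<in> V")
        case True
        have "pack \<mu> v = pack \<nu> v" using \<mu> \<nu> by simp
        then have "rank (\<mu> ` V) (\<mu> v) = rank (\<mu> ` V) (\<nu> v)" using True eq by (simp add: pack_def)
        moreover have "\<nu> v \<in> \<mu> ` V" using True eq by simp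
        ultimately show ?thesis using rank_eq_iff[of "\<mu> ` V" "\<mu> v" "\<nu> v"] True finite_V by simp
      next
        case False
        then show ?thesis using \<mu> \<nu>
          by (simp add: bounded_colorings_def proper_colorings_def PiE_iff extensional_def)
      qed
    qed
    show "(\<lambda>\<mu>. \<mu> ` V) ` ?F = {A. A \<subseteq> {1..k} \<and> card A = ?j}"
    proof (intro equalityI subsetI)
      fix A assume "A \<in> (\<lambda>\<mu>. \<mu> ` V) ` ?F"
      then obtain \<mu> where \<mu>: "\<mu> \<in> bounded_colorings k" "pack \<mu> = \<kappa>" "A = \<mu> ` V" by blast
      have "card (\<kappa> ` V) = card (\<mu> ` V)" using pack_image[of \<mu>] \<mu>(2) by simp
      then show "A \<in> {A. A \<subseteq> {1..k} \<and> card A = ?j}" using \<mu> by (simp add: bounded_colorings_def)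
    next
      fix A assume "A \<in> {A. A \<subseteq> {1..k} \<and> card A = ?j}"
      then have A: "A \<subseteq> {1..k}" "card A = ?j" by auto
      have fin: "finite A" using A(1) finite_subset by blast
      have rim: "rank A ` A = {1..?j}" using rank_image[OF fin] A(2) by simp
      \<comment> \<open>\<open>g i\<close> is the i-th smallest element of \<open>A\<close>.\<close>
      define g where "g = inv_into A (rank A)"
      have g: "g i \<in> A" "rank A (g i) = i" if "i \<in> {1..?j}" for i
        using that unfolding g_def rim[symmetric] by (auto intro: inv_into_into f_inv_into_f)
      have g_rank: "g (rank A c) = c" if "c \<in> A" for c
        unfolding g_def using that rank_eq_iff[OF fin] by (intro inv_into_f_f inj_onI) blast+
      define \<mu> where "\<mu> = (\<lambda>v\<in>V. g (\<kappa> v))"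
      have "\<mu> ` V = g ` \<kappa> ` V" by (auto simp: \<mu>_def)
      also have "\<dots> = g ` rank A ` A" using \<kappa>_props(2) rim by simp
      also have "\<dots> = A" using g_rank by (force simp: image_iff)
      finally have im: "\<mu> ` V = A" .
      have \<kappa>_range: "\<kappa> v \<in> {1..?j}" if "v \<in> V" for v using that \<kappa>_props(2) by blast
      have pack: "pack \<mu> = \<kappa>"
      proof
        fix v show "pack \<mu> v = \<kappa> v"
        proof (cases "v \<in> V")
          case True
          then show ?thesis using g(2)[OF \<kappa>_range[OF True]] im by (simp add: pack_def \<mu>_def)
        next
          case False
          then show ?thesis using \<kappa>_props(1) by (simp add: pack_def extensional_def)
        qed
      qed
      have "\<mu> x \<noteq> \<mu> y" if "x \<in> V" "y \<in> V" "{x, y} \<in> E" for x y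
        using \<kappa>_props(3)[OF that] pack_eq_iff[OF that(1,2), of \<mu>] pack by simp
      moreover have "\<mu> \<in> V \<rightarrow>\<^sub>E {1..}"
        using im A(1) by (auto simp: \<mu>_def PiE_iff)
      ultimately have "\<mu> \<in> bounded_colorings k"
        using im A(1) by (simp add: bounded_colorings_def proper_colorings_def)
      then show "A \<in> (\<lambda>\<mu>. \<mu> ` V) ` ?F" using im pack by blast
    qed
  qed
  then have "card ?F = card {A. A \<subseteq> {1..k} \<and> card A = ?j}" by (rule bij_betw_same_card)
  also have "\<dots> = k choose ?j" using n_subsets[of "{1..k}" ?j] by simp
  finally show ?thesis .
qed

lemma spec_chromatic_qsym_packed:
  "spec (card V) k (chromatic_qsym V E) =
    (\<Sum>\<kappa>\<in>packed V. monom 1 (inv_on V \<kappa>) * of_nat (k choose card (\<kappa> ` V)))"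
proof -
  have "spec (card V) k (chromatic_qsym V E) =
      (\<Sum>\<kappa>\<in>packed V. \<Sum>\<mu> | \<mu> \<in> bounded_colorings k \<and> pack \<mu> = \<kappa>. monom 1 (inv_on V \<mu>))"
    unfolding spec_chromatic_qsym
    by (intro sum.group[symmetric] finite_bounded_colorings finite_packed finite_V)
      (auto simp: bounded_colorings_def pack_packed)
  also have "\<dots> = (\<Sum>\<kappa>\<in>packed V. monom 1 (inv_on V \<kappa>) * of_nat (k choose card (\<kappa> ` V)))"
  proof (rule sum.cong[OF refl])
    fix \<kappa> assume \<kappa>: "\<kappa> \<in> packed V"
    have "(\<Sum>\<mu> | \<mu> \<in> bounded_colorings k \<and> pack \<mu> = \<kappa>. monom (1::int) (inv_on V \<mu>)) =
        (\<Sum>\<mu> | \<mu> \<in> bounded_colorings k \<and> pack \<mu> = \<kappa>. monom 1 (inv_on V \<kappa>))"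
      by (intro sum.cong[OF refl]) (auto simp: inv_on_pack)
    then show "(\<Sum>\<mu> | \<mu> \<in> bounded_colorings k \<and> pack \<mu> = \<kappa>. monom (1::int) (inv_on V \<mu>)) =
        monom 1 (inv_on V \<kappa>) * of_nat (k choose card (\<kappa> ` V))"
      using card_pack_fiber[OF \<kappa>, of k] by (simp add: mult.commute)
  qed
  finally show ?thesis .
qed

text \<open>A packed coloring with j colors contributes \<open>k choose j\<close> to the
  specialisation, and extrapolation turns this into the sign in
  \<open>signed_weight\<close>.\<close>

lemma extrapolate_chromatic_qsym:
  "extrapolate (card V) (\<lambda>k. spec (card V) k (chromatic_qsym V E)) = packed_sum V"
proof -
  let ?n = "card V"
  have "extrapolate ?n (\<lambda>k. spec ?n k (chromatic_qsym V E)) =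
      (\<Sum>\<kappa>\<in>packed V. monom 1 (inv_on V \<kappa>) * extrapolate ?n (\<lambda>k. of_nat (k choose card (\<kappa> ` V))))"
    unfolding extrapolate_def spec_chromatic_qsym_packed sum_distrib_left
    by (subst sum.swap) (simp only: mult.left_commute)
  also have "\<dots> = packed_sum V"
    unfolding packed_sum_def
  proof (rule sum.cong[OF refl])
    fix \<kappa> assume "\<kappa> \<in> packed V"
    have "card (\<kappa> ` V) \<le> ?n" using finite_V by (rule card_image_le)
    then have "extrapolate ?n (\<lambda>k. of_nat (k choose card (\<kappa> ` V))) = (-1) ^ (?n + card (\<kappa> ` V))"
      using extrapolate_prod_binomial[of "[card (\<kappa> ` V)]" ?n] by simp
    then show "monom 1 (inv_on V \<kappa>) * extrapolate ?n (\<lambda>k. of_nat (k choose card (\<kappa> ` V))) = signed_weight V \<kappa>"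
      by (simp add: signed_weight_def)
  qed
  finally show ?thesis .
qed

end

text \<open>Makes room for a new color p: the colors from p on move up by one, which preserves their
  order and their position relative to p.\<close>

definition open_gap :: "nat \<Rightarrow> nat \<Rightarrow> nat" where
  "open_gap p c = (if p \<le> c then Suc c else c)"

definition close_gap :: "nat \<Rightarrow> nat \<Rightarrow> nat" where
  "close_gap p c = (if p < c then c - 1 else c)"

lemma close_open_gap [simp]: "close_gap p (open_gap p c) = c"
  by (simp add: open_gap_def close_gap_def)

lemma open_close_gap: "c \<noteq> p \<Longrightarrow> open_gap p (close_gap p c) = c"
  by (auto simp: open_gap_def close_gap_def)

lemma open_gap_less_iff: "open_gap p c < open_gap p d \<longleftrightarrow> c < d"
  by (auto simp: open_gap_def)

lemma open_gap_neq: "open_gap p c \<noteq> p"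
  by (simp add: open_gap_def)

lemma open_gap_less: "open_gap p c < p \<longleftrightarrow> c < p"
  by (simp add: open_gap_def)

lemma open_gap_image:
  assumes "p \<in> {1..Suc k}"
  shows "insert p (open_gap p ` {1..k}) = {1..Suc k}"
proof (intro equalityI subsetI)
  fix c assume "c \<in> {1..Suc k}"
  then have "c = p \<or> close_gap p c \<in> {1..k} \<and> c = open_gap p (close_gap p c)"
    using assms by (auto simp: close_gap_def open_gap_def)
  then show "c \<in> insert p (open_gap p ` {1..k})" by blast
next
  fix c assume "c \<in> insert p (open_gap p ` {1..k})"
  then consider "c = p" | d where "d \<in> {1..k}" "c = open_gap p d" by blast
  then show "c \<in> {1..Suc k}"
    by cases (use assms in \<open>simp_all add: open_gap_def\<close>)
qed

lemma close_gap_image: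
  assumes "p \<in> {1..Suc k}"
  shows "close_gap p ` ({1..Suc k} - {p}) = {1..k}"
proof -
  have "p \<notin> open_gap p ` {1..k}" by (metis imageE open_gap_neq)
  then have "{1..Suc k} - {p} = open_gap p ` {1..k}" using open_gap_image[OF assms] by blast
  then have "close_gap p ` ({1..Suc k} - {p}) = (\<lambda>c. close_gap p (open_gap p c)) ` {1..k}"
    by (simp only: image_image)
  then show ?thesis by simp
qed

section \<open>Inserting a new smallest vertex\<close>

context interval_graph
begin

lemma packedD:
  assumes "\<kappa> \<in> packed U"
  shows "\<kappa> \<in> extensional U" "\<kappa> ` U = {1..card (\<kappa> ` U)}"
    "x \<in> U \<Longrightarrow> y \<in> U \<Longrightarrow> {x, y} \<in> E \<Longrightarrow> \<kappa> x \<noteq> \<kappa> y"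
  using assms by (auto simp: packed_def proper_colorings_def PiE_iff)

lemma packedI:
  assumes "\<kappa> \<in> extensional U" "\<kappa> ` U = {1..k}"
    "\<And>x y. x \<in> U \<Longrightarrow> y \<in> U \<Longrightarrow> {x, y} \<in> E \<Longrightarrow> \<kappa> x \<noteq> \<kappa> y"
  shows "\<kappa> \<in> packed U"
proof -
  have "\<kappa> x \<in> {1..}" if "x \<in> U" for x
    using imageI[OF that, of \<kappa>] unfolding assms(2) by simp
  then show ?thesis using assms by (simp add: packed_def proper_colorings_def PiE_iff)
qed

context
  fixes v :: nat and U :: "nat set"
  assumes U: "insert v U \<subseteq> V" "\<forall>u\<in>U. v < u"
begin

definition nbrs :: "nat set" where
  "nbrs = {u\<in>U. {v, u} \<in> E}"

lemma v_notin: "v \<notin> U"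
  using U(2) by auto

lemma finite_U: "finite U"
  by (rule finite_subset[OF _ finite_V]) (use U(1) in blast)

lemma proper_insert_iff:
  "(\<forall>x\<in>insert v U. \<forall>y\<in>insert v U. {x, y} \<in> E \<longrightarrow> \<mu> x \<noteq> \<mu> y) \<longleftrightarrow>
    (\<forall>x\<in>U. \<forall>y\<in>U. {x, y} \<in> E \<longrightarrow> \<mu> x \<noteq> \<mu> y) \<and> (\<forall>u\<in>nbrs. \<mu> v \<noteq> \<mu> u)"
proof (rule iffI[rotated])
  assume *: "(\<forall>x\<in>U. \<forall>y\<in>U. {x, y} \<in> E \<longrightarrow> \<mu> x \<noteq> \<mu> y) \<and> (\<forall>u\<in>nbrs. \<mu> v \<noteq> \<mu> u)"
  show "\<forall>x\<in>insert v U. \<forall>y\<in>insert v U. {x, y} \<in> E \<longrightarrow> \<mu> x \<noteq> \<mu> y"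
  proof (intro ballI impI)
    fix x y assume xy: "x \<in> insert v U" "y \<in> insert v U" "{x, y} \<in> E"
    then have "{y, x} \<in> E" "x \<noteq> y" using edge_swap edge by blast+
    then consider "x = v" "y \<in> nbrs" | "y = v" "x \<in> nbrs" | "x \<in> U" "y \<in> U"
      using xy unfolding nbrs_def by blast
    then show "\<mu> x \<noteq> \<mu> y" using * xy(3) by cases (auto dest: sym)
  qed
qed (auto simp: nbrs_def)

lemma inv_on_insert:
  "inv_on (insert v U) \<mu> = inv_on U \<mu> + card {u\<in>nbrs. \<mu> u < \<mu> v}"
proof -
  let ?A = "{(i, j). i \<in> U \<and> j \<in> U \<and> {i, j} \<in> E \<and> i < j \<and> \<mu> i > \<mu> j}"
  let ?B = "(\<lambda>u. (v, u)) ` {u\<in>nbrs. \<mu> u < \<mu> v}"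
  have "\<not> u < v" if "u \<in> U" for u using U that by force
  then have "{(i, j). i \<in> insert v U \<and> j \<in> insert v U \<and> {i, j} \<in> E \<and> i < j \<and> \<mu> i > \<mu> j} = ?A \<union> ?B"
    using U(2) by (auto simp: nbrs_def)
  moreover have "?A \<inter> ?B = {}" using v_notin by auto
  moreover have "finite ?A" by (rule finite_subset[of _ "U \<times> U"]) (auto simp: finite_U)
  moreover have "finite ?B" using finite_U by (simp add: nbrs_def)
  moreover have "card ?B = card {u\<in>nbrs. \<mu> u < \<mu> v}" by (intro card_image inj_onI) auto
  ultimately show ?thesis unfolding inv_on_def by (simp add: card_Un_disjoint)
qed

text \<open>All neighbors of v in \<open>U\<close> are larger than v, so by \<open>interval\<close>
  they form a clique and their colors are distinct.\<close>

lemma inj_on_nbrs: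
  assumes "\<kappa> \<in> packed U"
  shows "inj_on \<kappa> nbrs"
proof (rule inj_onI)
  have neq: "\<kappa> x \<noteq> \<kappa> y" if xy: "x \<in> nbrs" "y \<in> nbrs" "x < y" for x y
  proof -
    have x: "x \<in> U" and y: "y \<in> U" and vy: "{v, y} \<in> E" using xy unfolding nbrs_def by blast+
    have "v \<le> x" using U(2) x by (simp add: less_imp_le)
    moreover have "x \<in> V" "y \<in> V" using U(1) x y by blast+
    ultimately have "{x, y} \<in> E" using interval[OF vy _ xy(3) order_refl] by blast
    then show ?thesis using packedD(3)[OF assms x y] by blast
  qed
  show "x = y" if "x \<in> nbrs" "y \<in> nbrs" "\<kappa> x = \<kappa> y" for x y
    using neq[OF that(1,2)] neq[OF that(2,1)] that(3) by (metis nat_neq_iff)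
qed

definition join :: "(nat \<Rightarrow> nat) \<Rightarrow> nat \<Rightarrow> nat \<Rightarrow> nat" where
  "join \<kappa> c = \<kappa>(v := c)"

definition split :: "(nat \<Rightarrow> nat) \<Rightarrow> nat \<Rightarrow> nat \<Rightarrow> nat" where
  "split \<kappa> p = (\<lambda>x\<in>insert v U. if x = v then p else open_gap p (\<kappa> x))"

text \<open>The inversions that v adds when it has color p. The formula is the same whether p is
  reused or newly inserted below the old p, which makes the cancellation possible.\<close>

definition weight_at :: "(nat \<Rightarrow> nat) \<Rightarrow> nat \<Rightarrow> int poly" where
  "weight_at \<kappa> p = monom 1 (card {c\<in>\<kappa> ` nbrs. c < p})"

lemma card_nbrs_less:
  assumes "\<kappa> \<in> packed U"
  shows "card {u\<in>nbrs. \<kappa> u < p} = card {c\<in>\<kappa> ` nbrs. c < p}"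
proof -
  have "{c\<in>\<kappa> ` nbrs. c < p} = \<kappa> ` {u\<in>nbrs. \<kappa> u < p}" by blast
  moreover have "inj_on \<kappa> {u\<in>nbrs. \<kappa> u < p}"
    using inj_on_nbrs[OF assms] by (rule inj_on_subset) auto
  ultimately show ?thesis by (simp add: card_image)
qed

text \<open>One more vertex but no more colors: hence the minus sign. The colors of the neighbors
  are forbidden.\<close>

lemma sum_joined:
  "(\<Sum>\<mu> | \<mu> \<in> packed (insert v U) \<and> \<mu> v \<in> \<mu> ` U. signed_weight (insert v U) \<mu>) =
    - (\<Sum>\<kappa>\<in>packed U. signed_weight U \<kappa> * (\<Sum>c\<in>\<kappa> ` U - \<kappa> ` nbrs. weight_at \<kappa> c))"
proof -
  have on_U: "join \<kappa> c x = \<kappa> x" if "x \<in> U" for \<kappa> c x using that v_notin by (auto simp: join_def)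
  have at_v: "join \<kappa> c v = c" for \<kappa> c by (simp add: join_def)
  have image_U: "join \<kappa> c ` U = \<kappa> ` U" for \<kappa> c using on_U by simp
  have image: "join \<kappa> c ` insert v U = \<kappa> ` U" if "c \<in> \<kappa> ` U" for \<kappa> c
    using that image_U at_v by auto
  have weight: "signed_weight (insert v U) (join \<kappa> c) = - (signed_weight U \<kappa> * weight_at \<kappa> c)"
    if "\<kappa> \<in> packed U" "c \<in> \<kappa> ` U" for \<kappa> c
  proof -
    have "inv_on U (join \<kappa> c) = inv_on U \<kappa>"
      unfolding inv_on_def by (intro arg_cong[of _ _ card]) (auto simp: on_U)
    moreover have "{u\<in>nbrs. join \<kappa> c u < c} = {u\<in>nbrs. \<kappa> u < c}"
      using on_U by (auto simp: nbrs_def)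
    ultimately have "inv_on (insert v U) (join \<kappa> c) = inv_on U \<kappa> + card {c'\<in>\<kappa> ` nbrs. c' < c}"
      using card_nbrs_less[OF that(1)] by (simp add: inv_on_insert at_v)
    then show ?thesis
      using finite_U v_notin
      by (simp add: signed_weight_def weight_at_def image[OF that(2)] mult_monom mult.assoc
          del: image_insert)
  qed
  have "(\<Sum>\<mu> | \<mu> \<in> packed (insert v U) \<and> \<mu> v \<in> \<mu> ` U. signed_weight (insert v U) \<mu>) =
      (\<Sum>(\<kappa>, c)\<in>Sigma (packed U) (\<lambda>\<kappa>. \<kappa> ` U - \<kappa> ` nbrs). - (signed_weight U \<kappa> * weight_at \<kappa> c))"
  proof (rule sum.reindex_bij_witness[of _ "\<lambda>(\<kappa>, c). join \<kappa> c" "\<lambda>\<mu>. (restrict \<mu> U, \<mu> v)"])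
    fix \<mu> assume "\<mu> \<in> {\<mu>. \<mu> \<in> packed (insert v U) \<and> \<mu> v \<in> \<mu> ` U}"
    then have \<mu>: "\<mu> \<in> packed (insert v U)" "\<mu> v \<in> \<mu> ` U" by auto
    note \<mu>D = packedD[OF \<mu>(1)]
    have "join (restrict \<mu> U) (\<mu> v) = \<mu>"
    proof
      show "join (restrict \<mu> U) (\<mu> v) x = \<mu> x" for x
        using \<mu>D(1) by (auto simp: join_def restrict_def extensional_def)
    qed
    then show j: "(case (restrict \<mu> U, \<mu> v) of (\<kappa>, c) \<Rightarrow> join \<kappa> c) = \<mu>" by simp
    \<comment> \<open>v brings no color of its own, so the restriction still uses all the colors and
      stays packed.\<close>
    have im: "restrict \<mu> U ` U = \<mu> ` insert v U" using \<mu>(2) by auto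
    have proper: "(\<forall>x\<in>U. \<forall>y\<in>U. {x, y} \<in> E \<longrightarrow> \<mu> x \<noteq> \<mu> y) \<and> (\<forall>u\<in>nbrs. \<mu> v \<noteq> \<mu> u)"
      using \<mu>D(3) proper_insert_iff by blast
    have \<kappa>: "restrict \<mu> U \<in> packed U"
    proof (rule packedI)
      show "restrict \<mu> U ` U = {1..card (\<mu> ` insert v U)}" using im \<mu>D(2) by simp
    qed (use proper in auto)
    have "restrict \<mu> U ` nbrs = \<mu> ` nbrs" by (auto simp: nbrs_def)
    then have "\<mu> v \<notin> restrict \<mu> U ` nbrs" using proper by auto
    then have mem: "\<mu> v \<in> restrict \<mu> U ` U - restrict \<mu> U ` nbrs" using \<mu>(2) by auto
    then show "(restrict \<mu> U, \<mu> v) \<in> Sigma (packed U) (\<lambda>\<kappa>. \<kappa> ` U - \<kappa> ` nbrs)" using \<kappa> by simp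
    show "(case (restrict \<mu> U, \<mu> v) of (\<kappa>, c) \<Rightarrow> - (signed_weight U \<kappa> * weight_at \<kappa> c)) =
        signed_weight (insert v U) \<mu>"
      using weight[OF \<kappa>, of "\<mu> v"] mem j by simp
  next
    fix q assume "q \<in> Sigma (packed U) (\<lambda>\<kappa>. \<kappa> ` U - \<kappa> ` nbrs)"
    then obtain \<kappa> c where q: "q = (\<kappa>, c)" and \<kappa>: "\<kappa> \<in> packed U" and c: "c \<in> \<kappa> ` U" "c \<notin> \<kappa> ` nbrs" by blast
    note \<kappa>D = packedD[OF \<kappa>]
    have "restrict (join \<kappa> c) U = \<kappa>"
    proof
      show "restrict (join \<kappa> c) U x = \<kappa> x" for x
        using \<kappa>D(1) on_U by (auto simp: restrict_def extensional_def)
    qed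
    then show "(restrict (case q of (\<kappa>, c) \<Rightarrow> join \<kappa> c) U, (case q of (\<kappa>, c) \<Rightarrow> join \<kappa> c) v) = q"
      by (simp add: q at_v)
    have "join \<kappa> c \<in> packed (insert v U)"
    proof (rule packedI)
      show "join \<kappa> c \<in> extensional (insert v U)"
        using \<kappa>D(1) by (auto simp: join_def extensional_def)
      show "join \<kappa> c ` insert v U = {1..card (\<kappa> ` U)}" using image[OF c(1)] \<kappa>D(2) by simp
      have "\<forall>u\<in>nbrs. join \<kappa> c v \<noteq> join \<kappa> c u" using c(2) on_U by (auto simp: nbrs_def at_v)
      moreover have "\<forall>x\<in>U. \<forall>y\<in>U. {x, y} \<in> E \<longrightarrow> join \<kappa> c x \<noteq> join \<kappa> c y"
        using \<kappa>D(3) by (simp add: on_U)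
      ultimately show "join \<kappa> c x \<noteq> join \<kappa> c y"
        if "x \<in> insert v U" "y \<in> insert v U" "{x, y} \<in> E" for x y
        using that proper_insert_iff by blast
    qed
    then show "(case q of (\<kappa>, c) \<Rightarrow> join \<kappa> c) \<in> {\<mu>. \<mu> \<in> packed (insert v U) \<and> \<mu> v \<in> \<mu> ` U}"
      using c(1) by (simp add: q at_v image_U)
  qed
  also have "\<dots> = (\<Sum>\<kappa>\<in>packed U. \<Sum>c\<in>\<kappa> ` U - \<kappa> ` nbrs. - (signed_weight U \<kappa> * weight_at \<kappa> c))"
    using finite_U by (intro sum.Sigma[symmetric] finite_packed) auto
  finally show ?thesis by (simp add: sum_negf sum_distrib_left)
qed

lemma sum_split:
  "(\<Sum>\<mu> | \<mu> \<in> packed (insert v U) \<and> \<mu> v \<notin> \<mu> ` U. signed_weight (insert v U) \<mu>) =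
    (\<Sum>\<kappa>\<in>packed U. signed_weight U \<kappa> * (\<Sum>p\<in>{1..Suc (card (\<kappa> ` U))}. weight_at \<kappa> p))"
proof -
  have on_U: "split \<kappa> p x = open_gap p (\<kappa> x)" if "x \<in> U" for \<kappa> p x
    using that v_notin by (auto simp: split_def)
  have at_v: "split \<kappa> p v = p" for \<kappa> p by (simp add: split_def)
  have image_U: "split \<kappa> p ` U = open_gap p ` \<kappa> ` U" for \<kappa> p using on_U by (simp add: image_image)
  have image: "split \<kappa> p ` insert v U = {1..Suc (card (\<kappa> ` U))}"
    if "\<kappa> \<in> packed U" "p \<in> {1..Suc (card (\<kappa> ` U))}" for \<kappa> p
  proof -
    have "split \<kappa> p ` insert v U = insert p (open_gap p ` {1..card (\<kappa> ` U)})"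
      unfolding image_insert image_U at_v packedD(2)[OF that(1), symmetric] ..
    then show ?thesis using open_gap_image[OF that(2)] by simp
  qed
  have weight: "signed_weight (insert v U) (split \<kappa> p) = signed_weight U \<kappa> * weight_at \<kappa> p"
    if "\<kappa> \<in> packed U" "p \<in> {1..Suc (card (\<kappa> ` U))}" for \<kappa> p
  proof -
    have "inv_on U (split \<kappa> p) = inv_on U \<kappa>"
      unfolding inv_on_def by (intro arg_cong[of _ _ card]) (auto simp: on_U open_gap_less_iff)
    moreover have "{u\<in>nbrs. split \<kappa> p u < p} = {u\<in>nbrs. \<kappa> u < p}"
      using on_U by (auto simp: nbrs_def open_gap_less)
    ultimately have "inv_on (insert v U) (split \<kappa> p) = inv_on U \<kappa> + card {c\<in>\<kappa> ` nbrs. c < p}"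
      using card_nbrs_less[OF that(1)] by (simp add: inv_on_insert at_v)
    then show ?thesis
      using finite_U v_notin
      by (simp add: signed_weight_def weight_at_def image[OF that] mult_monom mult.assoc del: image_insert)
  qed
  have "(\<Sum>\<mu> | \<mu> \<in> packed (insert v U) \<and> \<mu> v \<notin> \<mu> ` U. signed_weight (insert v U) \<mu>) =
      (\<Sum>(\<kappa>, p)\<in>Sigma (packed U) (\<lambda>\<kappa>. {1..Suc (card (\<kappa> ` U))}). signed_weight U \<kappa> * weight_at \<kappa> p)"
  proof (rule sum.reindex_bij_witness[of _ "\<lambda>(\<kappa>, p). split \<kappa> p"
        "\<lambda>\<mu>. (\<lambda>x\<in>U. close_gap (\<mu> v) (\<mu> x), \<mu> v)"])
    fix \<mu> assume "\<mu> \<in> {\<mu>. \<mu> \<in> packed (insert v U) \<and> \<mu> v \<notin> \<mu> ` U}"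
    then have \<mu>: "\<mu> \<in> packed (insert v U)" "\<mu> v \<notin> \<mu> ` U" by auto
    note \<mu>D = packedD[OF \<mu>(1)]
    let ?\<kappa> = "\<lambda>x\<in>U. close_gap (\<mu> v) (\<mu> x)"
    have neq: "\<mu> x \<noteq> \<mu> v" if "x \<in> U" for x using \<mu>(2) that by (metis imageI)
    have "split ?\<kappa> (\<mu> v) = \<mu>"
    proof
      show "split ?\<kappa> (\<mu> v) x = \<mu> x" for x
        using \<mu>D(1) open_close_gap[OF neq, of x] v_notin
        by (cases "x = v"; cases "x \<in> U") (auto simp: split_def extensional_def)
    qed
    then show s: "(case (?\<kappa>, \<mu> v) of (\<kappa>, p) \<Rightarrow> split \<kappa> p) = \<mu>" by simp
    define k where "k = card (\<mu> ` U)"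
    have "card (\<mu> ` insert v U) = Suc k" using \<mu>(2) finite_U by (simp add: k_def)
    then have im: "\<mu> ` insert v U = {1..Suc k}" using \<mu>D(2) by simp
    then have v: "\<mu> v \<in> {1..Suc k}" by blast
    \<comment> \<open>Without v exactly one color is missing; closing that gap makes the coloring
      packed again.\<close>
    have "\<mu> ` U = {1..Suc k} - {\<mu> v}" unfolding im[symmetric] using \<mu>(2) by auto
    then have "?\<kappa> ` U = {1..k}"
      using close_gap_image[OF v] by (simp add: image_image[of "close_gap (\<mu> v)" \<mu>, symmetric])
    moreover have "?\<kappa> x \<noteq> ?\<kappa> y" if "x \<in> U" "y \<in> U" "{x, y} \<in> E" for x y
      using \<mu>D(3)[of x y] that open_close_gap[OF neq[of x]] open_close_gap[OF neq[of y]]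
      by (metis insertI2 restrict_apply')
    ultimately have \<kappa>: "?\<kappa> \<in> packed U" and kk: "card (?\<kappa> ` U) = k"
      by (auto intro!: packedI)
    show "(?\<kappa>, \<mu> v) \<in> Sigma (packed U) (\<lambda>\<kappa>. {1..Suc (card (\<kappa> ` U))})"
      using \<kappa> v kk by blast
    show "(case (?\<kappa>, \<mu> v) of (\<kappa>, p) \<Rightarrow> signed_weight U \<kappa> * weight_at \<kappa> p) = signed_weight (insert v U) \<mu>"
      using weight[OF \<kappa>, of "\<mu> v"] v kk s by simp
  next
    fix q assume "q \<in> Sigma (packed U) (\<lambda>\<kappa>. {1..Suc (card (\<kappa> ` U))})"
    then obtain \<kappa> p where q: "q = (\<kappa>, p)" and \<kappa>: "\<kappa> \<in> packed U" and p: "p \<in> {1..Suc (card (\<kappa> ` U))}" by blast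
    note \<kappa>D = packedD[OF \<kappa>]
    have "(\<lambda>x\<in>U. close_gap (split \<kappa> p v) (split \<kappa> p x)) = \<kappa>"
    proof
      show "(\<lambda>x\<in>U. close_gap (split \<kappa> p v) (split \<kappa> p x)) x = \<kappa> x" for x
        using \<kappa>D(1) by (cases "x \<in> U") (auto simp: on_U at_v extensional_def)
    qed
    then show "(\<lambda>x\<in>U. close_gap ((case q of (\<kappa>, p) \<Rightarrow> split \<kappa> p) v) ((case q of (\<kappa>, p) \<Rightarrow> split \<kappa> p) x),
        (case q of (\<kappa>, p) \<Rightarrow> split \<kappa> p) v) = q"
      by (simp add: q at_v)
    have "split \<kappa> p \<in> packed (insert v U)"
    proof (rule packedI)
      show "split \<kappa> p \<in> extensional (insert v U)" by (simp add: split_def)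
      show "split \<kappa> p ` insert v U = {1..Suc (card (\<kappa> ` U))}" using image[OF \<kappa> p] .
      have "\<forall>u\<in>nbrs. split \<kappa> p v \<noteq> split \<kappa> p u"
      proof
        fix u assume "u \<in> nbrs"
        then have "u \<in> U" by (simp add: nbrs_def)
        then show "split \<kappa> p v \<noteq> split \<kappa> p u" using open_gap_neq[of p "\<kappa> u"] by (simp add: on_U at_v)
      qed
      moreover have "\<forall>x\<in>U. \<forall>y\<in>U. {x, y} \<in> E \<longrightarrow> split \<kappa> p x \<noteq> split \<kappa> p y"
        using \<kappa>D(3) close_open_gap by (metis on_U)
      ultimately show "split \<kappa> p x \<noteq> split \<kappa> p y"
        if "x \<in> insert v U" "y \<in> insert v U" "{x, y} \<in> E" for x y
        using that proper_insert_iff by blast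
    qed
    moreover have "p \<notin> open_gap p ` \<kappa> ` U" using open_gap_neq by (metis imageE)
    ultimately show "(case q of (\<kappa>, p) \<Rightarrow> split \<kappa> p) \<in> {\<mu>. \<mu> \<in> packed (insert v U) \<and> \<mu> v \<notin> \<mu> ` U}"
      by (simp add: q at_v image_U)
  qed
  also have "\<dots> = (\<Sum>\<kappa>\<in>packed U. \<Sum>p\<in>{1..Suc (card (\<kappa> ` U))}. signed_weight U \<kappa> * weight_at \<kappa> p)"
    using finite_U by (intro sum.Sigma[symmetric] finite_packed) auto
  finally show ?thesis by (simp only: sum_distrib_left)
qed

lemma packed_sum_insert:
  "packed_sum (insert v U) = q_int (Suc (card {u\<in>U. {v, u} \<in> E})) * packed_sum U"
proof -
  have "packed (insert v U) =
      {\<mu>. \<mu> \<in> packed (insert v U) \<and> \<mu> v \<in> \<mu> ` U} \<union> {\<mu>. \<mu> \<in> packed (insert v U) \<and> \<mu> v \<notin> \<mu> ` U}"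
    by blast
  then have "packed_sum (insert v U) =
      (\<Sum>\<mu> | \<mu> \<in> packed (insert v U) \<and> \<mu> v \<in> \<mu> ` U. signed_weight (insert v U) \<mu>) +
      (\<Sum>\<mu> | \<mu> \<in> packed (insert v U) \<and> \<mu> v \<notin> \<mu> ` U. signed_weight (insert v U) \<mu>)"
    unfolding packed_sum_def using finite_packed[of "insert v U"] finite_U
    by (subst sum.union_disjoint[symmetric]) auto
  also have "\<dots> = (\<Sum>\<kappa>\<in>packed U. signed_weight U \<kappa> *
      ((\<Sum>p\<in>{1..Suc (card (\<kappa> ` U))}. weight_at \<kappa> p) - (\<Sum>c\<in>\<kappa> ` U - \<kappa> ` nbrs. weight_at \<kappa> c)))"
    unfolding sum_joined sum_split by (simp only: right_diff_distrib sum_subtractf)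
  also have "\<dots> = (\<Sum>\<kappa>\<in>packed U. signed_weight U \<kappa> * q_int (Suc (card nbrs)))"
  proof (rule sum.cong[OF refl])
    fix \<kappa> assume \<kappa>: "\<kappa> \<in> packed U"
    have im: "\<kappa> ` U = {1..card (\<kappa> ` U)}" by (rule packedD(2)[OF \<kappa>])
    have "\<kappa> ` nbrs \<subseteq> \<kappa> ` U" by (auto simp: nbrs_def)
    then have "\<kappa> ` nbrs \<subseteq> {1..card (\<kappa> ` U)}" using im by simp
    from telescoping_gaps[OF this, of "monom (1::int)"]
    have "(\<Sum>p\<in>{1..Suc (card (\<kappa> ` U))}. weight_at \<kappa> p) -
        (\<Sum>c\<in>{1..card (\<kappa> ` U)} - \<kappa> ` nbrs. weight_at \<kappa> c) = q_int (Suc (card (\<kappa> ` nbrs)))"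
      unfolding weight_at_def q_int_def .
    \<comment> \<open>Because the neighbors have distinct colors, the factor does not depend on the
      coloring and can be pulled out of the sum.\<close>
    moreover have "card (\<kappa> ` nbrs) = card nbrs" using inj_on_nbrs[OF \<kappa>] by (rule card_image)
    ultimately show "signed_weight U \<kappa> *
      ((\<Sum>p\<in>{1..Suc (card (\<kappa> ` U))}. weight_at \<kappa> p) - (\<Sum>c\<in>\<kappa> ` U - \<kappa> ` nbrs. weight_at \<kappa> c)) =
      signed_weight U \<kappa> * q_int (Suc (card nbrs))"
      using im by simp
  qed
  also have "\<dots> = q_int (Suc (card nbrs)) * packed_sum U"
    by (simp add: packed_sum_def sum_distrib_right[symmetric] mult.commute)
  finally show ?thesis by (simp add: nbrs_def)
qed

end

text \<open>Vertices are inserted from the largest down: a new smallest vertex leaves the factors of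
  the larger ones unchanged, since each counts larger neighbors only.\<close>

lemma packed_sum_eq_prod:
  assumes "finite U" "U \<subseteq> V"
  shows "packed_sum U = (\<Prod>v\<in>U. q_int (Suc (card {u\<in>U. v < u \<and> {v, u} \<in> E})))"
  using assms
proof (induction U rule: finite_linorder_min_induct)
  case empty
  \<comment> \<open>On the empty set the only extensional function is constantly
    \<open>undefined\<close>, and its weight is 1.\<close>
  have "packed {} = {\<lambda>x. undefined}" by (auto simp: packed_def proper_colorings_def)
  then show ?case by (simp add: packed_sum_def signed_weight_def inv_on_def)
next
  case (insert v U)
  have v: "v \<notin> U" using insert by auto
  have "{u\<in>insert v U. x < u \<and> {x, u} \<in> E} = {u\<in>U. x < u \<and> {x, u} \<in> E}" if "x \<in> U" for x
    using insert that by auto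
  moreover have "{u\<in>insert v U. v < u \<and> {v, u} \<in> E} = {u\<in>U. {v, u} \<in> E}"
    using insert by auto
  ultimately have "(\<Prod>x\<in>insert v U. q_int (Suc (card {u\<in>insert v U. x < u \<and> {x, u} \<in> E}))) =
      q_int (Suc (card {u\<in>U. {v, u} \<in> E})) * (\<Prod>x\<in>U. q_int (Suc (card {u\<in>U. x < u \<and> {x, u} \<in> E})))"
    using insert.hyps(1) v by simp
  then show ?case using packed_sum_insert[of v U] insert by simp
qed

lemma sum_elementary_coeffs_chromatic_qsym:
  "(\<Sum>lam\<in>partitions (card V). elementary_coeffs (card V) (chromatic_qsym V E) lam) =
    (\<Prod>v\<in>V. q_int (Suc (card {u\<in>V. v < u \<and> {v, u} \<in> E})))"
  using sum_elementary_coeffs[OF sym_series_chromatic_qsym chromatic_qsym_homogeneous]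
  by (simp add: extrapolate_chromatic_qsym packed_sum_eq_prod finite_V)

end

section \<open>Comparing the three sums\<close>

context natural_unit_interval
begin

lemma interval_graph_inc: "interval_graph {1..n} (inc {1..n} P)"
proof
  show "{i, j} \<in> inc {1..n} P \<Longrightarrow> i \<in> {1..n} \<and> j \<in> {1..n} \<and> i \<noteq> j" for i j
    using inc_edgeD by blast
  show "{i', j'} \<in> inc {1..n} P"
    if "{i, j} \<in> inc {1..n} P" "i \<le> i'" "i' < j'" "j' \<le> j" for i j i' j'
    using inc_edge_interval that by blast
qed simp

lemma sum_phi:
  "(\<Sum>lam\<in>partitions n. phi n P lam) =
    (\<Prod>j=1..n. q_int (Suc (card {i\<in>{1..n}. j < i \<and> \<not> strictly_below P j i})))"
proof -
  have "{i\<in>{1..n}. j < i \<and> {j, i} \<in> inc {1..n} P} = {i\<in>{1..n}. j < i \<and> \<not> strictly_below P j i}"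
    if "j \<in> {1..n}" for j
    using inc_edge_iff that by blast
  then show ?thesis
    using interval_graph.sum_elementary_coeffs_chromatic_qsym[OF interval_graph_inc]
    by (simp add: phi_def)
qed

end

theorem proposition5p2:
  fixes n :: nat and P :: "nat rel"
  assumes "unit_interval_order {1..n} P"
    and "\<forall>i\<in>{1..n}. \<forall>j\<in>{1..n}. i \<le> j \<longrightarrow> beta {1..n} P i \<le> beta {1..n} P j"
  shows "(\<Sum>lam\<in>partitions n. phi n P lam)
           = (\<Sum>v | v permutes {1..n} \<and> bruhat_le n v (w_perm n P). monom 1 (coxeter_length n v))
       \<and> (\<Sum>v | v permutes {1..n} \<and> bruhat_le n v (w_perm n P). monom 1 (coxeter_length n v))
           = (\<Sum>U | U \<in> permutations_of_set {1..n} \<and> excedance_free P U. monom (1::int) (word_inv U))"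
proof -
  interpret natural_unit_interval n P
    using assms by (rule natural_unit_intervalI)
  show ?thesis
    using sum_phi sum_excedance_free sum_bruhat_eq_sum_excedance_free by simp
qed

end
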